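(* Let $d<k$, let $\Theta\subset\mathbb{R}^k$ be open, and let $\mathcal{P}=\{P_{\theta,G}: \theta\in\Theta,\ G\in\mathcal{G}\}$ be a regular semiparametric model (in the sense specified in the context) on a measurable space $(\mathcal{X},\mathcal{A})$, with efficient influence function $\tilde\ell(\cdot;\theta,G,\mathcal{P})$ for $\theta$ within $\mathcal{P}$ and efficient information matrix $I(\theta,G,\mathcal{P})$. Let $S:\mathbb{R}^k\to\mathbb{R}^d$ be continuously differentiable with $d\times k$ Jacobian matrix $\dot S(\cdot)$ that has full rank $d$ at every $\theta\in\Theta$, and let $$\mathcal{Q}=\{P_{\theta,G}: S(\theta)=0,\ \theta\in\Theta,\ G\in\mathcal{G}\}.$$ Let $X_1,\dots,X_n$ be i.i.d. with distribution $P\in\mathcal{P}$. Suppose that $\hat\theta_n=\hat\theta_n(X_1,\dots,X_n)$ is an efficient estimator of $\theta$ within $\mathcal{P}$, i.e. for every $P_{\theta,G}\in\mathcal{P}$ $$\sqrt n\Big(\hat\theta_n-\theta-\frac1n\sum_{i=1}^n\tilde\ell(X_i;\theta,G,\mathcal{P})\Big)\to 0\quad\text{in } P_{\theta,G}\text{-probability},$$ and that $\hat I_n=\hat I_n(X_1,\dots,X_n)$ is a consistent estimator of $I(\theta,G,\mathcal{P})$, i.e. $\hat I_n\to I(\theta,G,\mathcal{P})$ in $P_{\theta,G}$-probability for every $P_{\theta,G}\in\mathcal{P}$. Write $$\theta_n^*=\hat\theta_n-\hat I_n^{-1}\dot S^T(\hat\theta_n)\Big(\dot S(\hat\theta_n)\hat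 I_n^{-1}\dot S^T(\hat\theta_n)\Big)^{-1}S(\hat\theta_n)$$ and define $$\tilde\theta_n=\operatorname*{arg\,min}_{\zeta\in\mathbb{R}^k,\ S(\zeta)=0}\|\zeta-\theta_n^*\|,$$ where $\|\cdot\|$ is the Euclidean norm on $\mathbb{R}^k$ or a topologically equivalent norm. Then $\tilde\theta_n$ efficiently estimates $\theta$ within the submodel $\mathcal{Q}$, and the efficient influence function for $\theta$ within $\mathcal{Q}$ is, at every $P_{\theta,G}\in\mathcal{Q}$, $$\tilde\ell(\cdot;\theta,G,\mathcal{Q})=\tilde\ell(\cdot;\theta,G,\mathcal{P})-I^{-1}(\theta,G,\mathcal{P})\dot S^T(\theta)\Big(\dot S(\theta)I^{-1}(\theta,G,\mathcal{P})\dot S^T(\theta)\Big)^{-1}\dot S(\theta)\,\tilde\ell(\cdot;\theta,G,\mathcal{P}).$$ That is, this function is the efficient influence function for $\theta$ within $\mathcal{Q}$ at $P_{\theta,G}$, and for every $P_{\theta,G}\in\mathcal{Q}$ $$\sqrt n\Big(\tilde\theta_n-\theta-\frac1n\sum_{i=1}^n\tilde\ell(X_i;\theta,G,\mathcal{Q})\Big)\to0\quad\text{in } P_{\theta,G}\text{-probability}.$$ Hence, for every $P_{\theta,G}\in\mathcal{Q}$, writing $I=I(\theta,G,\mathcal{P})$ and $\dot S=\dot S(\theta)$, under $P_{\theta,G}$ $$\sqrt n(\tilde\theta_n-\theta)\ \text{converges in distribution to}\ \mathcal{N}\Big(0,\ I^{-1}-I^{-1}\dot S^T(\dot S I^{-1}\dot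 S^T)^{-1}\dot S I^{-1}\Big).$$ Furthermore, for every $P_{\theta,G}\in\mathcal{Q}$, $$\sqrt n(\tilde\theta_n-\theta_n^* )\to0\quad\text{in } P_{\theta,G}\text{-probability}.$$
   Context: **Setting.** $\Theta\subset\mathbb{R}^k$ is open, $\mathcal{G}$ is a set of nuisance parameters (typically a subset of a Banach or Hilbert space; finite-dimensional in the parametric case), and each $P_{\theta,G}$ is a probability measure on $(\mathcal{X},\mathcal{A})$. The parameter $\theta$ is regarded as a functional $P_{\theta,G}\mapsto\theta$ on $\mathcal{P}$. All limits are as $n\to\infty$. The submodel $\mathcal{Q}$ is nonempty. $L_2^0(P_0)=\{f\in L_2(P_0): E_{P_0}f(X)=0\}$. Projections of vector-valued functions are taken componentwise in $L_2^0(P_0)$. **Tangent spaces.** For a model $\mathcal{M}$ containing $P_0$, consider one-dimensional regular parametric submodels $\{P_\eta: |\eta|<\epsilon\}\subset\mathcal{M}$ through $P_0$ at $\eta=0$, with score $h\in L_2^0(P_0)$ at $\eta=0$. This means that, with $s_\eta$ the square root of the density of $P_\eta$ with respect to a dominating measure $\mu$, $\|s_\eta-s_0-\tfrac12\eta h s_0\|_{L_2(\mu)}=o(|\eta|)$ as $\eta\to0$. The tangent space $\dot{\mathcal{M}}$ of $\mathcal{M}$ at $P_0$ is the closed linear span in $L_2^0(P_0)$ of all such scores $h$. For $P_0=P_{\theta_0,G_0}$, $\dot{\mathcal{P}}_1$ and $\dot{\mathcal{P}}_2$ denote the tangent spaces at $P_0$ of $\mathcal{P}_1=\{P_{\theta,G_0}:\theta\in\Theta\}$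 and $\mathcal{P}_2=\{P_{\theta_0,G}:G\in\mathcal{G}\}$, respectively. **Efficient influence function.** The parameter $\theta$ is pathwise differentiable at $P_0$ within $\mathcal{M}$ (for $\mathcal{M}=\mathcal{P}$ or $\mathcal{M}=\mathcal{Q}$) if there is a $k$-vector $\psi$ of elements of $L_2^0(P_0)$ such that, for every one-dimensional regular parametric submodel $\{P_\eta\}\subset\mathcal{M}$ through $P_0$ with score $h$, the parameter values satisfy $(\theta(P_\eta)-\theta(P_0))/\eta\to E_{P_0}[\psi h]$ as $\eta\to0$. The unique such $\psi$ with all components in $\dot{\mathcal{M}}$ is the efficient influence function $\tilde\ell(\cdot;\theta_0,G_0,\mathcal{M})$ for $\theta$ within $\mathcal{M}$ at $P_0$. **Information matrix.** $I(\theta,G,\mathcal{P})$ is the efficient information matrix. It is the nonsingular $k\times k$ matrix with inverse (the information bound) $I^{-1}(\theta,G,\mathcal{P})=\int_{\mathcal{X}}\tilde\ell(x;\theta,G,\mathcal{P})\,\tilde\ell^T(x;\theta,G,\mathcal{P})\,dP_{\theta,G}(x)$. The efficient score function is $\ell^*(\cdot;\theta,G,\mathcal{P})=I(\theta,G,\mathcal{P})\,\tilde\ell(\cdot;\theta,G,\mathcal{P})$. **Regular semiparametric model.** $\mathcal{P}$ is assumed to satisfy the following at every $P_0=P_{\theta_0,G_0}\in\mathcal{P}$: (i) The parametric submodel $\mathcal{P}_1$ is regular. In particular, with $s(\theta)$ the square root of the density of $P_{\theta,G_0}$ with respect to a dominating measure $\mu$, there is a score function $\dot\ell=\dot\ell(\cdot;\theta_0,G_0,\mathcal{P})$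 with components in $L_2^0(P_0)$ such that $\|s(\theta)-s(\theta_0)-\tfrac12 s(\theta_0)(\theta-\theta_0)^T\dot\ell\|_{L_2(\mu)}=o(|\theta-\theta_0|)$ as $\theta\to\theta_0$. (ii) $\theta$ is pathwise differentiable within $\mathcal{P}$, and $I(\theta_0,G_0,\mathcal{P})$ exists and is nonsingular. (iii) $\dot{\mathcal{P}}=\dot{\mathcal{P}}_1+\dot{\mathcal{P}}_2$. (iv) The efficient score $\ell^*(\cdot;\theta_0,G_0,\mathcal{P})$ is the componentwise projection of $\dot\ell(\cdot;\theta_0,G_0,\mathcal{P})$ on the orthocomplement of $\dot{\mathcal{P}}_2$ within $\dot{\mathcal{P}}$. **Efficient estimator.** An estimator $T_n=T_n(X_1,\dots,X_n)$ of $\theta$ is called (asymptotically, semiparametrically) efficient within $\mathcal{M}$ if for every $P_{\theta,G}\in\mathcal{M}$ it is asymptotically linear in the efficient influence function, i.e. $\sqrt n\big(T_n-\theta-\frac1n\sum_{i=1}^n\tilde\ell(X_i;\theta,G,\mathcal{M})\big)\to0$ in $P_{\theta,G}$-probability. **Conventions.** The matrix inverses defining $\theta_n^*$ exist with probability tending to 1 under each $P_{\theta,G}\in\mathcal{P}$; where they do not exist, $\theta_n^*$ may be defined arbitrarily. If the minimizer defining $\tilde\theta_n$ is not unique, $\tilde\theta_n$ is any (measurable) choice of minimizer. *)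

theory Defs
  imports "HOL-Probability.Probability" "HOL-Library.Landau_Symbols"
begin

section \<open>Square-integrable functions\<close>

text \<open>Elements of an \<open>L\<^sub>2\<close> space are represented by functions; all sets of such functions
  defined below are closed under almost-everywhere equality.\<close>

definition L2_norm :: "'x measure \<Rightarrow> ('x \<Rightarrow> real) \<Rightarrow> real" where
  "L2_norm \<mu> f = sqrt (LINT x|\<mu>. (f x)\<^sup>2)"

definition L2_zero_mean :: "'x measure \<Rightarrow> ('x \<Rightarrow> real) set" where
  "L2_zero_mean N =
     {f \<in> borel_measurable N. integrable N (\<lambda>x. (f x)\<^sup>2) \<and> (LINT x|N. f x) = 0}"

definition L2_orthogonal :: "'x measure \<Rightarrow> ('x \<Rightarrow> real) \<Rightarrow> ('x \<Rightarrow> real) \<Rightarrow> bool" where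
  "L2_orthogonal N f g \<longleftrightarrow> (LINT x|N. f x * g x) = 0"

definition L2_projection ::
    "'x measure \<Rightarrow> ('x \<Rightarrow> real) set \<Rightarrow> ('x \<Rightarrow> real) \<Rightarrow> ('x \<Rightarrow> real) \<Rightarrow> bool" where
  "L2_projection N W f p \<longleftrightarrow> p \<in> W \<and> (\<forall>w\<in>W. L2_orthogonal N (\<lambda>x. f x - p x) w)"


section \<open>Regular submodels and tangent spaces\<close>

definition dominating :: "'x measure \<Rightarrow> 'x measure set \<Rightarrow> bool" where
  "dominating \<mu> \<M> \<longleftrightarrow> sigma_finite_measure \<mu> \<and>
     (\<forall>N\<in>\<M>. sets N = sets \<mu> \<and> absolutely_continuous \<mu> N)"

definition root_density :: "'x measure \<Rightarrow> 'x measure \<Rightarrow> 'x \<Rightarrow> real" where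
  "root_density \<mu> N x = sqrt (enn2real (RN_deriv \<mu> N x))"

text \<open>The function whose norm is taken below is always in \<open>L\<^sub>2(\<mu>)\<close>, because \<open>h \<in> L\<^sub>2(N\<^sub>0)\<close> and root
  densities are square integrable; the totalised Bochner integral is therefore harmless.\<close>

definition regular_path ::
    "'x measure set \<Rightarrow> 'x measure \<Rightarrow> real \<Rightarrow> (real \<Rightarrow> 'x measure) \<Rightarrow> ('x \<Rightarrow> real) \<Rightarrow> bool" where
  "regular_path \<M> N\<^sub>0 \<epsilon> N h \<longleftrightarrow>
     0 < \<epsilon> \<and> (\<forall>\<eta>. \<bar>\<eta>\<bar> < \<epsilon> \<longrightarrow> N \<eta> \<in> \<M>) \<and> N 0 = N\<^sub>0 \<and> h \<in> L2_zero_mean N\<^sub>0 \<and>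
     (\<exists>\<mu>. dominating \<mu> (N ` {-\<epsilon><..<\<epsilon>}) \<and>
       (\<lambda>\<eta>. L2_norm \<mu> (\<lambda>x. root_density \<mu> (N \<eta>) x - root_density \<mu> N\<^sub>0 x
                              - 1/2 * \<eta> * h x * root_density \<mu> N\<^sub>0 x))
         \<in> o[at 0](\<lambda>\<eta>. \<bar>\<eta>\<bar>))"

definition scores :: "'x measure set \<Rightarrow> 'x measure \<Rightarrow> ('x \<Rightarrow> real) set" where
  "scores \<M> N\<^sub>0 = {h. \<exists>\<epsilon> N. regular_path \<M> N\<^sub>0 \<epsilon> N h}"

text \<open>Closed linear span of the scores.\<close>

definition tangent_space :: "'x measure set \<Rightarrow> 'x measure \<Rightarrow> ('x \<Rightarrow> real) set" where
  "tangent_space \<M> N\<^sub>0 =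
     {f \<in> L2_zero_mean N\<^sub>0. \<forall>e>0. \<exists>T c. finite T \<and> T \<subseteq> scores \<M> N\<^sub>0 \<and>
        L2_norm N\<^sub>0 (\<lambda>x. f x - (\<Sum>h\<in>T. c h * h x)) < e}"


section \<open>Pathwise differentiability and efficient influence functions\<close>

definition pathwise_gradient ::
    "('x measure \<Rightarrow> real^'k) \<Rightarrow> 'x measure set \<Rightarrow> 'x measure \<Rightarrow> ('x \<Rightarrow> real^'k) \<Rightarrow> bool" where
  "pathwise_gradient \<phi> \<M> N\<^sub>0 \<psi> \<longleftrightarrow>
     (\<forall>i. (\<lambda>x. \<psi> x $ i) \<in> L2_zero_mean N\<^sub>0) \<and>
     (\<forall>\<epsilon> N h. regular_path \<M> N\<^sub>0 \<epsilon> N h \<longrightarrow>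
        ((\<lambda>\<eta>. (\<phi> (N \<eta>) - \<phi> N\<^sub>0) /\<^sub>R \<eta>) \<longlongrightarrow> (LINT x|N\<^sub>0. h x *\<^sub>R \<psi> x)) (at 0))"

text \<open>A predicate, because the efficient influence function is unique only up to
  almost-everywhere equality.\<close>

definition efficient_influence_function ::
    "('x measure \<Rightarrow> real^'k) \<Rightarrow> 'x measure set \<Rightarrow> 'x measure \<Rightarrow> ('x \<Rightarrow> real^'k) \<Rightarrow> bool" where
  "efficient_influence_function \<phi> \<M> N\<^sub>0 \<psi> \<longleftrightarrow>
     pathwise_gradient \<phi> \<M> N\<^sub>0 \<psi> \<and> (\<forall>i. (\<lambda>x. \<psi> x $ i) \<in> tangent_space \<M> N\<^sub>0)"

text \<open>In the next three definitions \<open>\<psi>\<close> is the efficient influence function at \<open>N\<close>.\<close>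

definition information_bound :: "'x measure \<Rightarrow> ('x \<Rightarrow> real^'k) \<Rightarrow> real^'k^'k" where
  "information_bound N \<psi> = (\<chi> i j. LINT x|N. \<psi> x $ i * \<psi> x $ j)"

definition efficient_information :: "'x measure \<Rightarrow> ('x \<Rightarrow> real^'k) \<Rightarrow> real^'k^'k" where
  "efficient_information N \<psi> = matrix_inv (information_bound N \<psi>)"

definition efficient_score :: "'x measure \<Rightarrow> ('x \<Rightarrow> real^'k) \<Rightarrow> 'x \<Rightarrow> real^'k" where
  "efficient_score N \<psi> x = efficient_information N \<psi> *v \<psi> x"


section \<open>Regular semiparametric models\<close>

definition submodel :: "(real^'k \<Rightarrow> 'g \<Rightarrow> 'x measure) \<Rightarrow> (real^'k) set \<Rightarrow> 'g set \<Rightarrow> 'x measure set"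
  where "submodel P T H = {P \<theta> G |\<theta> G. \<theta> \<in> T \<and> G \<in> H}"

definition parameter ::
    "(real^'k \<Rightarrow> 'g \<Rightarrow> 'x measure) \<Rightarrow> (real^'k) set \<Rightarrow> 'g set \<Rightarrow> 'x measure \<Rightarrow> real^'k" where
  "parameter P \<Theta> \<G> N = (THE \<theta>. \<theta> \<in> \<Theta> \<and> (\<exists>G\<in>\<G>. N = P \<theta> G))"

definition score_function ::
    "(real^'k \<Rightarrow> 'x measure) \<Rightarrow> (real^'k) set \<Rightarrow> real^'k \<Rightarrow> ('x \<Rightarrow> real^'k) \<Rightarrow> bool" where
  "score_function F \<Theta> \<theta>\<^sub>0 l \<longleftrightarrow>
     (\<forall>i. (\<lambda>x. l x $ i) \<in> L2_zero_mean (F \<theta>\<^sub>0)) \<and>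
     (\<exists>\<mu>. dominating \<mu> (F ` \<Theta>) \<and>
       (\<lambda>\<theta>. L2_norm \<mu> (\<lambda>x. root_density \<mu> (F \<theta>) x - root_density \<mu> (F \<theta>\<^sub>0) x
                              - 1/2 * root_density \<mu> (F \<theta>\<^sub>0) x * ((\<theta> - \<theta>\<^sub>0) \<bullet> l x)))
         \<in> o[at \<theta>\<^sub>0](\<lambda>\<theta>. norm (\<theta> - \<theta>\<^sub>0)))"

text \<open>\<open>X\<close> only carries the measurable space; its measure is irrelevant. Identifiability of \<open>\<theta>\<close> is
  what makes it a functional of the distribution. The score function being unique almost
  everywhere, the last assumption concerns a single element of \<open>L\<^sub>2\<close>.\<close>

locale regular_semiparametric_model =
  fixes X :: "'x measure" and \<Theta> :: "(real^'k) set" and \<G> :: "'g set"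
    and P :: "real^'k \<Rightarrow> 'g \<Rightarrow> 'x measure"
    and ell :: "real^'k \<Rightarrow> 'g \<Rightarrow> 'x \<Rightarrow> real^'k"
  assumes open_parameters: "open \<Theta>"
    and prob: "\<And>\<theta> G. \<theta> \<in> \<Theta> \<Longrightarrow> G \<in> \<G> \<Longrightarrow> prob_space (P \<theta> G)"
    and sets_eq: "\<And>\<theta> G. \<theta> \<in> \<Theta> \<Longrightarrow> G \<in> \<G> \<Longrightarrow> sets (P \<theta> G) = sets X"
    and identifiable: "\<And>\<theta> \<theta>' G G'. \<theta> \<in> \<Theta> \<Longrightarrow> \<theta>' \<in> \<Theta> \<Longrightarrow> G \<in> \<G> \<Longrightarrow> G' \<in> \<G> \<Longrightarrow>
          P \<theta> G = P \<theta>' G' \<Longrightarrow> \<theta> = \<theta>'"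
    and regular_parametric: "\<And>\<theta> G. \<theta> \<in> \<Theta> \<Longrightarrow> G \<in> \<G> \<Longrightarrow>
          \<exists>l. score_function (\<lambda>\<theta>'. P \<theta>' G) \<Theta> \<theta> l"
    and eif: "\<And>\<theta> G. \<theta> \<in> \<Theta> \<Longrightarrow> G \<in> \<G> \<Longrightarrow>
          efficient_influence_function (parameter P \<Theta> \<G>) (submodel P \<Theta> \<G>) (P \<theta> G) (ell \<theta> G)"
    and information_exists: "\<And>\<theta> G. \<theta> \<in> \<Theta> \<Longrightarrow> G \<in> \<G> \<Longrightarrow>
          invertible (information_bound (P \<theta> G) (ell \<theta> G))"
    and tangent_space_sum: "\<And>\<theta> G. \<theta> \<in> \<Theta> \<Longrightarrow> G \<in> \<G> \<Longrightarrow>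
          tangent_space (submodel P \<Theta> \<G>) (P \<theta> G) =
            {\<lambda>x. f x + g x |f g. f \<in> tangent_space (submodel P \<Theta> {G}) (P \<theta> G) \<and>
                                 g \<in> tangent_space (submodel P {\<theta>} \<G>) (P \<theta> G)}"
    and efficient_score_projection: "\<And>\<theta> G l i. \<theta> \<in> \<Theta> \<Longrightarrow> G \<in> \<G> \<Longrightarrow>
          score_function (\<lambda>\<theta>'. P \<theta>' G) \<Theta> \<theta> l \<Longrightarrow>
          L2_projection (P \<theta> G)
            {f \<in> tangent_space (submodel P \<Theta> \<G>) (P \<theta> G).
               \<forall>g \<in> tangent_space (submodel P {\<theta>} \<G>) (P \<theta> G). L2_orthogonal (P \<theta> G) f g}
            (\<lambda>x. l x $ i)
            (\<lambda>x. efficient_score (P \<theta> G) (ell \<theta> G) x $ i)"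


section \<open>Asymptotics\<close>

text \<open>Law of an i.i.d. sample of size \<open>n\<close> from \<open>N\<close>. A statistic \<open>T\<^sub>n(X\<^sub>1, \<dots>, X\<^sub>n)\<close> is a function
  on the sample space, with indices starting at \<open>0\<close>.\<close>

definition sample :: "'x measure \<Rightarrow> nat \<Rightarrow> (nat \<Rightarrow> 'x) measure" where
  "sample N n = (\<Pi>\<^sub>M i\<in>{..<n}. N)"

text \<open>Measurability is part of the two notions of convergence, since \<^const>\<open>measure\<close> and the Bochner
  integral are \<open>0\<close> on nonmeasurable arguments. The spaces may change with \<open>n\<close>.\<close>

definition tendsto_in_prob ::
    "(nat \<Rightarrow> 's measure) \<Rightarrow> (nat \<Rightarrow> 's \<Rightarrow> 'b::euclidean_space) \<Rightarrow> 'b \<Rightarrow> bool" where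
  "tendsto_in_prob N Y c \<longleftrightarrow> (\<forall>n. Y n \<in> borel_measurable (N n)) \<and>
     (\<forall>e>0. (\<lambda>n. measure (N n) {\<omega> \<in> space (N n). e < dist (Y n \<omega>) c}) \<longlonglongrightarrow> 0)"

definition tendsto_in_distribution ::
    "(nat \<Rightarrow> 's measure) \<Rightarrow> (nat \<Rightarrow> 's \<Rightarrow> 'b::euclidean_space) \<Rightarrow> 'b measure \<Rightarrow> bool" where
  "tendsto_in_distribution N Y \<nu> \<longleftrightarrow> (\<forall>n. Y n \<in> borel_measurable (N n)) \<and>
     (\<forall>f::'b \<Rightarrow> real. continuous_on UNIV f \<longrightarrow> bounded (range f) \<longrightarrow>
        (\<lambda>n. LINT \<omega>|N n. f (Y n \<omega>)) \<longlonglongrightarrow> (LINT y|\<nu>. f y))"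

text \<open>Law of \<open>m + A Z\<close> with \<open>A A\<^sup>T = \<Sigma>\<close> and \<open>Z\<close> standard normal; it does not depend on the choice of
  \<open>A\<close>. The covariance \<open>\<Sigma>\<close> may be singular but must be positive semidefinite.\<close>

definition multivariate_normal :: "real^'k \<Rightarrow> real^'k^'k \<Rightarrow> (real^'k) measure" where
  "multivariate_normal m \<Sigma> =
     distr (\<Pi>\<^sub>M i\<in>(UNIV :: 'k set). std_normal_distribution) borel
       (\<lambda>z. m + (SOME A :: real^'k^'k. A ** transpose A = \<Sigma>) *v (\<chi> i. z i))"

definition asymptotically_linear ::
    "'x measure \<Rightarrow> (nat \<Rightarrow> (nat \<Rightarrow> 'x) \<Rightarrow> real^'k) \<Rightarrow> real^'k \<Rightarrow> ('x \<Rightarrow> real^'k) \<Rightarrow> bool" where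
  "asymptotically_linear N T \<theta> \<psi> \<longleftrightarrow>
     tendsto_in_prob (sample N)
       (\<lambda>n x. sqrt (real n) *\<^sub>R (T n x - \<theta> - (1 / real n) *\<^sub>R (\<Sum>i<n. \<psi> (x i)))) 0"


section \<open>The constrained estimator\<close>

text \<open>The matrix \<open>J\<^sup>-\<^sup>1 D\<^sup>T (D J\<^sup>-\<^sup>1 D\<^sup>T)\<^sup>-\<^sup>1\<close>.\<close>

definition constraint_gain :: "real^'k^'d \<Rightarrow> real^'k^'k \<Rightarrow> real^'d^'k" where
  "constraint_gain D J =
     matrix_inv J ** transpose D ** matrix_inv (D ** matrix_inv J ** transpose D)"

definition gain_inverses_exist :: "real^'k^'d \<Rightarrow> real^'k^'k \<Rightarrow> bool" where
  "gain_inverses_exist D J \<longleftrightarrow>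
     invertible J \<and> invertible (D ** matrix_inv J ** transpose D)"

definition equivalent_norm :: "('b::real_normed_vector \<Rightarrow> real) \<Rightarrow> bool" where
  "equivalent_norm \<nu> \<longleftrightarrow>
     (\<forall>x. \<nu> x = 0 \<longleftrightarrow> x = 0) \<and> (\<forall>c x. \<nu> (c *\<^sub>R x) = \<bar>c\<bar> * \<nu> x) \<and> (\<forall>x y. \<nu> (x + y) \<le> \<nu> x + \<nu> y) \<and>
     (\<exists>a>0. \<exists>b>0. \<forall>x. a * norm x \<le> \<nu> x \<and> \<nu> x \<le> b * norm x)"

end

theory Submission
  imports Defs
begin

text \<open>Along every regular path in the constrained model the derivative of the parameter lies in the kernel of
  \<open>D = \<nabla>S(\<theta>)\<close>, on which \<open>M = 1 - K D\<close> is the identity; hence \<open>M \<psi>\<close> is a gradient whenever \<open>\<psi>\<close> is. It is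
  tangent to the constrained model because it is a combination of efficient scores with coefficient
  vectors in the kernel of \<open>D\<close>: each efficient score is the ordinary score plus a nuisance tangent,
  and \<open>v \<bullet> l\<close> with \<open>D v = 0\<close> is the score of a curve inside the level set of \<open>S\<close>.
  For the estimator, a first-order expansion gives \<open>\<theta>\<^sup>* - \<theta> = M (\<theta>\<^sub>n - \<theta>)\<close> up to a term negligible at rate
  \<open>1 / \<surd>n\<close>, where \<open>\<theta>\<^sub>n\<close> is the unconstrained efficient estimator. So \<open>\<theta>\<^sup>*\<close> is negligibly close to the tangent
  space of the level set, and therefore to the level set itself. The normal limit follows from the
  one-dimensional central limit theorem through the functions \<open>cos (t \<bullet> x + c)\<close>.\<close>

section \<open>Matrices\<close>

text \<open>The gradient property would survive with any matrix in place of the gain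
  \<open>K\<close>; tangency is what singles it out. Let \<open>B\<close> be the covariance of
  \<open>\<psi>\<close>, the inverse information. Then \<open>M \<psi>\<close> is \<open>M B\<close>
  applied to the efficient score, so the coefficient vectors are the rows of \<open>M B\<close>.
  Since \<open>D M = 0\<close>, the columns of \<open>M B\<close> lie in the kernel of
  \<open>D\<close>, and tangency follows once \<open>M B\<close> is symmetric. Among right inverses
  of \<open>D\<close>, this symmetry forces \<open>K = B D^T (D B D^T)^-1\<close>. It also collapses
  the limiting covariance \<open>M B M^T\<close> to \<open>M B\<close>.

  The decomposition of the efficient score is not among the assumptions, which only describe a
  projection. Extracting it requires that the parametric tangent space be spanned by the ordinary
  score, hence that every path inside that submodel has its score there. The obstacle is that the
  path and the score function may be expanded with respect to unrelated dominating measures.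

  The two estimates behind the estimator are deterministic and uniform over all arguments in a
  shrinking neighbourhood, so that they can be applied at each sample point separately.\<close>

lemma matrix_inv_unique:
  fixes A :: "'a::semiring_1^'n^'m"
  assumes "A ** B = mat 1" "B ** A = mat 1"
  shows "matrix_inv A = B"
proof -
  have "A ** matrix_inv A = mat 1 \<and> matrix_inv A ** A = mat 1"
    unfolding matrix_inv_def by (rule someI[where x = B]) (use assms in simp)
  then show ?thesis
    by (metis assms(2) matrix_mul_assoc matrix_mul_lid matrix_mul_rid)
qed

lemma
  fixes A :: "'a::semiring_1^'n^'m"
  assumes "invertible A"
  shows matrix_inv_right: "A ** matrix_inv A = mat 1"
    and matrix_inv_left: "matrix_inv A ** A = mat 1"
proof -
  obtain B where "A ** B = mat 1" "B ** A = mat 1"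
    using assms unfolding invertible_def by blast
  with matrix_inv_unique[OF this] show "A ** matrix_inv A = mat 1" "matrix_inv A ** A = mat 1"
    by simp_all
qed

lemma matrix_inv_matrix_inv: "invertible A \<Longrightarrow> matrix_inv (matrix_inv A) = A"
  by (simp add: matrix_inv_left matrix_inv_right matrix_inv_unique)

lemma invertible_matrix_inv: "invertible A \<Longrightarrow> invertible (matrix_inv A)"
  unfolding invertible_def[of "matrix_inv A"] using matrix_inv_left matrix_inv_right by blast

lemma invertible_if_ker:
  fixes A :: "real^'n^'n"
  assumes "\<And>x. A *v x = 0 \<Longrightarrow> x = 0"
  shows "invertible A"
  using assms invertible_left_inverse matrix_left_invertible_ker by blast

lemma transpose_matrix_inv:
  fixes A :: "real^'n^'n"
  assumes "invertible A" "transpose A = A"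
  shows "transpose (matrix_inv A) = matrix_inv A"
  by (metis assms matrix_inv_left matrix_inv_right matrix_inv_unique matrix_transpose_mul transpose_mat)

lemma matrix_diff_ldistrib: "A ** (B - C) = A ** B - A ** (C :: real^'n^'m)"
  by (vector matrix_matrix_mult_def sum_subtractf right_diff_distrib)

lemma matrix_diff_rdistrib: "(B - C) ** A = B ** A - (C :: real^'n^'m) ** A"
  by (vector matrix_matrix_mult_def sum_subtractf left_diff_distrib)

lemma transpose_diff: "transpose (A - B) = transpose A - transpose (B :: real^'n^'m)"
  by (simp add: transpose_def vec_eq_iff)

lemma norm_matrix_vector_mult_le: "norm (A *v x) \<le> norm A * norm (x :: real^'n)"
proof -
  have "norm (A *v x) \<le> L2_set (\<lambda>i. norm (A $ i) * norm x) UNIV"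
    unfolding norm_vec_def[of "A *v x"]
    by (intro L2_set_mono) (auto simp: matrix_vector_mul_component Cauchy_Schwarz_ineq2)
  also have "\<dots> = norm A * norm x"
    unfolding norm_vec_def[of A] by (simp add: L2_set_left_distrib)
  finally show ?thesis .
qed

section \<open>Continuity of matrix operations, including inversion\<close>

lemma tendsto_matrix_mult [tendsto_intros]:
  fixes A :: "'a \<Rightarrow> real^'n^'m" and B :: "'a \<Rightarrow> real^'p^'n"
  assumes "(A \<longlongrightarrow> a) F" "(B \<longlongrightarrow> b) F"
  shows "((\<lambda>x. A x ** B x) \<longlongrightarrow> a ** b) F"
  unfolding matrix_matrix_mult_def using assms by (intro tendsto_intros)

lemma tendsto_matrix_vector_mult [tendsto_intros]:
  fixes A :: "'a \<Rightarrow> real^'n^'m" and v :: "'a \<Rightarrow> real^'n"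
  assumes "(A \<longlongrightarrow> a) F" "(v \<longlongrightarrow> b) F"
  shows "((\<lambda>x. A x *v v x) \<longlongrightarrow> a *v b) F"
  unfolding matrix_vector_mult_def using assms by (intro tendsto_intros)

lemma tendsto_transpose [tendsto_intros]:
  fixes A :: "'a \<Rightarrow> real^'n^'m"
  assumes "(A \<longlongrightarrow> a) F"
  shows "((\<lambda>x. transpose (A x)) \<longlongrightarrow> transpose a) F"
  unfolding transpose_def using assms by (intro tendsto_intros)

lemma tendsto_det [tendsto_intros]:
  fixes A :: "'a \<Rightarrow> real^'n^'n"
  assumes "(A \<longlongrightarrow> a) F"
  shows "((\<lambda>x. det (A x)) \<longlongrightarrow> det a) F"
  unfolding det_def using assms by (intro tendsto_intros)

lemma eventually_invertible:
  fixes A :: "'a \<Rightarrow> real^'n^'n"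
  assumes "(A \<longlongrightarrow> a) F" "invertible a"
  shows "\<forall>\<^sub>F x in F. invertible (A x)"
  using tendsto_imp_eventually_ne[OF tendsto_det[OF assms(1)], of 0] assms(2)
  by (simp add: invertible_det_nz)

text \<open>Column \<open>l\<close> of the inverse solves a linear system with right-hand side
  \<open>axis l 1\<close>. Writing every entry as a quotient of determinants reduces continuity of
  inversion to that of \<open>det\<close>.\<close>

lemma matrix_inv_cramer:
  fixes A :: "real^'n^'n"
  assumes "invertible A"
  shows "matrix_inv A = (\<chi> k l. det (\<chi> i j. if j = k then axis l 1 $ i else A $ i $ j) / det A)"
proof -
  have "A *v column l (matrix_inv A) = axis l 1" for l
    by (simp add: matrix_vector_mult_basis[symmetric] matrix_vector_mul_assoc matrix_inv_right assms)
  then have "column l (matrix_inv A)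
      = (\<chi> k. det (\<chi> i j. if j = k then axis l 1 $ i else A $ i $ j) / det A)" for l
    using cramer[of A "column l (matrix_inv A)" "axis l 1"] assms by (simp add: invertible_det_nz)
  then show ?thesis
    by (auto simp: vec_eq_iff column_def)
qed

lemma tendsto_matrix_inv:
  fixes A :: "'a \<Rightarrow> real^'n^'n"
  assumes A: "(A \<longlongrightarrow> a) F" and a: "invertible a"
  shows "((\<lambda>x. matrix_inv (A x)) \<longlongrightarrow> matrix_inv a) F"
proof (rule Lim_transform_eventually)
  have "((\<lambda>x. (\<chi> i j. if j = k then axis l 1 $ i else A x $ i $ j) :: real^'n^'n)
      \<longlongrightarrow> (\<chi> i j. if j = k then axis l 1 $ i else a $ i $ j)) F" for k l
  proof (intro tendsto_vec_lambda)
    show "((\<lambda>x. if j = k then axis l 1 $ i else A x $ i $ j)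
      \<longlongrightarrow> (if j = k then axis l 1 $ i else a $ i $ j)) F" for i j
      using tendsto_vec_nth[OF tendsto_vec_nth[OF A]] by simp
  qed
  note minors = this
  show "((\<lambda>x. \<chi> k l. det (\<chi> i j. if j = k then axis l 1 $ i else A x $ i $ j) / det (A x))
      \<longlongrightarrow> matrix_inv a) F"
    unfolding matrix_inv_cramer[OF a]
    using a by (intro tendsto_vec_lambda tendsto_divide tendsto_det minors A) (simp add: invertible_det_nz)
  show "\<forall>\<^sub>F x in F. (\<chi> k l. det (\<chi> i j. if j = k then axis l 1 $ i else A x $ i $ j) / det (A x))
      = matrix_inv (A x)"
    using eventually_invertible[OF A a] by eventually_elim (simp add: matrix_inv_cramer)
qed

text \<open>Evaluation at the critical point \<open>t = - c / b\<close>. It serves both the Schur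
  complement inequality for semidefinite matrices and the Cauchy-Schwarz inequality for
  square-integrable functions.\<close>

lemma discriminant_nonpos:
  fixes a b c :: real
  assumes "\<And>t. 0 \<le> a + 2 * t * c + t\<^sup>2 * b" "0 \<le> b"
  shows "c\<^sup>2 \<le> a * b"
proof (cases "b = 0")
  case True
  have "c = 0"
  proof (rule ccontr)
    assume "c \<noteq> 0"
    \<comment> \<open>With \<open>b = 0\<close> the quadratic is affine in \<open>t\<close>, and at
      this point its value is -1.\<close>
    then show False
      using assms(1)[of "- (a + 1) / (2 * c)"] True by (simp add: field_simps)
  qed
  with True show ?thesis by simp
next
  case False
  with assms(2) have "0 < b" by simp
  with assms(1)[of "- c / b"] show ?thesis
    by (simp add: field_simps power2_eq_square)
qed

text \<open>Outer-product form of the Cholesky factorization: subtracting the rank-one matrix built from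
  column \<open>j\<close> clears row and column \<open>j\<close> and leaves the Schur complement.\<close>

lemma psd_sum_outer:
  fixes M :: "real^'n^'n"
  assumes "finite J" "transpose M = M" "\<And>x. 0 \<le> x \<bullet> (M *v x)"
    "\<And>i j. i \<notin> J \<Longrightarrow> M $ i $ j = 0"
  shows "\<exists>v :: 'n \<Rightarrow> real^'n. \<forall>a b. M $ a $ b = (\<Sum>j\<in>J. v j $ a * v j $ b)"
  using assms
proof (induction J arbitrary: M rule: finite_induct)
  case empty
  then show ?case by auto
next
  case (insert j J)
  have sym: "M $ a $ b = M $ b $ a" for a b
    using insert.prems(1) by (metis transpose_def vec_lambda_beta)
  have quad: "(x + t *\<^sub>R axis j 1) \<bullet> (M *v (x + t *\<^sub>R axis j 1))
      = x \<bullet> (M *v x) + 2 * t * (M *v x) $ j + t\<^sup>2 * M $ j $ j" for x t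
  proof -
    have "x \<bullet> (M *v axis j 1) = (M *v x) $ j"
      by (metis dot_lmul_matrix inner_axis' insert.prems(1) mult_1 inner_real_def inner_commute
          vector_transpose_matrix real_inner_1_right)
    moreover have "axis j 1 \<bullet> (M *v y) = (M *v y) $ j" for y
      by (simp add: inner_axis')
    moreover have "(M *v axis j 1) $ j = M $ j $ j"
      by (simp add: matrix_vector_mult_basis column_def)
    ultimately show ?thesis
      by (simp add: matrix_vector_right_distrib matrix_vector_mult_scaleR inner_simps power2_eq_square algebra_simps)
  qed
  have Mjj: "0 \<le> M $ j $ j"
    using insert.prems(2)[of "axis j 1"]
    by (simp add: inner_axis' matrix_vector_mult_basis column_def)
  \<comment> \<open>The form is nonnegative along the line through \<open>x\<close> in direction
    \<open>axis j 1\<close>; its discriminant in \<open>t\<close> gives the Cauchy-Schwarz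
    inequality that keeps the Schur complement \<open>N\<close> nonnegative.\<close>
  have schur: "((M *v x) $ j)\<^sup>2 \<le> M $ j $ j * (x \<bullet> (M *v x))" for x
  proof -
    have *: "0 \<le> x \<bullet> (M *v x) + 2 * t * (M *v x) $ j + t\<^sup>2 * M $ j $ j" for t
      using insert.prems(2)[of "x + t *\<^sub>R axis j 1"] quad by simp
    show ?thesis
      using discriminant_nonpos[OF * Mjj] by (simp add: mult.commute)
  qed
  \<comment> \<open>If the pivot \<open>M $ j $ j\<close> is 0, division by zero makes
    \<open>w = 0\<close> and \<open>N = M\<close>; the fact \<open>zero\<close> below shows that row
    \<open>j\<close> was then already clear.\<close>
  define w where "w = (1 / sqrt (M $ j $ j)) *\<^sub>R column j M"
  define N where "N = (\<chi> a b. M $ a $ b - w $ a * w $ b)"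
  have ww: "w $ a * w $ b = M $ a $ j * M $ b $ j / M $ j $ j" for a b
    using Mjj by (simp add: w_def column_def)
  have zero: "M $ j $ j = 0 \<Longrightarrow> M $ j $ b = 0" for b
    using schur[of "axis b 1"] by (simp add: matrix_vector_mult_basis column_def)
  have "\<exists>v. \<forall>a b. N $ a $ b = (\<Sum>j\<in>J. v j $ a * v j $ b)"
  proof (rule insert.IH)
    show "transpose N = N"
      by (simp add: N_def transpose_def vec_eq_iff sym)
    show "0 \<le> x \<bullet> (N *v x)" for x
    proof -
      have wx: "w \<bullet> x = (M *v x) $ j / sqrt (M $ j $ j)"
        by (simp add: w_def column_def inner_vec_def matrix_vector_mult_def sym sum_divide_distrib)
      have "N *v x = M *v x - (w \<bullet> x) *\<^sub>R w"
        by (simp add: N_def matrix_vector_mult_def vec_eq_iff inner_vec_def sum_subtractf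
            left_diff_distrib sum_distrib_left sum_distrib_right right_diff_distrib mult_ac)
      then have "x \<bullet> (N *v x) = x \<bullet> (M *v x) - (w \<bullet> x)\<^sup>2"
        by (simp add: inner_simps power2_eq_square inner_commute)
      also have "\<dots> = x \<bullet> (M *v x) - ((M *v x) $ j)\<^sup>2 / M $ j $ j"
        using Mjj by (simp add: wx power_divide)
      also have "\<dots> \<ge> 0"
        using schur[of x] Mjj insert.prems(2)[of x]
        by (cases "M $ j $ j = 0") (simp_all add: field_simps)
      finally show ?thesis .
    qed
    show "N $ a $ b = 0" if "a \<notin> J" for a b
    proof (cases "a = j")
      case True
      then show ?thesis using zero[of b] sym[of b j] by (cases "M $ j $ j = 0") (auto simp: N_def ww)
    next
      case False
      then show ?thesis using that insert.prems(3) by (simp add: N_def ww)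
    qed
  qed
  then obtain v where v: "\<And>a b. N $ a $ b = (\<Sum>j\<in>J. v j $ a * v j $ b)" by blast
  show ?case
  proof (intro exI[of _ "v(j := w)"] allI)
    fix a b
    have "(\<Sum>i\<in>J. (v(j := w)) i $ a * (v(j := w)) i $ b) = N $ a $ b"
      unfolding v using insert.hyps by (intro sum.cong) auto
    then show "M $ a $ b = (\<Sum>i\<in>insert j J. (v(j := w)) i $ a * (v(j := w)) i $ b)"
      using insert.hyps by (simp add: N_def)
  qed
qed

lemma psd_factorization:
  fixes M :: "real^'n^'n"
  assumes "transpose M = M" "\<And>x. 0 \<le> x \<bullet> (M *v x)"
  obtains A :: "real^'n^'n" where "A ** transpose A = M"
proof -
  obtain v :: "'n \<Rightarrow> real^'n" where "\<forall>a b. M $ a $ b = (\<Sum>j\<in>UNIV. v j $ a * v j $ b)"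
    using psd_sum_outer[of UNIV M] assms by auto
  then have "(\<chi> a j. v j $ a) ** transpose (\<chi> a j. v j $ a) = M"
    by (simp add: matrix_matrix_mult_def transpose_def vec_eq_iff)
  then show thesis by (rule that)
qed

section \<open>Algebra of the constraint gain\<close>

lemma invertible_gram:
  fixes D :: "real^'k^'d" and B :: "real^'k^'k"
  assumes "rank D = CARD('d)" "\<And>x. x \<noteq> 0 \<Longrightarrow> 0 < x \<bullet> (B *v x)"
  shows "invertible (D ** B ** transpose D)"
proof (rule invertible_if_ker)
  fix x assume x: "(D ** B ** transpose D) *v x = 0"
  let ?y = "transpose D *v x"
  have "?y \<bullet> (B *v ?y) = x \<bullet> ((D ** B ** transpose D) *v x)"
    by (simp only: matrix_vector_mul_assoc[symmetric] transpose_matrix_vector dot_lmul_matrix)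
  then have "?y = 0"
    using assms(2)[of ?y] x by fastforce
  moreover have "inj ((*v) (transpose D))"
    using assms(1) by (simp add: full_rank_injective[symmetric] rank_transpose)
  ultimately show "x = 0"
    by (metis injD matrix_vector_mult_0_right)
qed

text \<open>Here \<open>B\<close> is a covariance and its inverse the information, so
  \<open>K = B D^T (D B D^T)^-1\<close> is a right inverse of \<open>D\<close>, and
  \<open>M = mat 1 - K ** D\<close> is the projection onto the kernel of \<open>D\<close> that is
  orthogonal for the inner product given by the inverse of \<open>B\<close>. Symmetry holds because
  \<open>K D B\<close> reads the same backwards. The last identity holds because
  \<open>M B D^T\<close> is the transpose of \<open>D M B = 0\<close>, so the \<open>K\<close>-term
  of the right-hand factor drops out.\<close>

lemma
  fixes D :: "real^'k^'d" and B :: "real^'k^'k"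
  assumes full_rank: "rank D = CARD('d)" and B: "invertible B" "transpose B = B"
    and pos: "\<And>x. x \<noteq> 0 \<Longrightarrow> 0 < x \<bullet> (B *v x)"
  defines "K \<equiv> constraint_gain D (matrix_inv B)"
  shows constraint_gain_inverses_exist: "gain_inverses_exist D (matrix_inv B)"
    and constraint_gain_complement: "D ** (mat 1 - K ** D) = 0"
    and constraint_gain_symmetric: "transpose ((mat 1 - K ** D) ** B) = (mat 1 - K ** D) ** B"
    and constraint_gain_idempotent:
      "(mat 1 - K ** D) ** B ** transpose (mat 1 - K ** D) = (mat 1 - K ** D) ** B"
proof -
  have gram: "invertible (D ** B ** transpose D)"
    by (rule invertible_gram[OF full_rank pos])
  then show "gain_inverses_exist D (matrix_inv B)"
    by (simp add: gain_inverses_exist_def matrix_inv_matrix_inv[OF B(1)] invertible_matrix_inv[OF B(1)])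
  have K: "K = B ** transpose D ** matrix_inv (D ** B ** transpose D)"
    by (simp add: K_def constraint_gain_def matrix_inv_matrix_inv[OF B(1)])
  have DK: "D ** K = mat 1"
    unfolding K by (simp add: matrix_mul_assoc matrix_inv_right[OF gram])
  show DM: "D ** (mat 1 - K ** D) = 0"
    by (simp add: matrix_diff_ldistrib matrix_mul_assoc DK)
  have "transpose (D ** B ** transpose D) = D ** B ** transpose D"
    by (simp only: matrix_transpose_mul B(2) transpose_transpose matrix_mul_assoc)
  then have "transpose (K ** D ** B) = K ** D ** B"
    unfolding K
    by (simp only: matrix_transpose_mul B(2) transpose_transpose matrix_mul_assoc
        transpose_matrix_inv[OF gram])
  then show MB: "transpose ((mat 1 - K ** D) ** B) = (mat 1 - K ** D) ** B"
    by (simp add: matrix_diff_rdistrib transpose_diff B(2))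
  have "(mat 1 - K ** D) ** B ** transpose D = transpose (D ** (mat 1 - K ** D) ** B)"
    using MB by (simp add: matrix_transpose_mul matrix_mul_assoc[symmetric])
  also have "\<dots> = 0"
    unfolding DM by (simp add: transpose_def vec_eq_iff)
  finally show "(mat 1 - K ** D) ** B ** transpose (mat 1 - K ** D) = (mat 1 - K ** D) ** B"
    by (simp add: transpose_diff matrix_diff_ldistrib matrix_transpose_mul matrix_mul_assoc)
qed

section \<open>The level set near a regular point\<close>

lemma full_rank_right_inverse:
  fixes D :: "real^'k^'d"
  assumes "rank D = CARD('d)"
  obtains R :: "real^'d^'k" where "D ** R = mat 1"
  using assms full_rank_surjective matrix_right_invertible_surjective by blast

text \<open>The chart is a local inverse of \<open>x \<mapsto> R S(x) + (1 - R D)(x - x\<^sub>0)\<close>, where \<open>D R = 1\<close>: this map has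
  derivative \<open>1\<close> at \<open>x\<^sub>0\<close>, and \<open>D\<close> sends its value at \<open>x\<close> to \<open>S(x)\<close>.\<close>

lemma level_set_chart:
  fixes S :: "real^'k \<Rightarrow> real^'d" and DS :: "real^'k \<Rightarrow> real^'k^'d"
  assumes S_deriv: "\<And>x. (S has_derivative (\<lambda>v. DS x *v v)) (at x)"
    and DS_cont: "continuous_on UNIV DS"
    and full_rank: "rank (DS x\<^sub>0) = CARD('d)" and zero: "S x\<^sub>0 = 0"
  obtains g where "g 0 = x\<^sub>0" "(g has_derivative (\<lambda>v. v)) (at 0)"
    "\<forall>\<^sub>F y in nhds 0. DS x\<^sub>0 *v y = 0 \<longrightarrow> S (g y) = 0"
proof -
  define D where "D = DS x\<^sub>0"
  obtain R where DR: "D ** R = mat 1"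
    using full_rank full_rank_right_inverse unfolding D_def by blast
  define f where "f x = R *v S x + (x - x\<^sub>0 - R *v (D *v (x - x\<^sub>0)))" for x
  define f' where "f' x = Blinfun (\<lambda>v. R *v (DS x *v v) + (v - R *v (D *v v)))" for x
  have bl: "bounded_linear (\<lambda>v. R *v (DS x *v v) + (v - R *v (D *v v)))" for x
    by (intro bounded_linear_intros bounded_linear_compose[OF matrix_vector_mul_bounded_linear])
  have f'[simp]: "blinfun_apply (f' x) = (\<lambda>v. R *v (DS x *v v) + (v - R *v (D *v v)))" for x
    unfolding f'_def by (rule bounded_linear_Blinfun_apply[OF bl])
  have deriv: "(f has_derivative blinfun_apply (f' x)) (at x)" for x
    unfolding f_def f'
  proof (rule has_derivative_add)
    note mv = bounded_linear.has_derivative[OF matrix_vector_mul_bounded_linear]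
    show "((\<lambda>x. R *v S x) has_derivative (\<lambda>v. R *v (DS x *v v))) (at x)"
      by (rule mv[OF S_deriv])
    have id: "((\<lambda>x. x - x\<^sub>0) has_derivative (\<lambda>v. v)) (at x)"
      by (auto intro!: derivative_eq_intros)
    show "((\<lambda>x. x - x\<^sub>0 - R *v (D *v (x - x\<^sub>0))) has_derivative (\<lambda>v. v - R *v (D *v v))) (at x)"
      by (rule has_derivative_diff[OF id mv[OF mv[OF id]]])
  qed
  have cont: "continuous_on UNIV f'"
  proof (rule continuous_on_blinfun_componentwise)
    fix i :: "real^'k"
    have "DS \<midarrow>x\<rightarrow> DS x" for x
      using DS_cont by (simp add: continuous_on_eq_continuous_at isCont_def)
    then have "isCont (\<lambda>x. blinfun_apply (f' x) i) x" for x
      unfolding f' isCont_def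
      by (intro tendsto_add tendsto_matrix_vector_mult tendsto_const)
    then show "continuous_on UNIV (\<lambda>x. blinfun_apply (f' x) i)"
      by (simp add: continuous_on_eq_continuous_at)
  qed
  have id: "f' x\<^sub>0 = id_blinfun"
    by (rule blinfun_eqI) (simp add: D_def)
  have f0: "f x\<^sub>0 = 0" by (simp add: f_def zero)
  have inv: "id_blinfun o\<^sub>L f' x\<^sub>0 = id_blinfun" by (rule blinfun_eqI) (simp add: id)
  show thesis
  proof (rule inverse_function_theorem[OF open_UNIV deriv cont UNIV_I inv])
    fix U V g g'
    assume *: "open U" "U \<subseteq> UNIV" "x\<^sub>0 \<in> U" "open V" "f x\<^sub>0 \<in> V" "homeomorphism U V f g"
      "\<And>y. y \<in> V \<Longrightarrow> (g has_derivative g' y) (at y)"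
      "\<And>y. y \<in> V \<Longrightarrow> g' y = inv (blinfun_apply (f' (g y)))"
    show thesis
    proof (rule that[of g])
      show g0: "g 0 = x\<^sub>0"
        using homeomorphism_apply1[OF *(6,3)] f0 by simp
      have "blinfun_apply (f' (g 0)) = (\<lambda>v. v)"
        unfolding g0 id by simp
      moreover have "inv (\<lambda>v::real^'k. v) = (\<lambda>v. v)"
        using inv_id unfolding id_def .
      ultimately have "g' 0 = (\<lambda>v. v)"
        using *(8)[OF *(5)] f0 by simp
      then show "(g has_derivative (\<lambda>v. v)) (at 0)"
        using *(7)[OF *(5)] f0 by simp
      have "S (g y) = 0" if "y \<in> V" "D *v y = 0" for y
      proof -
        have fg: "f (g y) = y"
          using homeomorphism_apply2[OF *(6) that(1)] .
        have DRv: "D *v (R *v w) = w" for w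
          by (simp add: matrix_vector_mul_assoc DR)
        have "D *v f (g y) = S (g y)"
          unfolding f_def
          by (simp add: matrix_vector_right_distrib matrix_vector_mult_diff_distrib DRv)
        with that fg show ?thesis by simp
      qed
      moreover have "\<forall>\<^sub>F y in nhds 0. y \<in> V"
        using * f0 by (simp add: eventually_nhds_in_open)
      ultimately show "\<forall>\<^sub>F y in nhds 0. DS x\<^sub>0 *v y = 0 \<longrightarrow> S (g y) = 0"
        unfolding D_def by (elim eventually_mono) simp
    qed
  qed
qed


section \<open>Square-integrable functions\<close>

text \<open>Unlike \<open>L2_zero_mean\<close> this imposes no mean condition, so that it also holds
  functions on the side of the sigma-finite dominating measure: root densities and the remainders of
  their expansions.\<close>

definition L2_functions :: "'x measure \<Rightarrow> ('x \<Rightarrow> real) set" where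
  "L2_functions M = {f \<in> borel_measurable M. integrable M (\<lambda>x. (f x)\<^sup>2)}"

lemma L2_functionsI:
  "f \<in> borel_measurable M \<Longrightarrow> integrable M (\<lambda>x. (f x)\<^sup>2) \<Longrightarrow> f \<in> L2_functions M"
  by (simp add: L2_functions_def)

lemma
  assumes "f \<in> L2_functions M"
  shows L2_functions_measurable: "f \<in> borel_measurable M"
    and L2_functions_integrable: "integrable M (\<lambda>x. (f x)\<^sup>2)"
  using assms by (simp_all add: L2_functions_def)

lemma L2_zero_mean_iff: "f \<in> L2_zero_mean N \<longleftrightarrow> f \<in> L2_functions N \<and> (LINT x|N. f x) = 0"
  by (simp add: L2_zero_mean_def L2_functions_def)

lemma L2_functions_mult_integrable:
  assumes "f \<in> L2_functions M" "g \<in> L2_functions M"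
  shows "integrable M (\<lambda>x. f x * g x)"
proof (rule Bochner_Integration.integrable_bound)
  note [measurable] = assms[THEN L2_functions_measurable]
  show "integrable M (\<lambda>x. (f x)\<^sup>2 + (g x)\<^sup>2)"
    using assms by (intro Bochner_Integration.integrable_add L2_functions_integrable)
  show "(\<lambda>x. f x * g x) \<in> borel_measurable M" by measurable
  have "\<bar>a * b\<bar> \<le> a\<^sup>2 + b\<^sup>2" for a b :: real
    using sum_squares_bound[of "\<bar>a\<bar>" "\<bar>b\<bar>"] mult_nonneg_nonneg[of "\<bar>a\<bar>" "\<bar>b\<bar>"]
    unfolding abs_mult power2_abs by linarith
  then show "AE x in M. norm (f x * g x) \<le> norm ((f x)\<^sup>2 + (g x)\<^sup>2)"
    by simp
qed

lemma L2_functions_add [intro]: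
  assumes f: "f \<in> L2_functions M" and g: "g \<in> L2_functions M"
  shows "(\<lambda>x. f x + g x) \<in> L2_functions M"
proof (rule L2_functionsI)
  note [measurable] = f[THEN L2_functions_measurable] g[THEN L2_functions_measurable]
  show "(\<lambda>x. f x + g x) \<in> borel_measurable M" by measurable
  have "integrable M (\<lambda>x. (f x)\<^sup>2 + (g x)\<^sup>2 + 2 * (f x * g x))"
    using f g by (intro Bochner_Integration.integrable_add integrable_mult_right
        L2_functions_integrable L2_functions_mult_integrable)
  then show "integrable M (\<lambda>x. (f x + g x)\<^sup>2)"
    by (simp add: power2_sum algebra_simps)
qed

lemma L2_functions_cmult [intro]:
  assumes "f \<in> L2_functions M"
  shows "(\<lambda>x. c * f x) \<in> L2_functions M"
proof (rule L2_functionsI)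
  note [measurable] = assms[THEN L2_functions_measurable]
  show "(\<lambda>x. c * f x) \<in> borel_measurable M" by measurable
  show "integrable M (\<lambda>x. (c * f x)\<^sup>2)"
    using L2_functions_integrable[OF assms] by (simp add: power_mult_distrib)
qed

lemma L2_functions_diff [intro]:
  assumes "f \<in> L2_functions M" "g \<in> L2_functions M"
  shows "(\<lambda>x. f x - g x) \<in> L2_functions M"
  using L2_functions_add[OF assms(1) L2_functions_cmult[OF assms(2), of "-1"]] by simp

lemma L2_functions_zero: "(\<lambda>x. 0) \<in> L2_functions M"
  by (simp add: L2_functions_def)

lemma L2_functions_sum [intro]:
  assumes "\<And>i. i \<in> I \<Longrightarrow> f i \<in> L2_functions M"
  shows "(\<lambda>x. \<Sum>i\<in>I. f i x) \<in> L2_functions M"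
  using assms by (induction I rule: infinite_finite_induct) (auto simp: L2_functions_zero)

lemma (in finite_measure) L2_functions_integrable_self:
  "f \<in> L2_functions M \<Longrightarrow> integrable M f"
  unfolding L2_functions_def by (auto intro: square_integrable_imp_integrable)

lemma L2_norm_nonneg: "0 \<le> L2_norm M f"
  by (simp add: L2_norm_def)

lemma L2_norm_square: "(L2_norm M f)\<^sup>2 = (LINT x|M. (f x)\<^sup>2)"
  by (simp add: L2_norm_def)

lemma L2_norm_cmult: "L2_norm M (\<lambda>x. c * f x) = \<bar>c\<bar> * L2_norm M f"
  by (simp add: L2_norm_def power_mult_distrib real_sqrt_mult)

lemma L2_norm_zero: "L2_norm M (\<lambda>x. 0) = 0"
  by (simp add: L2_norm_def)

lemma L2_norm_cong_AE:
  assumes "f \<in> borel_measurable M" "g \<in> borel_measurable M" "AE x in M. f x = g x"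
  shows "L2_norm M f = L2_norm M g"
proof -
  have "(LINT x|M. (f x)\<^sup>2) = (LINT x|M. (g x)\<^sup>2)"
    by (rule integral_cong_AE) (use assms in auto)
  then show ?thesis by (simp add: L2_norm_def)
qed

lemma L2_norm_eq_0_iff:
  assumes "f \<in> L2_functions M"
  shows "L2_norm M f = 0 \<longleftrightarrow> (AE x in M. f x = 0)"
  using integral_nonneg_eq_0_iff_AE[OF L2_functions_integrable[OF assms]]
  by (simp add: L2_norm_def)

text \<open>The squared norm of \<open>f + t g\<close> is a nonnegative quadratic in
  \<open>t\<close>, and its discriminant is read off.\<close>

lemma L2_Cauchy_Schwarz:
  assumes f: "f \<in> L2_functions M" and g: "g \<in> L2_functions M"
  shows "\<bar>LINT x|M. f x * g x\<bar> \<le> L2_norm M f * L2_norm M g"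
proof -
  note int = L2_functions_integrable[OF f] L2_functions_integrable[OF g]
    L2_functions_mult_integrable[OF f g]
  have "0 \<le> (LINT x|M. (f x)\<^sup>2) + 2 * t * (LINT x|M. f x * g x) + t\<^sup>2 * (LINT x|M. (g x)\<^sup>2)" for t
  proof -
    have "0 \<le> (LINT x|M. (f x + t * g x)\<^sup>2)" by simp
    also have "(\<lambda>x. (f x + t * g x)\<^sup>2) = (\<lambda>x. (f x)\<^sup>2 + (2 * t) * (f x * g x) + t\<^sup>2 * (g x)\<^sup>2)"
      by (auto simp: power2_sum power_mult_distrib)
    finally show ?thesis using int by simp
  qed
  then have "(LINT x|M. f x * g x)\<^sup>2 \<le> (LINT x|M. (f x)\<^sup>2) * (LINT x|M. (g x)\<^sup>2)"
    by (rule discriminant_nonpos) simp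
  then show ?thesis
    unfolding L2_norm_def real_sqrt_mult[symmetric] using real_le_rsqrt[of "\<bar>LINT x|M. f x * g x\<bar>"] by simp
qed

lemma L2_norm_triangle:
  assumes f: "f \<in> L2_functions M" and g: "g \<in> L2_functions M"
  shows "L2_norm M (\<lambda>x. f x + g x) \<le> L2_norm M f + L2_norm M g"
proof (rule power2_le_imp_le)
  note int = L2_functions_integrable[OF f] L2_functions_integrable[OF g]
    L2_functions_mult_integrable[OF f g]
  have "(\<lambda>x. (f x + g x)\<^sup>2) = (\<lambda>x. (f x)\<^sup>2 + (g x)\<^sup>2 + 2 * (f x * g x))"
    by (auto simp: power2_sum)
  then have "(L2_norm M (\<lambda>x. f x + g x))\<^sup>2
      = (L2_norm M f)\<^sup>2 + (L2_norm M g)\<^sup>2 + 2 * (LINT x|M. f x * g x)"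
    unfolding L2_norm_square using int by simp
  then show "(L2_norm M (\<lambda>x. f x + g x))\<^sup>2 \<le> (L2_norm M f + L2_norm M g)\<^sup>2"
    using L2_Cauchy_Schwarz[OF f g] by (simp add: power2_sum)
  show "0 \<le> L2_norm M f + L2_norm M g" by (simp add: L2_norm_nonneg)
qed

lemma L2_norm_triangle_diff:
  assumes "f \<in> L2_functions M" "g \<in> L2_functions M"
  shows "L2_norm M (\<lambda>x. f x - g x) \<le> L2_norm M f + L2_norm M g"
  using L2_norm_triangle[OF assms(1) L2_functions_cmult[OF assms(2), of "-1"]]
    L2_norm_cmult[of M "-1" g] by simp

lemma L2_norm_sum_le:
  assumes "\<And>i. i \<in> I \<Longrightarrow> f i \<in> L2_functions M"
  shows "L2_norm M (\<lambda>x. \<Sum>i\<in>I. f i x) \<le> (\<Sum>i\<in>I. L2_norm M (f i))"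
  using assms
proof (induction I rule: infinite_finite_induct)
  case (insert i I)
  then have "L2_norm M (\<lambda>x. f i x + (\<Sum>i\<in>I. f i x)) \<le> L2_norm M (f i) + L2_norm M (\<lambda>x. \<Sum>i\<in>I. f i x)"
    by (intro L2_norm_triangle L2_functions_sum) auto
  with insert show ?case by simp
qed (simp_all add: L2_norm_zero)

lemma L2_functions_inner:
  fixes l :: "'x \<Rightarrow> real^'k"
  assumes "\<And>i. (\<lambda>x. l x $ i) \<in> L2_functions M"
  shows "(\<lambda>x. u \<bullet> l x) \<in> L2_functions M"
  unfolding inner_vec_def inner_real_def by (intro L2_functions_sum L2_functions_cmult assms)

lemma L2_zero_mean_inner:
  fixes l :: "'x \<Rightarrow> real^'k"
  assumes "finite_measure M" "\<And>i. (\<lambda>x. l x $ i) \<in> L2_zero_mean M"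
  shows "(\<lambda>x. u \<bullet> l x) \<in> L2_zero_mean M"
proof -
  have l: "(\<lambda>x. l x $ i) \<in> L2_functions M" "(LINT x|M. l x $ i) = 0" for i
    using assms(2)[of i] by (auto simp: L2_zero_mean_iff)
  then have "integrable M (\<lambda>x. l x $ i)" for i
    using assms(1) finite_measure.L2_functions_integrable_self by blast
  then have "(LINT x|M. u \<bullet> l x) = 0"
    unfolding inner_vec_def by (simp add: l)
  with L2_functions_inner[of l M u] l show ?thesis
    by (simp add: L2_zero_mean_iff)
qed

lemma L2_norm_inner_le:
  fixes l :: "'x \<Rightarrow> real^'k"
  assumes "\<And>i. (\<lambda>x. l x $ i) \<in> L2_functions M"
  shows "L2_norm M (\<lambda>x. u \<bullet> l x) \<le> norm u * (\<Sum>i\<in>UNIV. L2_norm M (\<lambda>x. l x $ i))"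
proof -
  have "L2_norm M (\<lambda>x. u \<bullet> l x) \<le> (\<Sum>i\<in>UNIV. L2_norm M (\<lambda>x. u $ i * l x $ i))"
    unfolding inner_vec_def inner_real_def by (intro L2_norm_sum_le L2_functions_cmult assms)
  also have "\<dots> \<le> (\<Sum>i\<in>UNIV. norm u * L2_norm M (\<lambda>x. l x $ i))"
    unfolding L2_norm_cmult
    by (intro sum_mono mult_right_mono L2_norm_nonneg) (simp add: component_le_norm_cart)
  finally show ?thesis by (simp add: sum_distrib_left)
qed


section \<open>Root densities\<close>

lemma root_density_measurable [measurable]: "root_density \<mu> N \<in> borel_measurable \<mu>"
  unfolding root_density_def[abs_def] by measurable

text \<open>The square of the root density is the Radon-Nikodym derivative, so multiplication by the
  root density embeds the square-integrable functions of \<open>N\<close> isometrically into those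
  of \<open>\<mu>\<close>.\<close>

lemma
  assumes "sigma_finite_measure \<mu>" "sigma_finite_measure N" "sets N = sets \<mu>"
    "absolutely_continuous \<mu> N" and f: "f \<in> borel_measurable \<mu>"
  shows L2_norm_root_density: "L2_norm \<mu> (\<lambda>x. root_density \<mu> N x * f x) = L2_norm N f"
    and L2_functions_root_density:
      "f \<in> L2_functions N \<Longrightarrow> (\<lambda>x. root_density \<mu> N x * f x) \<in> L2_functions \<mu>"
proof -
  interpret sigma_finite_measure \<mu> by fact
  note [measurable] = f
  have eq: "(\<lambda>x. (root_density \<mu> N x * f x)\<^sup>2) = (\<lambda>x. enn2real (RN_deriv \<mu> N x) * (f x)\<^sup>2)"
    by (simp add: root_density_def power_mult_distrib fun_eq_iff)
  have m: "(\<lambda>x. (f x)\<^sup>2) \<in> borel_measurable \<mu>" by measurable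
  show "L2_norm \<mu> (\<lambda>x. root_density \<mu> N x * f x) = L2_norm N f"
    unfolding L2_norm_def eq using RN_deriv_integral[OF assms(2,4,3) m] by simp
  show "(\<lambda>x. root_density \<mu> N x * f x) \<in> L2_functions \<mu>" if "f \<in> L2_functions N"
  proof (rule L2_functionsI)
    show "(\<lambda>x. root_density \<mu> N x * f x) \<in> borel_measurable \<mu>" by measurable
    show "integrable \<mu> (\<lambda>x. (root_density \<mu> N x * f x)\<^sup>2)"
      unfolding eq using RN_deriv_integrable[OF assms(2,4,3) m] L2_functions_integrable[OF that] by simp
  qed
qed

lemma root_density_L2_functions:
  assumes "sigma_finite_measure \<mu>" "finite_measure N" "sets N = sets \<mu>"
    "absolutely_continuous \<mu> N"
  shows "root_density \<mu> N \<in> L2_functions \<mu>"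
proof -
  interpret finite_measure N by fact
  have "(\<lambda>x. root_density \<mu> N x * 1) \<in> L2_functions \<mu>"
    by (rule L2_functions_root_density)
       (use assms in \<open>auto simp: L2_functions_def sigma_finite_measure_axioms\<close>)
  then show ?thesis by simp
qed

text \<open>The chain rule for Radon-Nikodym derivatives under a square root. It rests on
  uniqueness: the product of the two derivatives is also a density of \<open>N\<close> with respect
  to \<open>\<rho>\<close>.\<close>

lemma root_density_chain:
  assumes \<rho>: "sigma_finite_measure \<rho>" and \<mu>: "sigma_finite_measure \<mu>"
    and "sets \<mu> = sets \<rho>" "absolutely_continuous \<rho> \<mu>"
    and N: "sets N = sets \<mu>" "absolutely_continuous \<mu> N"
  shows "AE x in \<rho>. root_density \<rho> N x = root_density \<rho> \<mu> x * root_density \<mu> N x"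
proof -
  interpret \<rho>: sigma_finite_measure \<rho> by fact
  interpret \<mu>: sigma_finite_measure \<mu> by fact
  have m: "RN_deriv \<mu> N \<in> borel_measurable \<rho>"
    using borel_measurable_RN_deriv[of \<mu> N] assms(3) by (simp cong: measurable_cong_sets)
  have "density \<rho> (\<lambda>x. RN_deriv \<rho> \<mu> x * RN_deriv \<mu> N x) = density (density \<rho> (RN_deriv \<rho> \<mu>)) (RN_deriv \<mu> N)"
    using m by (simp add: density_density_eq)
  also have "density \<rho> (RN_deriv \<rho> \<mu>) = \<mu>"
    using assms by (simp add: \<rho>.density_RN_deriv)
  also have "density \<mu> (RN_deriv \<mu> N) = N"
    using assms by (simp add: \<mu>.density_RN_deriv)
  finally have "AE x in \<rho>. RN_deriv \<rho> \<mu> x * RN_deriv \<mu> N x = RN_deriv \<rho> N x"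
    using m by (intro \<rho>.RN_deriv_unique borel_measurable_times_ennreal borel_measurable_RN_deriv)
  then show ?thesis
    by eventually_elim
       (simp add: root_density_def enn2real_mult real_sqrt_mult[symmetric] flip: enn2real_mult)
qed

text \<open>The Hellinger-type norms in the definitions of regular paths and of score functions do not
  depend on the dominating measure.\<close>

lemma L2_norm_root_density_expansion:
  assumes \<rho>: "sigma_finite_measure \<rho>" and \<mu>: "sigma_finite_measure \<mu>"
    and "sets \<mu> = sets \<rho>" "absolutely_continuous \<rho> \<mu>"
    and N: "sets N = sets \<mu>" "absolutely_continuous \<mu> N"
    and N0: "sets N\<^sub>0 = sets \<mu>" "absolutely_continuous \<mu> N\<^sub>0"
    and f: "f \<in> borel_measurable \<mu>"
  shows "L2_norm \<rho> (\<lambda>x. root_density \<rho> N x - root_density \<rho> N\<^sub>0 x - f x * root_density \<rho> N\<^sub>0 x)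
       = L2_norm \<mu> (\<lambda>x. root_density \<mu> N x - root_density \<mu> N\<^sub>0 x - f x * root_density \<mu> N\<^sub>0 x)"
proof -
  have sets: "borel_measurable \<mu> = (borel_measurable \<rho> :: ('a \<Rightarrow> real) set)"
    using assms(3) by (rule measurable_cong_sets) simp
  have [measurable]: "f \<in> borel_measurable \<rho>" "f \<in> borel_measurable \<mu>"
    "root_density \<mu> N \<in> borel_measurable \<rho>" "root_density \<mu> N\<^sub>0 \<in> borel_measurable \<rho>"
    using f root_density_measurable[of \<mu>] by (simp_all add: sets)
  have "AE x in \<rho>. root_density \<rho> N x - root_density \<rho> N\<^sub>0 x - f x * root_density \<rho> N\<^sub>0 x
    = root_density \<rho> \<mu> x * (root_density \<mu> N x - root_density \<mu> N\<^sub>0 x - f x * root_density \<mu> N\<^sub>0 x)"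
    using root_density_chain[OF assms(1-6)] root_density_chain[OF assms(1-4) N0]
    by eventually_elim (simp add: algebra_simps)
  then have "L2_norm \<rho> (\<lambda>x. root_density \<rho> N x - root_density \<rho> N\<^sub>0 x - f x * root_density \<rho> N\<^sub>0 x)
    = L2_norm \<rho> (\<lambda>x. root_density \<rho> \<mu> x *
        (root_density \<mu> N x - root_density \<mu> N\<^sub>0 x - f x * root_density \<mu> N\<^sub>0 x))"
    by (intro L2_norm_cong_AE) measurable
  also have "\<dots> = L2_norm \<mu> (\<lambda>x. root_density \<mu> N x - root_density \<mu> N\<^sub>0 x - f x * root_density \<mu> N\<^sub>0 x)"
    by (rule L2_norm_root_density) (use assms in measurable)
  finally show ?thesis .
qed

text \<open>The sum of the two measures works, since its null sets are null for both. Under it,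
  expansions relative to unrelated dominating measures become comparable.\<close>

lemma sigma_finite_common_dominating:
  assumes \<mu>: "sigma_finite_measure \<mu>" and \<nu>: "sigma_finite_measure \<nu>"
    and sets: "sets \<nu> = sets \<mu>"
  obtains \<rho> where "sigma_finite_measure \<rho>" "sets \<rho> = sets \<mu>"
    "absolutely_continuous \<rho> \<mu>" "absolutely_continuous \<rho> \<nu>"
proof -
  interpret \<mu>: sigma_finite_measure \<mu> by fact
  interpret \<nu>: sigma_finite_measure \<nu> by fact
  define \<rho> where "\<rho> = measure_of (space \<mu>) (sets \<mu>) (\<lambda>A. emeasure \<mu> A + emeasure \<nu> A)"
  have [simp]: "sets \<rho> = sets \<mu>" "space \<rho> = space \<mu>"
    by (simp_all add: \<rho>_def)
  have \<rho>: "emeasure \<rho> A = emeasure \<mu> A + emeasure \<nu> A" if "A \<in> sets \<mu>" for A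
  proof (rule emeasure_measure_of[OF \<rho>_def])
    show "sets \<mu> \<subseteq> Pow (space \<mu>)" by (rule sets.space_closed)
    show "positive (sets \<rho>) (\<lambda>A. emeasure \<mu> A + emeasure \<nu> A)"
      by (simp add: positive_def)
    show "countably_additive (sets \<rho>) (\<lambda>A. emeasure \<mu> A + emeasure \<nu> A)"
    proof (rule countably_additiveI)
      fix A :: "nat \<Rightarrow> 'a set"
      assume "range A \<subseteq> sets \<rho>" "disjoint_family A"
      then show "(\<Sum>i. emeasure \<mu> (A i) + emeasure \<nu> (A i))
          = emeasure \<mu> (\<Union>(range A)) + emeasure \<nu> (\<Union>(range A))"
        using suminf_emeasure[of A \<mu>] suminf_emeasure[of A \<nu>] sets by (simp flip: suminf_add)
    qed
    show "A \<in> sets \<rho>" using that by simp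
  qed
  obtain A where A: "countable A" "A \<subseteq> sets \<mu>" "\<Union>A = space \<mu>" "\<forall>a\<in>A. emeasure \<mu> a \<noteq> \<infinity>"
    using \<mu>.sigma_finite_countable by blast
  obtain B where B: "countable B" "B \<subseteq> sets \<nu>" "\<Union>B = space \<nu>" "\<forall>b\<in>B. emeasure \<nu> b \<noteq> \<infinity>"
    using \<nu>.sigma_finite_countable by blast
  show thesis
  proof (rule that)
    show "sigma_finite_measure \<rho>"
    proof
      \<comment> \<open>Intersections of members of the two covers, so that each piece has finite
        mass under both measures at once.\<close>
      let ?C = "(\<lambda>(a, b). a \<inter> b) ` (A \<times> B)"
      show "\<exists>C. countable C \<and> C \<subseteq> sets \<rho> \<and> \<Union>C = space \<rho> \<and> (\<forall>c\<in>C. emeasure \<rho> c \<noteq> \<infinity>)"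
      proof (intro exI[of _ ?C] conjI ballI)
        show "countable ?C" using A B by simp
        show "?C \<subseteq> sets \<rho>" using A(2) B(2) sets by auto
        have "\<Union>?C = \<Union>A \<inter> \<Union>B" by auto
        then show "\<Union>?C = space \<rho>"
          using A(3) B(3) sets_eq_imp_space_eq[OF sets] by simp
        fix c assume "c \<in> ?C"
        then obtain a b where ab: "a \<in> A" "b \<in> B" "c = a \<inter> b" by auto
        then have m: "a \<in> sets \<mu>" "b \<in> sets \<mu>" using A B sets by auto
        have "emeasure \<mu> c \<le> emeasure \<mu> a" "emeasure \<nu> c \<le> emeasure \<nu> b"
          using m sets ab by (auto intro!: emeasure_mono)
        moreover have "emeasure \<mu> a < \<infinity>" "emeasure \<nu> b < \<infinity>"
          using A B ab by (auto simp: less_top)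
        ultimately have "emeasure \<mu> c < \<infinity>" "emeasure \<nu> c < \<infinity>"
          by (auto intro: le_less_trans)
        then show "emeasure \<rho> c \<noteq> \<infinity>"
          using m ab by (simp add: \<rho> less_top)
      qed
    qed
    show "absolutely_continuous \<rho> \<mu>" "absolutely_continuous \<rho> \<nu>"
      using sets by (auto simp: absolutely_continuous_def null_sets_def \<rho>)
  qed simp
qed


section \<open>Regular paths\<close>

lemma borel_measurable_sets_eq:
  "f \<in> borel_measurable M \<Longrightarrow> sets M = sets N \<Longrightarrow> f \<in> borel_measurable N"
  by (simp cong: measurable_cong_sets)

lemma difference_quotient_imp_tendsto:
  fixes \<theta> :: "real \<Rightarrow> 'b::real_normed_vector"
  assumes "((\<lambda>\<eta>. (\<theta> \<eta> - \<theta>\<^sub>0) /\<^sub>R \<eta>) \<longlongrightarrow> a) (at 0)"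
  shows "(\<theta> \<longlongrightarrow> \<theta>\<^sub>0) (at 0)"
proof -
  have "((\<lambda>\<eta>. \<theta>\<^sub>0 + \<eta> *\<^sub>R ((\<theta> \<eta> - \<theta>\<^sub>0) /\<^sub>R \<eta>)) \<longlongrightarrow> \<theta>\<^sub>0 + 0 *\<^sub>R a) (at 0)"
    by (intro tendsto_add tendsto_scaleR tendsto_const tendsto_ident_at assms)
  then have "((\<lambda>\<eta>. \<theta>\<^sub>0 + \<eta> *\<^sub>R ((\<theta> \<eta> - \<theta>\<^sub>0) /\<^sub>R \<eta>)) \<longlongrightarrow> \<theta>\<^sub>0) (at 0)" by simp
  then show ?thesis
    by (rule Lim_transform_eventually) (simp add: eventually_at_filter)
qed

text \<open>The little-o hypothesis says nothing at \<open>\<theta>\<^sub>0\<close> itself, yet the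
  curve may return there for nonzero \<open>\<eta>\<close>; \<open>r0\<close> covers these returns.
  Elsewhere the convergent difference quotient bounds the distance to
  \<open>\<theta>\<^sub>0\<close> by a multiple of \<open>\<bar>\<eta>\<bar>\<close>.\<close>

lemma smallo_along_curve:
  fixes r :: "'b::real_normed_vector \<Rightarrow> real"
  assumes r: "r \<in> o[at \<theta>\<^sub>0](\<lambda>\<theta>. norm (\<theta> - \<theta>\<^sub>0))" and r0: "r \<theta>\<^sub>0 = 0"
    and \<theta>: "((\<lambda>\<eta>. (\<theta> \<eta> - \<theta>\<^sub>0) /\<^sub>R \<eta>) \<longlongrightarrow> a) (at (0::real))"
  shows "(\<lambda>\<eta>. r (\<theta> \<eta>)) \<in> o[at 0](\<lambda>\<eta>. \<bar>\<eta>\<bar>)"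
proof (rule landau_o.smallI)
  fix c :: real assume c: "0 < c"
  define b where "b = norm a + 1"
  have b: "0 < b" by (simp add: b_def add_nonneg_pos)
  have "\<forall>\<^sub>F \<zeta> in at \<theta>\<^sub>0. norm (r \<zeta>) \<le> c / b * norm (\<zeta> - \<theta>\<^sub>0)"
    using landau_o.smallD[OF r, of "c / b"] c b by simp
  then have "\<forall>\<^sub>F \<zeta> in nhds \<theta>\<^sub>0. norm (r \<zeta>) \<le> c / b * norm (\<zeta> - \<theta>\<^sub>0)"
    unfolding eventually_at_filter by (rule eventually_mono) (use r0 in force)
  then have 1: "\<forall>\<^sub>F \<eta> in at 0. norm (r (\<theta> \<eta>)) \<le> c / b * norm (\<theta> \<eta> - \<theta>\<^sub>0)"
    using difference_quotient_imp_tendsto[OF \<theta>] by (auto simp: filterlim_iff)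
  have "\<forall>\<^sub>F \<eta> in at 0. norm ((\<theta> \<eta> - \<theta>\<^sub>0) /\<^sub>R \<eta>) < b"
    using tendsto_norm[OF \<theta>] by (rule order_tendstoD) (simp add: b_def)
  moreover have "\<forall>\<^sub>F \<eta>::real in at 0. \<eta> \<noteq> 0" by (simp add: eventually_at_filter)
  ultimately show "\<forall>\<^sub>F \<eta> in at 0. norm (r (\<theta> \<eta>)) \<le> c * norm \<bar>\<eta>\<bar>"
    using 1
  proof eventually_elim
    case (elim \<eta>)
    have "norm (\<theta> \<eta> - \<theta>\<^sub>0) = norm (\<eta> *\<^sub>R ((\<theta> \<eta> - \<theta>\<^sub>0) /\<^sub>R \<eta>))"
      using elim(2) by simp
    also have "\<dots> \<le> b * \<bar>\<eta>\<bar>"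
      unfolding norm_scaleR[of \<eta>] mult.commute[of b] using elim(1) by (intro mult_left_mono) auto
    finally have "norm (\<theta> \<eta> - \<theta>\<^sub>0) \<le> b * \<bar>\<eta>\<bar>" .
    then have "c / b * norm (\<theta> \<eta> - \<theta>\<^sub>0) \<le> c / b * (b * \<bar>\<eta>\<bar>)"
      using b c by (intro mult_left_mono) auto
    with elim b show ?case by simp
  qed
qed

text \<open>Differentiability in quadratic mean passes from the parameter to curves: the remainder
  stays negligible along the curve, and replacing the increment by its linearization
  \<open>\<eta> v\<close> costs at most a constant times the norm of their difference. This produces
  the scores \<open>v \<bullet> l\<close> of the constrained model.\<close>

lemma regular_path_along_curve:
  fixes F :: "real^'k \<Rightarrow> 'x measure"
  assumes score: "score_function F \<Theta> \<theta>\<^sub>0 l" and prob: "\<And>\<theta>. \<theta> \<in> \<Theta> \<Longrightarrow> prob_space (F \<theta>)"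
    and \<epsilon>: "0 < \<epsilon>" and \<theta>: "\<And>\<eta>. \<bar>\<eta>\<bar> < \<epsilon> \<Longrightarrow> \<theta> \<eta> \<in> \<Theta> \<and> F (\<theta> \<eta>) \<in> \<M>" "\<theta> 0 = \<theta>\<^sub>0"
    and v: "((\<lambda>\<eta>. (\<theta> \<eta> - \<theta>\<^sub>0) /\<^sub>R \<eta>) \<longlongrightarrow> v) (at 0)"
  shows "regular_path \<M> (F \<theta>\<^sub>0) \<epsilon> (\<lambda>\<eta>. F (\<theta> \<eta>)) (\<lambda>x. v \<bullet> l x)"
proof -
  have \<theta>0: "\<theta>\<^sub>0 \<in> \<Theta>" using \<theta>(1)[of 0] \<theta>(2) \<epsilon> by simp
  interpret P0: prob_space "F \<theta>\<^sub>0" using prob \<theta>0 by blast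
  from score obtain \<mu> where dom: "dominating \<mu> (F ` \<Theta>)"
    and small: "(\<lambda>\<theta>. L2_norm \<mu> (\<lambda>x. root_density \<mu> (F \<theta>) x - root_density \<mu> (F \<theta>\<^sub>0) x
      - 1/2 * root_density \<mu> (F \<theta>\<^sub>0) x * ((\<theta> - \<theta>\<^sub>0) \<bullet> l x))) \<in> o[at \<theta>\<^sub>0](\<lambda>\<theta>. norm (\<theta> - \<theta>\<^sub>0))"
    and l0: "\<And>i. (\<lambda>x. l x $ i) \<in> L2_zero_mean (F \<theta>\<^sub>0)"
    unfolding score_function_def by blast
  have l: "(\<lambda>x. l x $ i) \<in> L2_functions (F \<theta>\<^sub>0)" for i
    using l0[of i] by (simp add: L2_zero_mean_iff)
  have \<mu>: "sigma_finite_measure \<mu>" "\<And>\<theta>. \<theta> \<in> \<Theta> \<Longrightarrow> sets (F \<theta>) = sets \<mu>"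
    "\<And>\<theta>. \<theta> \<in> \<Theta> \<Longrightarrow> absolutely_continuous \<mu> (F \<theta>)"
    using dom by (auto simp: dominating_def)
  define R where "R \<theta> x = root_density \<mu> (F \<theta>) x - root_density \<mu> (F \<theta>\<^sub>0) x
      - 1/2 * root_density \<mu> (F \<theta>\<^sub>0) x * ((\<theta> - \<theta>\<^sub>0) \<bullet> l x)" for \<theta> x
  have rl: "(\<lambda>x. root_density \<mu> (F \<theta>\<^sub>0) x * (u \<bullet> l x)) \<in> L2_functions \<mu>"
    "L2_norm \<mu> (\<lambda>x. root_density \<mu> (F \<theta>\<^sub>0) x * (u \<bullet> l x)) = L2_norm (F \<theta>\<^sub>0) (\<lambda>x. u \<bullet> l x)" for u
  proof -
    have u: "(\<lambda>x. u \<bullet> l x) \<in> L2_functions (F \<theta>\<^sub>0)" by (rule L2_functions_inner[OF l])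
    note m = borel_measurable_sets_eq[OF L2_functions_measurable[OF u] \<mu>(2)[OF \<theta>0]]
    show "(\<lambda>x. root_density \<mu> (F \<theta>\<^sub>0) x * (u \<bullet> l x)) \<in> L2_functions \<mu>"
      by (rule L2_functions_root_density[OF \<mu>(1) P0.sigma_finite_measure_axioms \<mu>(2,3)[OF \<theta>0] m u])
    show "L2_norm \<mu> (\<lambda>x. root_density \<mu> (F \<theta>\<^sub>0) x * (u \<bullet> l x)) = L2_norm (F \<theta>\<^sub>0) (\<lambda>x. u \<bullet> l x)"
      by (rule L2_norm_root_density[OF \<mu>(1) P0.sigma_finite_measure_axioms \<mu>(2,3)[OF \<theta>0] m])
  qed
  have root: "root_density \<mu> (F \<theta>) \<in> L2_functions \<mu>" if "\<theta> \<in> \<Theta>" for \<theta>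
    using root_density_L2_functions[OF \<mu>(1) _ \<mu>(2,3)] prob[OF that] that
    by (simp add: prob_space_def)
  have R: "R \<theta> \<in> L2_functions \<mu>" if "\<theta> \<in> \<Theta>" for \<theta>
  proof -
    have "(\<lambda>x. root_density \<mu> (F \<theta>) x - root_density \<mu> (F \<theta>\<^sub>0) x
      - 1/2 * (root_density \<mu> (F \<theta>\<^sub>0) x * ((\<theta> - \<theta>\<^sub>0) \<bullet> l x))) \<in> L2_functions \<mu>"
      by (intro L2_functions_diff L2_functions_cmult root rl \<theta>0 that)
    then show ?thesis by (simp add: R_def[abs_def] mult.assoc)
  qed
  \<comment> \<open>Bounds the linear map sending a vector \<open>u\<close> to the function
    \<open>u \<bullet> l\<close>.\<close>
  define C where "C = (\<Sum>i\<in>UNIV. L2_norm (F \<theta>\<^sub>0) (\<lambda>x. l x $ i))"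
  define E where "E \<eta> = L2_norm \<mu> (\<lambda>x. root_density \<mu> (F (\<theta> \<eta>)) x - root_density \<mu> (F \<theta>\<^sub>0) x
      - 1/2 * \<eta> * (v \<bullet> l x) * root_density \<mu> (F \<theta>\<^sub>0) x)" for \<eta>
  have E: "E \<eta> \<le> L2_norm \<mu> (R (\<theta> \<eta>)) + 1/2 * (norm (\<theta> \<eta> - \<theta>\<^sub>0 - \<eta> *\<^sub>R v) * C)" if "\<bar>\<eta>\<bar> < \<epsilon>" for \<eta>
  proof -
    let ?u = "\<theta> \<eta> - \<theta>\<^sub>0 - \<eta> *\<^sub>R v"
    have "E \<eta> = L2_norm \<mu> (\<lambda>x. R (\<theta> \<eta>) x + 1/2 * (root_density \<mu> (F \<theta>\<^sub>0) x * (?u \<bullet> l x)))"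
      unfolding E_def R_def by (intro arg_cong[where f = "L2_norm \<mu>"] ext) (simp add: inner_simps algebra_simps)
    also have "\<dots> \<le> L2_norm \<mu> (R (\<theta> \<eta>)) + L2_norm \<mu> (\<lambda>x. 1/2 * (root_density \<mu> (F \<theta>\<^sub>0) x * (?u \<bullet> l x)))"
      by (intro L2_norm_triangle L2_functions_cmult rl R) (use \<theta> that in auto)
    also have "L2_norm \<mu> (\<lambda>x. 1/2 * (root_density \<mu> (F \<theta>\<^sub>0) x * (?u \<bullet> l x)))
      = 1/2 * L2_norm (F \<theta>\<^sub>0) (\<lambda>x. ?u \<bullet> l x)"
      unfolding L2_norm_cmult rl(2) by simp
    also have "\<dots> \<le> 1/2 * (norm ?u * C)"
      unfolding C_def by (intro mult_left_mono L2_norm_inner_le l) simp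
    finally show ?thesis by simp
  qed
  have "(\<lambda>\<eta>. L2_norm \<mu> (R (\<theta> \<eta>))) \<in> o[at 0](\<lambda>\<eta>. \<bar>\<eta>\<bar>)"
    unfolding R_def by (rule smallo_along_curve[OF small _ v]) (simp add: L2_norm_zero)
  then have RL: "((\<lambda>\<eta>. L2_norm \<mu> (R (\<theta> \<eta>)) / \<bar>\<eta>\<bar>) \<longlongrightarrow> 0) (at 0)"
    by (rule smalloD_tendsto)
  have "((\<lambda>\<eta>. L2_norm \<mu> (R (\<theta> \<eta>)) / \<bar>\<eta>\<bar> + 1/2 * (norm ((\<theta> \<eta> - \<theta>\<^sub>0) /\<^sub>R \<eta> - v) * C))
      \<longlongrightarrow> 0 + 1/2 * (norm (v - v) * C)) (at 0)"
    by (intro tendsto_intros RL v)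
  then have lim: "((\<lambda>\<eta>. L2_norm \<mu> (R (\<theta> \<eta>)) / \<bar>\<eta>\<bar> + 1/2 * (norm ((\<theta> \<eta> - \<theta>\<^sub>0) /\<^sub>R \<eta> - v) * C))
      \<longlongrightarrow> 0) (at 0)" by simp
  have "((\<lambda>\<eta>. E \<eta> / \<bar>\<eta>\<bar>) \<longlongrightarrow> 0) (at 0)"
  proof (rule tendsto_sandwich[OF _ _ tendsto_const lim])
    show "\<forall>\<^sub>F \<eta> in at 0. 0 \<le> E \<eta> / \<bar>\<eta>\<bar>"
      by (simp add: E_def L2_norm_nonneg)
    have "\<forall>\<^sub>F \<eta> in at 0. \<bar>\<eta>\<bar> < \<epsilon>"
      using \<epsilon> by (auto simp: eventually_at intro!: exI[of _ \<epsilon>])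
    moreover have "\<forall>\<^sub>F \<eta>::real in at 0. \<eta> \<noteq> 0" by (simp add: eventually_at_filter)
    ultimately show "\<forall>\<^sub>F \<eta> in at 0. E \<eta> / \<bar>\<eta>\<bar>
        \<le> L2_norm \<mu> (R (\<theta> \<eta>)) / \<bar>\<eta>\<bar> + 1/2 * (norm ((\<theta> \<eta> - \<theta>\<^sub>0) /\<^sub>R \<eta> - v) * C)"
    proof eventually_elim
      case (elim \<eta>)
      have "(\<theta> \<eta> - \<theta>\<^sub>0) /\<^sub>R \<eta> - v = (\<theta> \<eta> - \<theta>\<^sub>0 - \<eta> *\<^sub>R v) /\<^sub>R \<eta>"
        using elim by (simp add: scaleR_diff_right)
      then have "norm ((\<theta> \<eta> - \<theta>\<^sub>0) /\<^sub>R \<eta> - v) = norm (\<theta> \<eta> - \<theta>\<^sub>0 - \<eta> *\<^sub>R v) / \<bar>\<eta>\<bar>"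
        by (simp add: divide_inverse_commute)
      then show ?case
        using divide_right_mono[OF E[OF elim(1)], of "\<bar>\<eta>\<bar>"] by (simp add: add_divide_distrib)
    qed
  qed
  then have "E \<in> o[at 0](\<lambda>\<eta>. \<bar>\<eta>\<bar>)"
    by (rule smalloI_tendsto) (simp add: eventually_at_filter)
  moreover have "dominating \<mu> ((\<lambda>\<eta>. F (\<theta> \<eta>)) ` {-\<epsilon><..<\<epsilon>})"
    using dom \<theta>(1) unfolding dominating_def by (auto simp: abs_less_iff)
  moreover have "(\<lambda>x. v \<bullet> l x) \<in> L2_zero_mean (F \<theta>\<^sub>0)"
    by (intro L2_zero_mean_inner P0.finite_measure_axioms l0)
  ultimately show ?thesis
    unfolding regular_path_def E_def using \<epsilon> \<theta> by auto
qed

text \<open>A converse: a path inside the parametric family has no other score. The same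
  root-density increment is expanded once with \<open>h\<close> and once with \<open>l\<close>.
  Subtracting and dividing by \<open>\<eta>\<close> bounds the norm of
  \<open>h - a \<bullet> l\<close>, a fixed number, by a quantity that tends to 0.\<close>

lemma path_score_eq:
  fixes F :: "real^'k \<Rightarrow> 'x measure"
  assumes score: "score_function F \<Theta> \<theta>\<^sub>0 l" and prob: "\<And>\<theta>. \<theta> \<in> \<Theta> \<Longrightarrow> prob_space (F \<theta>)"
    and path: "regular_path \<M> (F \<theta>\<^sub>0) \<epsilon> N h"
    and \<theta>: "\<And>\<eta>. \<bar>\<eta>\<bar> < \<epsilon> \<Longrightarrow> \<theta> \<eta> \<in> \<Theta> \<and> N \<eta> = F (\<theta> \<eta>)" "\<theta> 0 = \<theta>\<^sub>0"
    and a: "((\<lambda>\<eta>. (\<theta> \<eta> - \<theta>\<^sub>0) /\<^sub>R \<eta>) \<longlongrightarrow> a) (at 0)"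
  shows "AE x in F \<theta>\<^sub>0. h x = a \<bullet> l x"
proof -
  from path have \<epsilon>: "0 < \<epsilon>" and h: "h \<in> L2_functions (F \<theta>\<^sub>0)"
    by (auto simp: regular_path_def L2_zero_mean_iff)
  have \<theta>0: "\<theta>\<^sub>0 \<in> \<Theta>" using \<theta>(1)[of 0] \<theta>(2) \<epsilon> by simp
  interpret P0: prob_space "F \<theta>\<^sub>0" using prob \<theta>0 by blast
  from score obtain \<mu> where dom: "dominating \<mu> (F ` \<Theta>)"
    and small: "(\<lambda>\<theta>. L2_norm \<mu> (\<lambda>x. root_density \<mu> (F \<theta>) x - root_density \<mu> (F \<theta>\<^sub>0) x
      - 1/2 * root_density \<mu> (F \<theta>\<^sub>0) x * ((\<theta> - \<theta>\<^sub>0) \<bullet> l x))) \<in> o[at \<theta>\<^sub>0](\<lambda>\<theta>. norm (\<theta> - \<theta>\<^sub>0))"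
    and l0: "\<And>i. (\<lambda>x. l x $ i) \<in> L2_zero_mean (F \<theta>\<^sub>0)"
    unfolding score_function_def by blast
  from path obtain \<nu> where dom': "dominating \<nu> (N ` {-\<epsilon><..<\<epsilon>})"
    and small': "(\<lambda>\<eta>. L2_norm \<nu> (\<lambda>x. root_density \<nu> (N \<eta>) x - root_density \<nu> (F \<theta>\<^sub>0) x
      - 1/2 * \<eta> * h x * root_density \<nu> (F \<theta>\<^sub>0) x)) \<in> o[at 0](\<lambda>\<eta>. \<bar>\<eta>\<bar>)"
    unfolding regular_path_def by blast
  have l: "(\<lambda>x. l x $ i) \<in> L2_functions (F \<theta>\<^sub>0)" for i
    using l0[of i] by (simp add: L2_zero_mean_iff)
  \<comment> \<open>The measure \<open>\<nu>\<close> is only known to dominate the members of the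
    path, so all comparisons are restricted to the parameters that the path visits.\<close>
  define \<Theta>' where "\<Theta>' = \<theta> ` {-\<epsilon><..<\<epsilon>}"
  have N: "N ` {-\<epsilon><..<\<epsilon>} = F ` \<Theta>'"
    unfolding \<Theta>'_def image_image by (rule image_cong) (use \<theta>(1) in \<open>auto simp: abs_less_iff\<close>)
  have \<Theta>': "\<Theta>' \<subseteq> \<Theta>" "\<And>\<eta>. \<bar>\<eta>\<bar> < \<epsilon> \<Longrightarrow> \<theta> \<eta> \<in> \<Theta>'"
    using \<theta>(1) unfolding \<Theta>'_def by (auto simp: abs_less_iff)
  then have \<theta>0': "\<theta>\<^sub>0 \<in> \<Theta>'" using \<theta>(2) \<epsilon> by fastforce
  have \<mu>: "sigma_finite_measure \<mu>" "\<And>\<theta>. \<theta> \<in> \<Theta>' \<Longrightarrow> sets (F \<theta>) = sets \<mu>"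
    "\<And>\<theta>. \<theta> \<in> \<Theta>' \<Longrightarrow> absolutely_continuous \<mu> (F \<theta>)"
    using dom \<Theta>' by (auto simp: dominating_def)
  have \<nu>: "sigma_finite_measure \<nu>" "\<And>\<theta>. \<theta> \<in> \<Theta>' \<Longrightarrow> sets (F \<theta>) = sets \<nu>"
    "\<And>\<theta>. \<theta> \<in> \<Theta>' \<Longrightarrow> absolutely_continuous \<nu> (F \<theta>)"
    using dom' unfolding N by (auto simp: dominating_def)
  have sets: "sets \<nu> = sets \<mu>" using \<mu>(2)[OF \<theta>0'] \<nu>(2)[OF \<theta>0'] by simp
  obtain \<rho> where \<rho>: "sigma_finite_measure \<rho>" "sets \<rho> = sets \<mu>"
    "absolutely_continuous \<rho> \<mu>" "absolutely_continuous \<rho> \<nu>"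
    using sigma_finite_common_dominating[OF \<mu>(1) \<nu>(1) sets] by blast
  have \<rho>F: "sets (F \<theta>) = sets \<rho>" "absolutely_continuous \<rho> (F \<theta>)" if "\<theta> \<in> \<Theta>'" for \<theta>
    using \<mu>(2)[OF that] \<rho> \<mu>(3)[OF that] unfolding absolutely_continuous_def by auto
  have meas: "f \<in> borel_measurable M" if "f \<in> L2_functions (F \<theta>\<^sub>0)" "sets M = sets \<mu>" for f :: "'x \<Rightarrow> real" and M
    by (rule borel_measurable_sets_eq[OF L2_functions_measurable[OF that(1)]])
       (simp add: that(2) \<mu>(2)[OF \<theta>0'])
  define r where "r \<theta> = root_density \<rho> (F \<theta>)" for \<theta>
  have r0: "(\<lambda>x. r \<theta>\<^sub>0 x * f x) \<in> L2_functions \<rho>"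
    "L2_norm \<rho> (\<lambda>x. r \<theta>\<^sub>0 x * f x) = L2_norm (F \<theta>\<^sub>0) f" if "f \<in> L2_functions (F \<theta>\<^sub>0)" for f
    using L2_functions_root_density[OF \<rho>(1) P0.sigma_finite_measure_axioms \<rho>F[OF \<theta>0'] meas[OF that \<rho>(2)] that]
      L2_norm_root_density[OF \<rho>(1) P0.sigma_finite_measure_axioms \<rho>F[OF \<theta>0'] meas[OF that \<rho>(2)]]
    by (simp_all add: r_def)
  have r: "r \<theta> \<in> L2_functions \<rho>" if "\<theta> \<in> \<Theta>'" for \<theta>
    unfolding r_def using root_density_L2_functions[OF \<rho>(1) _ \<rho>F[OF that]] prob \<Theta>' that
    by (auto simp: prob_space_def)
  \<comment> \<open>The remainders of the path expansion and of the score expansion, both moved to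
    the common dominating measure \<open>\<rho>\<close>.\<close>
  define A where "A \<eta> x = r (\<theta> \<eta>) x - r \<theta>\<^sub>0 x - 1/2 * (r \<theta>\<^sub>0 x * (\<eta> * h x))" for \<eta> x
  define B where "B \<zeta> x = r \<zeta> x - r \<theta>\<^sub>0 x - 1/2 * (r \<theta>\<^sub>0 x * ((\<zeta> - \<theta>\<^sub>0) \<bullet> l x))" for \<zeta> x
  have lu: "(\<lambda>x. u \<bullet> l x) \<in> L2_functions (F \<theta>\<^sub>0)" for u by (rule L2_functions_inner[OF l])
  have A: "A \<eta> \<in> L2_functions \<rho>" and B: "B (\<theta> \<eta>) \<in> L2_functions \<rho>" if "\<bar>\<eta>\<bar> < \<epsilon>" for \<eta>
    unfolding A_def[abs_def] B_def
    by (intro L2_functions_diff L2_functions_cmult r r0 h lu \<theta>0' \<Theta>'(2) that)+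
  have small_A: "(\<lambda>\<eta>. L2_norm \<rho> (A \<eta>)) \<in> o[at 0](\<lambda>\<eta>. \<bar>\<eta>\<bar>)"
  proof (rule landau_o.small.in_cong[THEN iffD1, OF _ small'])
    have "\<forall>\<^sub>F \<eta> in at 0. \<bar>\<eta>\<bar> < \<epsilon>"
      using \<epsilon> by (auto simp: eventually_at intro!: exI[of _ \<epsilon>])
    then show "\<forall>\<^sub>F \<eta> in at 0. L2_norm \<nu> (\<lambda>x. root_density \<nu> (N \<eta>) x - root_density \<nu> (F \<theta>\<^sub>0) x
      - 1/2 * \<eta> * h x * root_density \<nu> (F \<theta>\<^sub>0) x) = L2_norm \<rho> (A \<eta>)"
    proof eventually_elim
      case (elim \<eta>)
      have N\<eta>: "N \<eta> = F (\<theta> \<eta>)" using \<theta> elim by blast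
      have "(\<lambda>x. 1/2 * \<eta> * h x) \<in> borel_measurable \<nu>"
        by (rule meas[OF L2_functions_cmult[OF h] sets])
      then have "L2_norm \<rho> (\<lambda>x. root_density \<rho> (F (\<theta> \<eta>)) x - root_density \<rho> (F \<theta>\<^sub>0) x
          - (1/2 * \<eta> * h x) * root_density \<rho> (F \<theta>\<^sub>0) x)
        = L2_norm \<nu> (\<lambda>x. root_density \<nu> (F (\<theta> \<eta>)) x - root_density \<nu> (F \<theta>\<^sub>0) x
          - (1/2 * \<eta> * h x) * root_density \<nu> (F \<theta>\<^sub>0) x)"
        by (intro L2_norm_root_density_expansion \<rho> \<nu> \<theta>0' \<Theta>'(2) elim) (simp add: sets \<rho>)
      then show ?case
        unfolding N\<eta> by (simp add: A_def[abs_def] r_def mult_ac)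
    qed
  qed
  have small_B: "(\<lambda>\<eta>. L2_norm \<rho> (B (\<theta> \<eta>))) \<in> o[at 0](\<lambda>\<eta>. \<bar>\<eta>\<bar>)"
  proof (rule landau_o.small.in_cong[THEN iffD1, OF _ smallo_along_curve[OF small _ a]])
    have "\<forall>\<^sub>F \<eta> in at 0. \<bar>\<eta>\<bar> < \<epsilon>"
      using \<epsilon> by (auto simp: eventually_at intro!: exI[of _ \<epsilon>])
    then show "\<forall>\<^sub>F \<eta> in at 0. L2_norm \<mu> (\<lambda>x. root_density \<mu> (F (\<theta> \<eta>)) x - root_density \<mu> (F \<theta>\<^sub>0) x
      - 1/2 * root_density \<mu> (F \<theta>\<^sub>0) x * ((\<theta> \<eta> - \<theta>\<^sub>0) \<bullet> l x)) = L2_norm \<rho> (B (\<theta> \<eta>))"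
    proof eventually_elim
      case (elim \<eta>)
      have "(\<lambda>x. 1/2 * ((\<theta> \<eta> - \<theta>\<^sub>0) \<bullet> l x)) \<in> borel_measurable \<mu>"
        by (rule meas[OF L2_functions_cmult[OF lu] refl])
      then have "L2_norm \<rho> (\<lambda>x. root_density \<rho> (F (\<theta> \<eta>)) x - root_density \<rho> (F \<theta>\<^sub>0) x
          - (1/2 * ((\<theta> \<eta> - \<theta>\<^sub>0) \<bullet> l x)) * root_density \<rho> (F \<theta>\<^sub>0) x)
        = L2_norm \<mu> (\<lambda>x. root_density \<mu> (F (\<theta> \<eta>)) x - root_density \<mu> (F \<theta>\<^sub>0) x
          - (1/2 * ((\<theta> \<eta> - \<theta>\<^sub>0) \<bullet> l x)) * root_density \<mu> (F \<theta>\<^sub>0) x)"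
        by (intro L2_norm_root_density_expansion \<rho> \<mu> \<theta>0' \<Theta>'(2) elim) (simp add: \<rho>)
      then show ?case
        by (simp add: B_def[abs_def] r_def mult_ac)
    qed
  qed (simp add: L2_norm_zero)
  define C where "C = (\<Sum>i\<in>UNIV. L2_norm (F \<theta>\<^sub>0) (\<lambda>x. l x $ i))"
  let ?d = "\<lambda>\<eta>. (\<theta> \<eta> - \<theta>\<^sub>0) /\<^sub>R \<eta>"
  have bound: "L2_norm (F \<theta>\<^sub>0) (\<lambda>x. h x - a \<bullet> l x)
      \<le> 2 * (L2_norm \<rho> (A \<eta>) / \<bar>\<eta>\<bar> + L2_norm \<rho> (B (\<theta> \<eta>)) / \<bar>\<eta>\<bar>) + norm (?d \<eta> - a) * C"
    if \<eta>: "\<bar>\<eta>\<bar> < \<epsilon>" "\<eta> \<noteq> 0" for \<eta>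
  proof -
    have hd: "(\<lambda>x. h x - ?d \<eta> \<bullet> l x) \<in> L2_functions (F \<theta>\<^sub>0)"
      by (intro L2_functions_diff h lu)
    have "L2_norm (F \<theta>\<^sub>0) (\<lambda>x. h x - a \<bullet> l x)
        = L2_norm (F \<theta>\<^sub>0) (\<lambda>x. (h x - ?d \<eta> \<bullet> l x) + (?d \<eta> - a) \<bullet> l x)"
      by (simp add: inner_simps)
    also have "\<dots> \<le> L2_norm (F \<theta>\<^sub>0) (\<lambda>x. h x - ?d \<eta> \<bullet> l x) + L2_norm (F \<theta>\<^sub>0) (\<lambda>x. (?d \<eta> - a) \<bullet> l x)"
      by (intro L2_norm_triangle hd lu)
    also have "L2_norm (F \<theta>\<^sub>0) (\<lambda>x. h x - ?d \<eta> \<bullet> l x)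
        = L2_norm \<rho> (\<lambda>x. r \<theta>\<^sub>0 x * (h x - ?d \<eta> \<bullet> l x))"
      using r0(2)[OF hd] by simp
    \<comment> \<open>The root-density increments cancel in the difference of \<open>B\<close> and
      \<open>A\<close>; what is left is \<open>\<eta> / 2\<close> times the left-hand side.\<close>
    also have "(\<lambda>x. r \<theta>\<^sub>0 x * (h x - ?d \<eta> \<bullet> l x)) = (\<lambda>x. (2 / \<eta>) * (B (\<theta> \<eta>) x - A \<eta> x))"
      using \<eta> by (intro ext) (simp add: A_def B_def inner_simps field_simps)
    also have "L2_norm \<rho> (\<lambda>x. (2 / \<eta>) * (B (\<theta> \<eta>) x - A \<eta> x))
        \<le> 2 / \<bar>\<eta>\<bar> * (L2_norm \<rho> (B (\<theta> \<eta>)) + L2_norm \<rho> (A \<eta>))"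
      unfolding L2_norm_cmult abs_divide
      by (intro mult_mono L2_norm_triangle_diff A B \<eta>) (simp_all add: L2_norm_nonneg)
    also have "L2_norm (F \<theta>\<^sub>0) (\<lambda>x. (?d \<eta> - a) \<bullet> l x) \<le> norm (?d \<eta> - a) * C"
      unfolding C_def by (rule L2_norm_inner_le[OF l])
    finally show ?thesis by (simp add: add_divide_distrib algebra_simps)
  qed
  have "((\<lambda>\<eta>. 2 * (L2_norm \<rho> (A \<eta>) / \<bar>\<eta>\<bar> + L2_norm \<rho> (B (\<theta> \<eta>)) / \<bar>\<eta>\<bar>) + norm (?d \<eta> - a) * C)
      \<longlongrightarrow> 2 * (0 + 0) + norm (a - a) * C) (at 0)"
    by (intro tendsto_intros smalloD_tendsto[OF small_A] smalloD_tendsto[OF small_B] a)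
  then have "L2_norm (F \<theta>\<^sub>0) (\<lambda>x. h x - a \<bullet> l x) \<le> 2 * (0 + 0) + norm (a - a) * C"
  proof (rule tendsto_lowerbound)
    have "\<forall>\<^sub>F \<eta> in at 0. \<bar>\<eta>\<bar> < \<epsilon> \<and> \<eta> \<noteq> 0"
      using \<epsilon> by (auto simp: eventually_at intro!: exI[of _ \<epsilon>])
    then show "\<forall>\<^sub>F \<eta> in at 0. L2_norm (F \<theta>\<^sub>0) (\<lambda>x. h x - a \<bullet> l x)
      \<le> 2 * (L2_norm \<rho> (A \<eta>) / \<bar>\<eta>\<bar> + L2_norm \<rho> (B (\<theta> \<eta>)) / \<bar>\<eta>\<bar>) + norm (?d \<eta> - a) * C"
      by (rule eventually_mono) (use bound in blast)
  qed simp
  then have "L2_norm (F \<theta>\<^sub>0) (\<lambda>x. h x - a \<bullet> l x) = 0"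
    using L2_norm_nonneg[of "F \<theta>\<^sub>0" "\<lambda>x. h x - a \<bullet> l x"] by simp
  then show ?thesis
    by (subst (asm) L2_norm_eq_0_iff) (auto intro: h lu)
qed


section \<open>Tangent spaces\<close>

lemma regular_path_mono: "\<M> \<subseteq> \<M>' \<Longrightarrow> regular_path \<M> N\<^sub>0 \<epsilon> N h \<Longrightarrow> regular_path \<M>' N\<^sub>0 \<epsilon> N h"
  unfolding regular_path_def by blast

lemma scores_mono: "\<M> \<subseteq> \<M>' \<Longrightarrow> scores \<M> N\<^sub>0 \<subseteq> scores \<M>' N\<^sub>0"
  unfolding scores_def using regular_path_mono by blast

lemma scores_L2_zero_mean: "h \<in> scores \<M> N\<^sub>0 \<Longrightarrow> h \<in> L2_zero_mean N\<^sub>0"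
  unfolding scores_def regular_path_def by blast

lemma tangent_space_L2_zero_mean: "f \<in> tangent_space \<M> N\<^sub>0 \<Longrightarrow> f \<in> L2_zero_mean N\<^sub>0"
  unfolding tangent_space_def by blast

lemma tangent_space_L2_functions: "f \<in> tangent_space \<M> N\<^sub>0 \<Longrightarrow> f \<in> L2_functions N\<^sub>0"
  using tangent_space_L2_zero_mean L2_zero_mean_iff by blast

lemma tangent_space_approx:
  assumes "f \<in> tangent_space \<M> N\<^sub>0" "0 < e"
  obtains T c where "finite T" "T \<subseteq> scores \<M> N\<^sub>0" "L2_norm N\<^sub>0 (\<lambda>x. f x - (\<Sum>h\<in>T. c h * h x)) < e"
  using assms unfolding tangent_space_def by blast

lemma tangent_space_mono:
  assumes "\<M> \<subseteq> \<M>'"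
  shows "tangent_space \<M> N\<^sub>0 \<subseteq> tangent_space \<M>' N\<^sub>0"
proof
  fix f assume f: "f \<in> tangent_space \<M> N\<^sub>0"
  show "f \<in> tangent_space \<M>' N\<^sub>0"
    unfolding tangent_space_def
  proof (intro CollectI conjI allI impI)
    fix e :: real assume "0 < e"
    then obtain T c where "finite T" "T \<subseteq> scores \<M> N\<^sub>0" "L2_norm N\<^sub>0 (\<lambda>x. f x - (\<Sum>h\<in>T. c h * h x)) < e"
      using tangent_space_approx[OF f] by blast
    with scores_mono[OF assms] show "\<exists>T c. finite T \<and> T \<subseteq> scores \<M>' N\<^sub>0 \<and>
        L2_norm N\<^sub>0 (\<lambda>x. f x - (\<Sum>h\<in>T. c h * h x)) < e"
      by blast
  qed (rule tangent_space_L2_zero_mean[OF f])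
qed

lemma scores_subset_tangent_space: "scores \<M> N\<^sub>0 \<subseteq> tangent_space \<M> N\<^sub>0"
proof
  fix h assume h: "h \<in> scores \<M> N\<^sub>0"
  show "h \<in> tangent_space \<M> N\<^sub>0"
    unfolding tangent_space_def using h
    by (auto intro: scores_L2_zero_mean intro!: exI[of _ "{h}"] exI[of _ "\<lambda>_. 1"] simp: L2_norm_zero)
qed

context
  fixes N\<^sub>0 :: "'x measure"
  assumes prob: "prob_space N\<^sub>0"
begin

interpretation prob_space N\<^sub>0 by (fact prob)

lemma L2_zero_mean_add:
  assumes "f \<in> L2_zero_mean N\<^sub>0" "g \<in> L2_zero_mean N\<^sub>0"
  shows "(\<lambda>x. f x + g x) \<in> L2_zero_mean N\<^sub>0"
  using assms L2_functions_integrable_self[of f] L2_functions_integrable_self[of g]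
  by (auto simp: L2_zero_mean_iff)

lemma L2_zero_mean_cmult:
  assumes "f \<in> L2_zero_mean N\<^sub>0"
  shows "(\<lambda>x. c * f x) \<in> L2_zero_mean N\<^sub>0"
  using assms by (auto simp: L2_zero_mean_iff)

lemma L2_zero_mean_zero: "(\<lambda>x. 0) \<in> L2_zero_mean N\<^sub>0"
  by (simp add: L2_zero_mean_iff L2_functions_zero)

lemma scores_combination_L2_functions:
  assumes "T \<subseteq> scores \<M> N\<^sub>0"
  shows "(\<lambda>x. \<Sum>h\<in>T. c h * h x) \<in> L2_functions N\<^sub>0"
  using assms scores_L2_zero_mean by (intro L2_functions_sum L2_functions_cmult) (auto simp: L2_zero_mean_iff)

lemma tangent_space_add:
  assumes f: "f \<in> tangent_space \<M> N\<^sub>0" and g: "g \<in> tangent_space \<M> N\<^sub>0"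
  shows "(\<lambda>x. f x + g x) \<in> tangent_space \<M> N\<^sub>0"
  unfolding tangent_space_def
proof (intro CollectI conjI allI impI)
  show "(\<lambda>x. f x + g x) \<in> L2_zero_mean N\<^sub>0"
    by (intro L2_zero_mean_add tangent_space_L2_zero_mean[OF f] tangent_space_L2_zero_mean[OF g])
  fix e :: real assume "0 < e"
  then have e: "0 < e / 2" by simp
  obtain T c where T: "finite T" "T \<subseteq> scores \<M> N\<^sub>0" "L2_norm N\<^sub>0 (\<lambda>x. f x - (\<Sum>h\<in>T. c h * h x)) < e / 2"
    using tangent_space_approx[OF f e] by blast
  obtain U d where U: "finite U" "U \<subseteq> scores \<M> N\<^sub>0" "L2_norm N\<^sub>0 (\<lambda>x. g x - (\<Sum>h\<in>U. d h * h x)) < e / 2"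
    using tangent_space_approx[OF g e] by blast
  \<comment> \<open>The two finite sets of scores may overlap, so both coefficient functions are
    extended by 0 before they are added.\<close>
  let ?c = "\<lambda>h. (if h \<in> T then c h else 0) + (if h \<in> U then d h else 0)"
  have "(\<Sum>h\<in>T \<union> U. ?c h * h x) = (\<Sum>h\<in>T. c h * h x) + (\<Sum>h\<in>U. d h * h x)" for x
  proof -
    have "(\<Sum>h\<in>T \<union> U. (if h \<in> T then c h else 0) * h x) = (\<Sum>h\<in>T. c h * h x)"
      using T(1) U(1) by (intro sum.mono_neutral_cong_right) auto
    moreover have "(\<Sum>h\<in>T \<union> U. (if h \<in> U then d h else 0) * h x) = (\<Sum>h\<in>U. d h * h x)"
      using T(1) U(1) by (intro sum.mono_neutral_cong_right) auto
    ultimately show ?thesis by (simp add: distrib_right sum.distrib)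
  qed
  then have "L2_norm N\<^sub>0 (\<lambda>x. f x + g x - (\<Sum>h\<in>T \<union> U. ?c h * h x))
    = L2_norm N\<^sub>0 (\<lambda>x. (f x - (\<Sum>h\<in>T. c h * h x)) + (g x - (\<Sum>h\<in>U. d h * h x)))"
    by (simp add: algebra_simps)
  also have "\<dots> \<le> L2_norm N\<^sub>0 (\<lambda>x. f x - (\<Sum>h\<in>T. c h * h x)) + L2_norm N\<^sub>0 (\<lambda>x. g x - (\<Sum>h\<in>U. d h * h x))"
    by (intro L2_norm_triangle L2_functions_diff scores_combination_L2_functions[OF T(2)]
        scores_combination_L2_functions[OF U(2)] tangent_space_L2_functions[OF f] tangent_space_L2_functions[OF g])
  also have "\<dots> < e" using T(3) U(3) by simp
  finally show "\<exists>T c. finite T \<and> T \<subseteq> scores \<M> N\<^sub>0 \<and>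
      L2_norm N\<^sub>0 (\<lambda>x. f x + g x - (\<Sum>h\<in>T. c h * h x)) < e"
    using T(1,2) U(1,2) by (intro exI[of _ "T \<union> U"] exI[of _ ?c]) auto
qed

lemma tangent_space_cmult:
  assumes f: "f \<in> tangent_space \<M> N\<^sub>0"
  shows "(\<lambda>x. a * f x) \<in> tangent_space \<M> N\<^sub>0"
  unfolding tangent_space_def
proof (intro CollectI conjI allI impI)
  show "(\<lambda>x. a * f x) \<in> L2_zero_mean N\<^sub>0"
    by (intro L2_zero_mean_cmult tangent_space_L2_zero_mean[OF f])
  fix e :: real assume e: "0 < e"
  \<comment> \<open>Dividing by \<open>\<bar>a\<bar> + 1\<close> also covers
    \<open>a = 0\<close>.\<close>
  then have "0 < e / (\<bar>a\<bar> + 1)" by (simp add: add_nonneg_pos)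
  then obtain T c where T: "finite T" "T \<subseteq> scores \<M> N\<^sub>0"
    "L2_norm N\<^sub>0 (\<lambda>x. f x - (\<Sum>h\<in>T. c h * h x)) < e / (\<bar>a\<bar> + 1)"
    using tangent_space_approx[OF f] by blast
  have "(\<Sum>h\<in>T. a * c h * h x) = a * (\<Sum>h\<in>T. c h * h x)" for x
    by (simp add: sum_distrib_left mult.assoc)
  then have "L2_norm N\<^sub>0 (\<lambda>x. a * f x - (\<Sum>h\<in>T. a * c h * h x))
    = L2_norm N\<^sub>0 (\<lambda>x. a * (f x - (\<Sum>h\<in>T. c h * h x)))"
    by (simp add: algebra_simps)
  also have "\<dots> \<le> (\<bar>a\<bar> + 1) * L2_norm N\<^sub>0 (\<lambda>x. f x - (\<Sum>h\<in>T. c h * h x))"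
    unfolding L2_norm_cmult by (intro mult_right_mono L2_norm_nonneg) simp
  also have "\<dots> < e" using T(3) by (simp add: field_simps add_nonneg_pos)
  finally show "\<exists>T c. finite T \<and> T \<subseteq> scores \<M> N\<^sub>0 \<and>
      L2_norm N\<^sub>0 (\<lambda>x. a * f x - (\<Sum>h\<in>T. c h * h x)) < e"
    using T(1,2) by (intro exI[of _ T] exI[of _ "\<lambda>h. a * c h"]) auto
qed

lemma tangent_space_zero: "(\<lambda>x. 0) \<in> tangent_space \<M> N\<^sub>0"
  unfolding tangent_space_def
  by (auto intro!: exI[of _ "{}"] simp: L2_norm_zero L2_zero_mean_zero)

lemma tangent_space_finite_sum:
  assumes "\<And>i. i \<in> I \<Longrightarrow> f i \<in> tangent_space \<M> N\<^sub>0"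
  shows "(\<lambda>x. \<Sum>i\<in>I. f i x) \<in> tangent_space \<M> N\<^sub>0"
  using assms
  by (induction I rule: infinite_finite_induct) (auto simp: tangent_space_zero intro: tangent_space_add)

text \<open>The approximation condition only sees almost-everywhere classes. This bridges score
  identities, which hold almost everywhere, and tangent spaces, which are sets of functions.\<close>

lemma tangent_space_cong_AE:
  assumes f: "f \<in> tangent_space \<M> N\<^sub>0" and g: "g \<in> L2_zero_mean N\<^sub>0" and "AE x in N\<^sub>0. f x = g x"
  shows "g \<in> tangent_space \<M> N\<^sub>0"
  unfolding tangent_space_def
proof (intro CollectI conjI allI impI)
  fix e :: real assume "0 < e"
  then obtain T c where T: "finite T" "T \<subseteq> scores \<M> N\<^sub>0" "L2_norm N\<^sub>0 (\<lambda>x. f x - (\<Sum>h\<in>T. c h * h x)) < e"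
    using tangent_space_approx[OF f] by blast
  note [measurable] = scores_combination_L2_functions[OF T(2), THEN L2_functions_measurable]
    tangent_space_L2_functions[OF f, THEN L2_functions_measurable]
  have [measurable]: "g \<in> borel_measurable N\<^sub>0"
    using g by (simp add: L2_zero_mean_def)
  have "L2_norm N\<^sub>0 (\<lambda>x. g x - (\<Sum>h\<in>T. c h * h x)) = L2_norm N\<^sub>0 (\<lambda>x. f x - (\<Sum>h\<in>T. c h * h x))"
  proof (rule L2_norm_cong_AE)
    show "AE x in N\<^sub>0. g x - (\<Sum>h\<in>T. c h * h x) = f x - (\<Sum>h\<in>T. c h * h x)"
      using assms(3) by eventually_elim simp
  qed measurable
  with T show "\<exists>T c. finite T \<and> T \<subseteq> scores \<M> N\<^sub>0 \<and> L2_norm N\<^sub>0 (\<lambda>x. g x - (\<Sum>h\<in>T. c h * h x)) < e"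
    by (intro exI[of _ T] exI[of _ c]) auto
qed (rule g)

text \<open>The operator \<open>f \<mapsto> f - E[f \<psi>] \<bullet> l\<close> is linear and bounded on \<open>L\<^sub>2\<close>.\<close>

lemma tangent_space_finite_dim:
  fixes \<psi> l :: "'x \<Rightarrow> real^'k"
  assumes f: "f \<in> tangent_space \<M> N\<^sub>0"
    and \<psi>: "\<And>i. (\<lambda>x. \<psi> x $ i) \<in> L2_functions N\<^sub>0" and l: "\<And>i. (\<lambda>x. l x $ i) \<in> L2_functions N\<^sub>0"
    and scores: "\<And>h. h \<in> scores \<M> N\<^sub>0 \<Longrightarrow>
      AE x in N\<^sub>0. h x = (\<Sum>i\<in>UNIV. (LINT x|N\<^sub>0. h x * \<psi> x $ i) * l x $ i)"
  shows "AE x in N\<^sub>0. f x = (\<Sum>i\<in>UNIV. (LINT x|N\<^sub>0. f x * \<psi> x $ i) * l x $ i)"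
proof -
  define A where "A f x = (\<Sum>i\<in>UNIV. (LINT x|N\<^sub>0. f x * \<psi> x $ i) * l x $ i)" for f x
  have A: "A f \<in> L2_functions N\<^sub>0" for f
    unfolding A_def[abs_def] by (intro L2_functions_sum L2_functions_cmult l)
  \<comment> \<open>Operator bound for \<open>A\<close>, from the Cauchy-Schwarz inequality in each
    coefficient.\<close>
  define C where "C = (\<Sum>i\<in>UNIV. L2_norm N\<^sub>0 (\<lambda>x. \<psi> x $ i) * L2_norm N\<^sub>0 (\<lambda>x. l x $ i))"
  have C: "0 \<le> C" unfolding C_def by (intro sum_nonneg mult_nonneg_nonneg L2_norm_nonneg)
  have A_bound: "L2_norm N\<^sub>0 (A g) \<le> L2_norm N\<^sub>0 g * C" if g: "g \<in> L2_functions N\<^sub>0" for g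
  proof -
    have "L2_norm N\<^sub>0 (A g) \<le> (\<Sum>i\<in>UNIV. \<bar>LINT x|N\<^sub>0. g x * \<psi> x $ i\<bar> * L2_norm N\<^sub>0 (\<lambda>x. l x $ i))"
      unfolding A_def[abs_def] L2_norm_cmult[symmetric] by (intro L2_norm_sum_le L2_functions_cmult l)
    also have "\<dots> \<le> (\<Sum>i\<in>UNIV. (L2_norm N\<^sub>0 g * L2_norm N\<^sub>0 (\<lambda>x. \<psi> x $ i)) * L2_norm N\<^sub>0 (\<lambda>x. l x $ i))"
      by (intro sum_mono mult_right_mono L2_Cauchy_Schwarz g \<psi> L2_norm_nonneg)
    finally show ?thesis by (simp add: C_def sum_distrib_left mult.assoc)
  qed
  note f' = tangent_space_L2_functions[OF f]
  \<comment> \<open>The map \<open>A\<close> reproduces every score almost everywhere, hence every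
    finite combination \<open>g\<close> of scores. So \<open>f - A f\<close> agrees with
    \<open>(f - g) - A (f - g)\<close>, which is small by boundedness; this carries the identity
    from the scores to the closure of their span.\<close>
  have *: "L2_norm N\<^sub>0 (\<lambda>x. f x - A f x) \<le> e * (1 + C)" if e: "0 < e" for e
  proof -
    obtain T c where T: "finite T" "T \<subseteq> scores \<M> N\<^sub>0" "L2_norm N\<^sub>0 (\<lambda>x. f x - (\<Sum>h\<in>T. c h * h x)) < e"
      using tangent_space_approx[OF f e] by blast
    define g where "g x = (\<Sum>h\<in>T. c h * h x)" for x
    have g: "g \<in> L2_functions N\<^sub>0"
      unfolding g_def by (rule scores_combination_L2_functions[OF T(2)])
    have hL2: "h \<in> L2_functions N\<^sub>0" if "h \<in> T" for h
      using that T(2) scores_L2_zero_mean L2_zero_mean_iff by blast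
    have "AE x in N\<^sub>0. \<forall>h\<in>T. h x = A h x"
      using T(1,2) scores by (intro AE_finite_allI) (auto simp: A_def)
    then have gA: "AE x in N\<^sub>0. g x = A g x"
    proof eventually_elim
      case (elim x)
      have "(LINT x|N\<^sub>0. g x * \<psi> x $ i) = (\<Sum>h\<in>T. c h * (LINT x|N\<^sub>0. h x * \<psi> x $ i))" for i
        unfolding g_def sum_distrib_right mult.assoc
        using L2_functions_mult_integrable[OF hL2 \<psi>] by (subst Bochner_Integration.integral_sum) auto
      then have "A g x = (\<Sum>h\<in>T. c h * A h x)"
        unfolding A_def by (simp add: sum_distrib_right sum_distrib_left mult.assoc) (rule sum.swap)
      with elim show ?case by (simp add: g_def)
    qed
    have "(LINT x|N\<^sub>0. (f x - g x) * \<psi> x $ i) = (LINT x|N\<^sub>0. f x * \<psi> x $ i) - (LINT x|N\<^sub>0. g x * \<psi> x $ i)" for i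
      unfolding left_diff_distrib using L2_functions_mult_integrable[OF f' \<psi>] L2_functions_mult_integrable[OF g \<psi>]
      by simp
    then have Afg: "A (\<lambda>x. f x - g x) x = A f x - A g x" for x
      unfolding A_def by (simp add: left_diff_distrib sum_subtractf)
    note [measurable] = A[THEN L2_functions_measurable] f'[THEN L2_functions_measurable]
      g[THEN L2_functions_measurable]
    have "L2_norm N\<^sub>0 (\<lambda>x. f x - A f x) = L2_norm N\<^sub>0 (\<lambda>x. (f x - g x) - A (\<lambda>x. f x - g x) x)"
    proof (rule L2_norm_cong_AE)
      show "AE x in N\<^sub>0. f x - A f x = (f x - g x) - A (\<lambda>x. f x - g x) x"
        using gA by eventually_elim (simp add: Afg)
    qed measurable
    also have "\<dots> \<le> L2_norm N\<^sub>0 (\<lambda>x. f x - g x) + L2_norm N\<^sub>0 (A (\<lambda>x. f x - g x))"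
      by (intro L2_norm_triangle_diff L2_functions_diff f' g A)
    also have "\<dots> \<le> L2_norm N\<^sub>0 (\<lambda>x. f x - g x) + L2_norm N\<^sub>0 (\<lambda>x. f x - g x) * C"
      by (intro add_left_mono A_bound L2_functions_diff f' g)
    also have "\<dots> \<le> e + e * C"
      using T(3) C unfolding g_def by (intro add_mono mult_right_mono) auto
    finally show ?thesis by (simp add: algebra_simps)
  qed
  have "L2_norm N\<^sub>0 (\<lambda>x. f x - A f x) \<le> e" if "0 < e" for e
    using *[of "e / (1 + C)"] that C by (simp add: add_pos_nonneg)
  then have "L2_norm N\<^sub>0 (\<lambda>x. f x - A f x) \<le> 0"
    by (rule field_le_epsilon) simp
  then have "L2_norm N\<^sub>0 (\<lambda>x. f x - A f x) = 0"
    using L2_norm_nonneg[of N\<^sub>0 "\<lambda>x. f x - A f x"] by simp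
  then show ?thesis
    using L2_norm_eq_0_iff[OF L2_functions_diff[OF f' A[of f]]] by (simp add: A_def)
qed

end


section \<open>The efficient influence function of the constrained model\<close>

text \<open>Pathwise differentiability speaks of difference quotients; this form lets the chain rule
  act on them.\<close>

lemma has_vector_derivative_at_0_iff:
  "(f has_vector_derivative a) (at 0) \<longleftrightarrow> ((\<lambda>\<eta>. (f \<eta> - f 0) /\<^sub>R \<eta>) \<longlongrightarrow> a) (at 0)"
proof -
  have "(f has_vector_derivative a) (at 0)
      \<longleftrightarrow> ((\<lambda>\<eta>. norm (f \<eta> - f 0 - \<eta> *\<^sub>R a) / norm \<eta>) \<longlongrightarrow> 0) (at 0)"
    by (simp add: has_vector_derivative_def has_derivative_at bounded_linear_scaleR_left)
  also have "\<dots> \<longleftrightarrow> ((\<lambda>\<eta>. norm ((f \<eta> - f 0) /\<^sub>R \<eta> - a)) \<longlongrightarrow> 0) (at 0)"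
  proof (rule tendsto_cong)
    have "norm (f \<eta> - f 0 - \<eta> *\<^sub>R a) / norm \<eta> = norm ((f \<eta> - f 0) /\<^sub>R \<eta> - a)" if "\<eta> \<noteq> 0" for \<eta>
    proof -
      have "(f \<eta> - f 0) /\<^sub>R \<eta> - a = (f \<eta> - f 0 - \<eta> *\<^sub>R a) /\<^sub>R \<eta>"
        using that by (simp add: scaleR_diff_right)
      then show ?thesis by (simp add: divide_inverse_commute)
    qed
    then show "\<forall>\<^sub>F \<eta> in at 0. norm (f \<eta> - f 0 - \<eta> *\<^sub>R a) / norm \<eta> = norm ((f \<eta> - f 0) /\<^sub>R \<eta> - a)"
      by (simp add: eventually_at_filter)
  qed
  finally show ?thesis by (simp add: tendsto_norm_zero_iff LIM_zero_iff)
qed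

lemma transpose_information_bound: "transpose (information_bound N \<psi>) = information_bound N \<psi>"
  by (simp add: information_bound_def transpose_def vec_eq_iff mult.commute)

lemma information_bound_mult:
  assumes "\<And>i. (\<lambda>x. \<psi> x $ i) \<in> L2_functions N"
  shows "(information_bound N \<psi> *v u) $ i = (LINT x|N. \<psi> x $ i * (u \<bullet> \<psi> x))"
proof -
  have "(LINT x|N. \<psi> x $ i * (u \<bullet> \<psi> x)) = (LINT x|N. (\<Sum>j\<in>UNIV. u $ j * (\<psi> x $ i * \<psi> x $ j)))"
    by (simp add: inner_vec_def sum_distrib_left mult_ac)
  also have "\<dots> = (\<Sum>j\<in>UNIV. u $ j * (LINT x|N. \<psi> x $ i * \<psi> x $ j))"
    using L2_functions_mult_integrable[OF assms assms] by (subst Bochner_Integration.integral_sum) auto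
  finally show ?thesis
    by (simp add: information_bound_def matrix_vector_mult_def mult.commute)
qed

lemma information_bound_quadratic_form:
  assumes "\<And>i. (\<lambda>x. \<psi> x $ i) \<in> L2_functions N"
  shows "u \<bullet> (information_bound N \<psi> *v u) = (LINT x|N. (u \<bullet> \<psi> x)\<^sup>2)"
proof -
  have u: "(\<lambda>x. u \<bullet> \<psi> x) \<in> L2_functions N" by (rule L2_functions_inner[OF assms])
  have "u \<bullet> (information_bound N \<psi> *v u) = (\<Sum>i\<in>UNIV. u $ i * (LINT x|N. \<psi> x $ i * (u \<bullet> \<psi> x)))"
    unfolding inner_vec_def[of u "information_bound N \<psi> *v u"] by (simp add: information_bound_mult[OF assms])
  also have "\<dots> = (LINT x|N. (\<Sum>i\<in>UNIV. u $ i * (\<psi> x $ i * (u \<bullet> \<psi> x))))"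
    using L2_functions_mult_integrable[OF assms u] by (subst Bochner_Integration.integral_sum) auto
  also have "(\<lambda>x. \<Sum>i\<in>UNIV. u $ i * (\<psi> x $ i * (u \<bullet> \<psi> x))) = (\<lambda>x. (u \<bullet> \<psi> x)\<^sup>2)"
    by (simp add: inner_vec_def power2_eq_square sum_distrib_right mult.assoc)
  finally show ?thesis .
qed

text \<open>The form is the second moment of \<open>u \<bullet> \<psi>\<close>. If it vanished,
  \<open>u \<bullet> \<psi>\<close> would be 0 almost everywhere, and \<open>u\<close> would lie in
  the kernel of an invertible matrix.\<close>

lemma information_bound_pos_def:
  assumes \<psi>: "\<And>i. (\<lambda>x. \<psi> x $ i) \<in> L2_functions N" and inv: "invertible (information_bound N \<psi>)"
    and "u \<noteq> 0"
  shows "0 < u \<bullet> (information_bound N \<psi> *v u)"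
proof -
  have "u \<bullet> (information_bound N \<psi> *v u) \<noteq> 0"
  proof
    assume "u \<bullet> (information_bound N \<psi> *v u) = 0"
    then have "L2_norm N (\<lambda>x. u \<bullet> \<psi> x) = 0"
      by (simp add: information_bound_quadratic_form[OF \<psi>] L2_norm_def)
    then have "AE x in N. u \<bullet> \<psi> x = 0"
      by (subst (asm) L2_norm_eq_0_iff[OF L2_functions_inner[OF \<psi>]])
    then have "(information_bound N \<psi> *v u) $ i = 0" for i
      unfolding information_bound_mult[OF \<psi>] by (intro integral_eq_zero_AE) (elim eventually_mono, simp)
    then have "information_bound N \<psi> *v u = 0" by (simp add: vec_eq_iff)
    then show False
      using inj_matrix_vector_mult[OF inv] \<open>u \<noteq> 0\<close> by (metis injD matrix_vector_mult_0_right)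
  qed
  moreover have "0 \<le> u \<bullet> (information_bound N \<psi> *v u)"
    unfolding information_bound_quadratic_form[OF \<psi>] by simp
  ultimately show ?thesis by simp
qed

lemma integral_scaleR_vec_nth:
  fixes \<psi> :: "'x \<Rightarrow> real^'k"
  assumes "\<And>i. (\<lambda>x. \<psi> x $ i) \<in> L2_functions N" "h \<in> L2_functions N"
  shows "(LINT x|N. h x *\<^sub>R \<psi> x) $ i = (LINT x|N. h x * \<psi> x $ i)"
    and "integrable N (\<lambda>x. h x *\<^sub>R \<psi> x)"
proof -
  have i: "integrable N (\<lambda>x. h x * \<psi> x $ i)" for i
    by (rule L2_functions_mult_integrable[OF assms(2,1)])
  have "(\<lambda>x. h x *\<^sub>R \<psi> x) = (\<lambda>x. \<Sum>i\<in>UNIV. (h x * \<psi> x $ i) *\<^sub>R axis i 1)"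
    by (intro ext) (simp add: vec_eq_iff axis_def if_distrib[of "\<lambda>y. _ * y"] cong: if_cong)
  then show int: "integrable N (\<lambda>x. h x *\<^sub>R \<psi> x)"
    using i by simp
  show "(LINT x|N. h x *\<^sub>R \<psi> x) $ i = (LINT x|N. h x * \<psi> x $ i)"
    using integral_bounded_linear[OF bounded_linear_vec_nth int, of i] by simp
qed

lemma pathwise_gradientD:
  assumes "pathwise_gradient \<phi> \<M> N\<^sub>0 \<psi>" "regular_path \<M> N\<^sub>0 \<epsilon> N h"
  shows "((\<lambda>\<eta>. (\<phi> (N \<eta>) - \<phi> N\<^sub>0) /\<^sub>R \<eta>) \<longlongrightarrow> (LINT x|N\<^sub>0. h x *\<^sub>R \<psi> x)) (at 0)"
  using assms unfolding pathwise_gradient_def by blast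

context regular_semiparametric_model
begin

lemma parameter_eq: "\<theta> \<in> \<Theta> \<Longrightarrow> G \<in> \<G> \<Longrightarrow> parameter P \<Theta> \<G> (P \<theta> G) = \<theta>"
  unfolding parameter_def using identifiable by (intro the_equality) blast+

lemma ell_L2:
  assumes "\<theta> \<in> \<Theta>" "G \<in> \<G>"
  shows "(\<lambda>x. ell \<theta> G x $ i) \<in> L2_zero_mean (P \<theta> G)" "(\<lambda>x. ell \<theta> G x $ i) \<in> L2_functions (P \<theta> G)"
  using eif[OF assms] unfolding efficient_influence_function_def pathwise_gradient_def L2_zero_mean_iff
  by blast+

text \<open>Pathwise differentiability identifies the derivative of the parameter along a path with
  score \<open>h\<close> as the vector of integrals of \<open>h\<close> against \<open>ell\<close>,
  so uniqueness of path scores expresses \<open>h\<close> through \<open>l\<close>. These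
  coefficients are continuous in \<open>h\<close>, which extends the formula to limits of linear
  combinations.\<close>

lemma parametric_tangent_space:
  assumes \<theta>: "\<theta> \<in> \<Theta>" and G: "G \<in> \<G>" and l: "score_function (\<lambda>\<theta>'. P \<theta>' G) \<Theta> \<theta> l"
    and f: "f \<in> tangent_space (submodel P \<Theta> {G}) (P \<theta> G)"
  shows "AE x in P \<theta> G. f x = (\<Sum>i\<in>UNIV. (LINT x|P \<theta> G. f x * ell \<theta> G x $ i) * l x $ i)"
proof (rule tangent_space_finite_dim[OF prob[OF \<theta> G] f ell_L2(2)[OF \<theta> G]])
  show "(\<lambda>x. l x $ i) \<in> L2_functions (P \<theta> G)" for i
    using l by (simp add: score_function_def L2_zero_mean_iff)
  fix h assume "h \<in> scores (submodel P \<Theta> {G}) (P \<theta> G)"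
  then obtain \<epsilon> N where path: "regular_path (submodel P \<Theta> {G}) (P \<theta> G) \<epsilon> N h"
    unfolding scores_def by blast
  then have h: "h \<in> L2_functions (P \<theta> G)" by (simp add: regular_path_def L2_zero_mean_iff)
  let ?\<phi> = "parameter P \<Theta> \<G>"
  have N: "?\<phi> (N \<eta>) \<in> \<Theta> \<and> N \<eta> = P (?\<phi> (N \<eta>)) G" if \<eta>: "\<bar>\<eta>\<bar> < \<epsilon>" for \<eta>
  proof -
    obtain \<theta>' where "\<theta>' \<in> \<Theta>" "N \<eta> = P \<theta>' G"
      using path \<eta> unfolding regular_path_def submodel_def by blast
    then show ?thesis using parameter_eq[OF _ G] by simp
  qed
  have N0: "N 0 = P \<theta> G" using path by (simp add: regular_path_def)
  have "regular_path (submodel P \<Theta> \<G>) (P \<theta> G) \<epsilon> N h"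
    by (rule regular_path_mono[OF _ path]) (use G in \<open>auto simp: submodel_def\<close>)
  then have "((\<lambda>\<eta>. (?\<phi> (N \<eta>) - \<theta>) /\<^sub>R \<eta>) \<longlongrightarrow> (LINT x|P \<theta> G. h x *\<^sub>R ell \<theta> G x)) (at 0)"
    using pathwise_gradientD[of ?\<phi> "submodel P \<Theta> \<G>" "P \<theta> G" "ell \<theta> G"] eif[OF \<theta> G]
    by (simp add: efficient_influence_function_def parameter_eq[OF \<theta> G])
  from path_score_eq[OF l _ path N _ this]
  have "AE x in P \<theta> G. h x = (LINT x|P \<theta> G. h x *\<^sub>R ell \<theta> G x) \<bullet> l x"
    using prob G by (simp add: N0 parameter_eq[OF \<theta> G])
  then show "AE x in P \<theta> G. h x = (\<Sum>i\<in>UNIV. (LINT x|P \<theta> G. h x * ell \<theta> G x $ i) * l x $ i)"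
    unfolding inner_vec_def integral_scaleR_vec_nth(1)[OF ell_L2(2)[OF \<theta> G] h] by simp
qed

text \<open>Write \<open>\<l>\<^sup>*\<^sub>i = f + g\<close> with \<open>f\<close> in the parametric and \<open>g\<close> in the nuisance tangent space. The efficient
  influence function is orthogonal to \<open>g\<close>, so it pairs with \<open>f\<close> as with \<open>\<l>\<^sup>*\<^sub>i\<close>, which forces \<open>f = \<l>\<^sub>i\<close>.\<close>

lemma efficient_score_decomposition:
  assumes \<theta>: "\<theta> \<in> \<Theta>" and G: "G \<in> \<G>" and l: "score_function (\<lambda>\<theta>'. P \<theta>' G) \<Theta> \<theta> l"
  obtains g where "g \<in> tangent_space (submodel P {\<theta>} \<G>) (P \<theta> G)"
    "AE x in P \<theta> G. efficient_score (P \<theta> G) (ell \<theta> G) x $ i = l x $ i + g x"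
proof -
  let ?N = "P \<theta> G" and ?\<psi> = "ell \<theta> G"
  define B where "B = information_bound ?N ?\<psi>"
  have B: "invertible B" using information_exists[OF \<theta> G] by (simp add: B_def)
  note \<psi> = ell_L2(2)[OF \<theta> G]
  let ?e = "\<lambda>i x. efficient_score ?N ?\<psi> x $ i"
  have e: "?e j \<in> tangent_space (submodel P \<Theta> \<G>) ?N"
    "g \<in> tangent_space (submodel P {\<theta>} \<G>) ?N \<Longrightarrow> (LINT x|?N. ?e j x * g x) = 0" for j g
    using efficient_score_projection[OF \<theta> G l, of j]
    unfolding L2_projection_def L2_orthogonal_def by blast+
  then have eL2: "?e j \<in> L2_functions ?N" for j
    using tangent_space_L2_functions by blast
  \<comment> \<open>The influence function is a combination of efficient scores and thereby inherits
    their orthogonality to the nuisance tangent space.\<close>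
  have \<psi>_eq: "?\<psi> x $ j = (\<Sum>m\<in>UNIV. B $ j $ m * ?e m x)" for x j
  proof -
    have "B *v efficient_score ?N ?\<psi> x = ?\<psi> x"
      unfolding efficient_score_def efficient_information_def B_def[symmetric]
      by (simp add: matrix_vector_mul_assoc matrix_inv_right[OF B])
    then have "?\<psi> x $ j = (B *v efficient_score ?N ?\<psi> x) $ j" by simp
    then show ?thesis by (simp add: matrix_vector_mult_def)
  qed
  from e(1)[of i] obtain f g where f: "f \<in> tangent_space (submodel P \<Theta> {G}) ?N"
    and g: "g \<in> tangent_space (submodel P {\<theta>} \<G>) ?N" and fg: "?e i = (\<lambda>x. f x + g x)"
    unfolding tangent_space_sum[OF \<theta> G] by blast
  have fgx: "?e i x = f x + g x" for x using fun_cong[OF fg] by simp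
  note f' = tangent_space_L2_functions[OF f] and g' = tangent_space_L2_functions[OF g]
  have "(LINT x|?N. f x * ?\<psi> x $ j) = (if j = i then 1 else 0)" for j
  proof -
    have "(LINT x|?N. g x * ?\<psi> x $ j) = (LINT x|?N. (\<Sum>m\<in>UNIV. B $ j $ m * (?e m x * g x)))"
      unfolding \<psi>_eq by (simp add: sum_distrib_left mult_ac)
    also have "\<dots> = (\<Sum>m\<in>UNIV. B $ j $ m * (LINT x|?N. ?e m x * g x))"
      using L2_functions_mult_integrable[OF eL2 g'] by (subst Bochner_Integration.integral_sum) auto
    finally have g0: "(LINT x|?N. g x * ?\<psi> x $ j) = 0"
      using e(2)[OF g] by simp
    have "(LINT x|?N. ?e i x * ?\<psi> x $ j) = (LINT x|?N. f x * ?\<psi> x $ j) + (LINT x|?N. g x * ?\<psi> x $ j)"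
      unfolding fgx distrib_right
      using L2_functions_mult_integrable[OF f' \<psi>] L2_functions_mult_integrable[OF g' \<psi>] by simp
    then have "(LINT x|?N. f x * ?\<psi> x $ j) = (LINT x|?N. ?e i x * ?\<psi> x $ j)"
      using g0 by simp
    \<comment> \<open>The mixed moments of efficient score and influence function form
      \<open>matrix_inv B ** B\<close>, the identity matrix.\<close>
    also have "\<dots> = (LINT x|?N. (\<Sum>m\<in>UNIV. matrix_inv B $ i $ m * (?\<psi> x $ m * ?\<psi> x $ j)))"
      by (simp add: efficient_score_def efficient_information_def B_def[symmetric]
          matrix_vector_mult_def sum_distrib_right mult.assoc)
    also have "\<dots> = (\<Sum>m\<in>UNIV. matrix_inv B $ i $ m * B $ m $ j)"
      using L2_functions_mult_integrable[OF \<psi> \<psi>]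
      by (subst Bochner_Integration.integral_sum) (auto simp: B_def information_bound_def)
    also have "\<dots> = (matrix_inv B ** B) $ i $ j"
      by (simp add: matrix_matrix_mult_def)
    also have "\<dots> = (if j = i then 1 else 0)"
      by (simp add: matrix_inv_left[OF B] mat_def)
    finally show ?thesis .
  qed
  then have "AE x in ?N. f x = l x $ i"
    using parametric_tangent_space[OF \<theta> G l f] by (simp cong: if_cong add: if_distribR if_distrib[of "\<lambda>y. y * _"])
  then have "AE x in ?N. ?e i x = l x $ i + g x"
    unfolding fgx by eventually_elim simp
  with g show thesis by (rule that)
qed

lemma efficient_influence_function_constrained:
  fixes S :: "real^'k \<Rightarrow> real^'d" and DS :: "real^'k \<Rightarrow> real^'k^'d"
  assumes \<theta>: "\<theta> \<in> \<Theta>" and G: "G \<in> \<G>" and S0: "S \<theta> = 0"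
    and S_deriv: "\<And>\<theta>. (S has_derivative (\<lambda>v. DS \<theta> *v v)) (at \<theta>)"
    and DS_cont: "continuous_on UNIV DS" and full_rank: "rank (DS \<theta>) = CARD('d)"
  shows "efficient_influence_function (parameter P \<Theta> \<G>) (submodel P {\<theta> \<in> \<Theta>. S \<theta> = 0} \<G>) (P \<theta> G)
     (\<lambda>x. ell \<theta> G x - constraint_gain (DS \<theta>) (efficient_information (P \<theta> G) (ell \<theta> G))
               *v (DS \<theta> *v ell \<theta> G x))"
proof -
  let ?N = "P \<theta> G" and ?\<psi> = "ell \<theta> G" and ?Q = "submodel P {\<theta> \<in> \<Theta>. S \<theta> = 0} \<G>"
  let ?\<phi> = "parameter P \<Theta> \<G>"
  interpret N: prob_space ?N by (rule prob[OF \<theta> G])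
  define B where "B = information_bound ?N ?\<psi>"
  define D where "D = DS \<theta>"
  define K where "K = constraint_gain D (matrix_inv B)"
  define M where "M = mat 1 - K ** D"
  define \<psi>Q where "\<psi>Q x = M *v ?\<psi> x" for x
  note \<psi>0 = ell_L2(1)[OF \<theta> G] and \<psi> = ell_L2(2)[OF \<theta> G]
  have B: "invertible B" "transpose B = B"
    using information_exists[OF \<theta> G] by (simp_all add: B_def transpose_information_bound)
  note pos = information_bound_pos_def[OF \<psi> information_exists[OF \<theta> G], folded B_def]
  note gain = full_rank[folded D_def] B pos
  have DM: "D ** M = 0"
    unfolding M_def K_def by (rule constraint_gain_complement[OF gain])
  have MB: "transpose (M ** B) = M ** B"
    unfolding M_def K_def by (rule constraint_gain_symmetric[OF gain])
  have \<psi>Q_eq: "\<psi>Q = (\<lambda>x. ?\<psi> x - constraint_gain (DS \<theta>) (efficient_information ?N ?\<psi>) *v (DS \<theta> *v ?\<psi> x))"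
    by (simp add: \<psi>Q_def[abs_def] M_def K_def D_def B_def efficient_information_def
        matrix_vector_mult_diff_rdistrib matrix_vector_mul_assoc)
  have \<psi>Q_inner: "\<psi>Q x $ i = row i M \<bullet> ?\<psi> x" for x i
    by (simp add: \<psi>Q_def matrix_vector_mul_component row_def)
  have \<psi>Q0: "(\<lambda>x. \<psi>Q x $ i) \<in> L2_zero_mean ?N" for i
    unfolding \<psi>Q_inner by (intro L2_zero_mean_inner N.finite_measure_axioms \<psi>0)
  have grad: "pathwise_gradient ?\<phi> ?Q ?N \<psi>Q"
    unfolding pathwise_gradient_def
  proof (intro conjI allI impI \<psi>Q0)
    fix \<epsilon> N h assume path: "regular_path ?Q ?N \<epsilon> N h"
    then have \<epsilon>: "0 < \<epsilon>" and h: "h \<in> L2_functions ?N" by (simp_all add: regular_path_def L2_zero_mean_iff)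
    let ?a = "LINT x|?N. h x *\<^sub>R ?\<psi> x"
    have "regular_path (submodel P \<Theta> \<G>) ?N \<epsilon> N h"
      by (rule regular_path_mono[OF _ path]) (auto simp: submodel_def)
    then have lim: "((\<lambda>\<eta>. (?\<phi> (N \<eta>) - ?\<phi> ?N) /\<^sub>R \<eta>) \<longlongrightarrow> ?a) (at 0)"
      using pathwise_gradientD eif[OF \<theta> G] unfolding efficient_influence_function_def by blast
    have "S (?\<phi> (N \<eta>)) = 0" if \<eta>: "\<bar>\<eta>\<bar> < \<epsilon>" for \<eta>
    proof -
      obtain \<theta>' G' where "\<theta>' \<in> \<Theta>" "S \<theta>' = 0" "G' \<in> \<G>" "N \<eta> = P \<theta>' G'"
        using path \<eta> unfolding regular_path_def submodel_def by blast
      then show ?thesis by (simp add: parameter_eq)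
    qed
    then have S\<phi>: "\<forall>\<^sub>F \<eta> in at 0. S (?\<phi> (N \<eta>)) = 0"
      using \<epsilon> by (auto simp: eventually_at intro!: exI[of _ \<epsilon>])
    have N0: "?\<phi> (N 0) = \<theta>"
      using path parameter_eq[OF \<theta> G] by (simp add: regular_path_def)
    have "((\<lambda>\<eta>. ?\<phi> (N \<eta>)) has_derivative (\<lambda>\<eta>. \<eta> *\<^sub>R ?a)) (at 0)"
      using lim has_vector_derivative_at_0_iff[of "\<lambda>\<eta>. ?\<phi> (N \<eta>)" ?a]
      by (simp add: N0 parameter_eq[OF \<theta> G] has_vector_derivative_def)
    moreover have "(S has_derivative (\<lambda>v. D *v v)) (at (?\<phi> (N 0)))"
      using S_deriv[of \<theta>] by (simp add: N0 D_def)
    ultimately have "((\<lambda>\<eta>. S (?\<phi> (N \<eta>))) has_derivative (\<lambda>\<eta>. D *v (\<eta> *\<^sub>R ?a))) (at 0)"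
      by (rule has_derivative_compose)
    \<comment> \<open>Every member of the path satisfies the constraint, so the composite is
      constantly 0 near 0 and its chain-rule derivative must vanish.\<close>
    moreover have "((\<lambda>\<eta>. S (?\<phi> (N \<eta>))) has_derivative (\<lambda>\<eta>. 0)) (at 0)"
    proof (rule has_derivative_transform_eventually[OF has_derivative_const])
      show "\<forall>\<^sub>F \<eta> in at 0. 0 = S (?\<phi> (N \<eta>))"
        using S\<phi> by eventually_elim simp
    qed (simp_all add: N0 S0)
    ultimately have "(\<lambda>\<eta>. D *v (\<eta> *\<^sub>R ?a)) = (\<lambda>\<eta>. 0)"
      by (rule has_derivative_unique)
    then have Da: "D *v ?a = 0"
      using fun_cong[of _ _ 1] by fastforce
    have "(LINT x|?N. h x *\<^sub>R \<psi>Q x) = (LINT x|?N. M *v (h x *\<^sub>R ?\<psi> x))"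
      by (simp add: \<psi>Q_def matrix_vector_mult_scaleR)
    also have "\<dots> = M *v ?a"
      by (rule integral_bounded_linear[OF matrix_vector_mul_bounded_linear integral_scaleR_vec_nth(2)[OF \<psi> h]])
    also have "\<dots> = ?a"
      using Da by (simp add: M_def matrix_vector_mult_diff_rdistrib matrix_vector_mul_assoc[symmetric])
    finally show "((\<lambda>\<eta>. (?\<phi> (N \<eta>) - ?\<phi> ?N) /\<^sub>R \<eta>) \<longlongrightarrow> (LINT x|?N. h x *\<^sub>R \<psi>Q x)) (at 0)"
      using lim by simp
  qed
  obtain l where l: "score_function (\<lambda>\<theta>'. P \<theta>' G) \<Theta> \<theta> l"
    using regular_parametric[OF \<theta> G] by blast
  obtain \<gamma> where \<gamma>: "\<gamma> 0 = \<theta>" "(\<gamma> has_derivative (\<lambda>v. v)) (at 0)"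
    "\<forall>\<^sub>F y in nhds 0. DS \<theta> *v y = 0 \<longrightarrow> S (\<gamma> y) = 0"
    by (rule level_set_chart[OF S_deriv DS_cont full_rank S0])
  \<comment> \<open>With the nuisance parameter kept at \<open>G\<close>, the chart maps the line
    through \<open>v\<close> to a curve that starts at \<open>\<theta>\<close> with velocity
    \<open>v\<close>. It satisfies the constraint for small \<open>\<eta>\<close> because
    \<open>D\<close> vanishes on that line.\<close>
  have score_Q: "(\<lambda>x. v \<bullet> l x) \<in> tangent_space ?Q ?N" if v: "D *v v = 0" for v
  proof -
    have deriv: "((\<lambda>\<eta>. \<gamma> (\<eta> *\<^sub>R v)) has_vector_derivative v) (at 0)"
      using has_derivative_compose[of "\<lambda>\<eta>. \<eta> *\<^sub>R v" "\<lambda>\<eta>. \<eta> *\<^sub>R v" 0 UNIV \<gamma> "\<lambda>v. v"] \<gamma>(2)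
      by (simp add: has_vector_derivative_def has_derivative_scaleR_left)
    then have dq: "((\<lambda>\<eta>. (\<gamma> (\<eta> *\<^sub>R v) - \<theta>) /\<^sub>R \<eta>) \<longlongrightarrow> v) (at 0)"
      by (simp add: has_vector_derivative_at_0_iff \<gamma>(1))
    have lim: "((\<lambda>\<eta>::real. \<eta> *\<^sub>R v) \<longlongrightarrow> 0) (nhds 0)"
      using tendsto_at_iff_tendsto_nhds[of "\<lambda>\<eta>. \<eta> *\<^sub>R v" 0] tendsto_scaleR[OF tendsto_ident_at[of 0 UNIV] tendsto_const[of v]]
      by simp
    have "isCont \<gamma> 0" using \<gamma>(2) has_derivative_continuous by blast
    then have "((\<lambda>y. \<gamma> y) \<longlongrightarrow> \<theta>) (nhds 0)"
      using tendsto_at_iff_tendsto_nhds[of \<gamma> 0] by (simp add: \<gamma>(1) isCont_def)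
    then have "\<forall>\<^sub>F y in nhds 0. \<gamma> y \<in> \<Theta>"
      by (rule topological_tendstoD[OF _ open_parameters \<theta>])
    then have "\<forall>\<^sub>F y in nhds 0. \<gamma> y \<in> \<Theta> \<and> (DS \<theta> *v y = 0 \<longrightarrow> S (\<gamma> y) = 0)"
      using \<gamma>(3) by (rule eventually_conj)
    then have "\<forall>\<^sub>F \<eta> in nhds 0. \<gamma> (\<eta> *\<^sub>R v) \<in> \<Theta> \<and> (DS \<theta> *v (\<eta> *\<^sub>R v) = 0 \<longrightarrow> S (\<gamma> (\<eta> *\<^sub>R v)) = 0)"
      by (rule eventually_compose_filterlim[OF _ lim])
    then obtain \<epsilon> where \<epsilon>: "0 < \<epsilon>" "\<And>\<eta>. \<bar>\<eta>\<bar> < \<epsilon> \<Longrightarrow> \<gamma> (\<eta> *\<^sub>R v) \<in> \<Theta> \<and> S (\<gamma> (\<eta> *\<^sub>R v)) = 0"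
      using v unfolding eventually_nhds_metric D_def by (auto simp: matrix_vector_mult_scaleR)
    have "regular_path ?Q ?N \<epsilon> (\<lambda>\<eta>. P (\<gamma> (\<eta> *\<^sub>R v)) G) (\<lambda>x. v \<bullet> l x)"
      by (rule regular_path_along_curve[OF l _ \<epsilon>(1) _ _ dq])
         (use \<epsilon>(2) G \<gamma>(1) prob in \<open>auto simp: submodel_def\<close>)
    then show ?thesis
      using scores_subset_tangent_space unfolding scores_def by blast
  qed
  have "\<forall>i. \<exists>g. g \<in> tangent_space (submodel P {\<theta>} \<G>) ?N \<and>
      (AE x in ?N. efficient_score ?N ?\<psi> x $ i = l x $ i + g x)"
    (is "\<forall>i. \<exists>g. ?R i g")
  proof
    fix i
    show "\<exists>g. ?R i g"
      by (rule efficient_score_decomposition[OF \<theta> G l, of i]) (intro exI conjI)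
  qed
  from choice[OF this] obtain g where "\<forall>i. ?R i (g i)" ..
  then have g: "\<And>i. g i \<in> tangent_space (submodel P {\<theta>} \<G>) ?N"
    and decomp: "\<And>i. AE x in ?N. efficient_score ?N ?\<psi> x $ i = l x $ i + g i x"
    by simp_all
  \<comment> \<open>The nuisance submodel at \<open>\<theta>\<close> already satisfies the
    constraint.\<close>
  have g_Q: "g i \<in> tangent_space ?Q ?N" for i
  proof -
    have "submodel P {\<theta>} \<G> \<subseteq> ?Q" using \<theta> S0 by (auto simp: submodel_def)
    from tangent_space_mono[OF this] g show ?thesis by blast
  qed
  have "(\<lambda>x. \<psi>Q x $ i) \<in> tangent_space ?Q ?N" for i
  proof (rule tangent_space_cong_AE[OF N.prob_space_axioms _ \<psi>Q0])
    \<comment> \<open>Component \<open>i\<close> of \<open>\<psi>Q\<close> pairs the efficient score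
      with this row. By symmetry the row is also a column of \<open>M ** B\<close>, which
      \<open>D\<close> annihilates.\<close>
    let ?v = "row i (M ** B)"
    have "D *v ?v = 0"
    proof -
      have "?v = column i (M ** B)" using column_transpose[of i "M ** B"] MB by simp
      then have "?v = (M ** B) *v axis i 1" by (simp add: matrix_vector_mult_basis)
      then show ?thesis by (simp only: matrix_vector_mul_assoc matrix_mul_assoc DM) simp
    qed
    then have "(\<lambda>x. ?v \<bullet> l x) \<in> tangent_space ?Q ?N" by (rule score_Q)
    moreover have "(\<lambda>x. \<Sum>j\<in>UNIV. ?v $ j * g j x) \<in> tangent_space ?Q ?N"
      by (rule tangent_space_finite_sum[OF N.prob_space_axioms tangent_space_cmult[OF N.prob_space_axioms g_Q]])
    ultimately show "(\<lambda>x. ?v \<bullet> l x + (\<Sum>j\<in>UNIV. ?v $ j * g j x)) \<in> tangent_space ?Q ?N"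
      by (rule tangent_space_add[OF N.prob_space_axioms])
    have "AE x in ?N. \<forall>j. efficient_score ?N ?\<psi> x $ j = l x $ j + g j x"
      using decomp by (simp add: AE_all_countable)
    then show "AE x in ?N. ?v \<bullet> l x + (\<Sum>j\<in>UNIV. ?v $ j * g j x) = \<psi>Q x $ i"
    proof eventually_elim
      case (elim x)
      have "\<psi>Q x = (M ** B) *v efficient_score ?N ?\<psi> x"
        unfolding \<psi>Q_def efficient_score_def efficient_information_def B_def[symmetric]
        by (simp add: matrix_vector_mul_assoc matrix_mul_assoc[symmetric] matrix_inv_right[OF B(1)])
      then have "\<psi>Q x $ i = ?v \<bullet> efficient_score ?N ?\<psi> x"
        by (simp add: matrix_vector_mul_component row_def)
      also have "\<dots> = ?v \<bullet> l x + (\<Sum>j\<in>UNIV. ?v $ j * g j x)"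
        using elim by (simp add: inner_vec_def distrib_left sum.distrib)
      finally show ?case by simp
    qed
  qed
  with grad show ?thesis
    unfolding efficient_influence_function_def \<psi>Q_eq[symmetric] by blast
qed

end


section \<open>Convergence in distribution\<close>

text \<open>Tightness along the sequence. The bound is required only eventually in \<open>n\<close>,
  which suffices for limits and is what a moment bound valid for \<open>n > 0\<close>
  delivers.\<close>

definition bounded_in_prob ::
    "(nat \<Rightarrow> 's measure) \<Rightarrow> (nat \<Rightarrow> 's \<Rightarrow> 'b::euclidean_space) \<Rightarrow> bool" where
  "bounded_in_prob N Y \<longleftrightarrow> (\<forall>n. Y n \<in> borel_measurable (N n)) \<and>
     (\<forall>e>0. \<exists>L. \<forall>\<^sub>F n in sequentially. measure (N n) {\<omega> \<in> space (N n). L < norm (Y n \<omega>)} < e)"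

text \<open>Finite sums of cosines with arbitrary frequency and phase, hence also constants and
  sines. Limits of their integrals follow from those of single cosines by linearity, and
  product-to-sum formulas make the class an algebra, so that it contains all polynomials in
  sines.\<close>

inductive trig_poly :: "('b::euclidean_space \<Rightarrow> real) \<Rightarrow> bool" where
  cos: "trig_poly (\<lambda>x. a * cos (t \<bullet> x + c))"
| add: "trig_poly f \<Longrightarrow> trig_poly g \<Longrightarrow> trig_poly (\<lambda>x. f x + g x)"

lemma trig_poly_const: "trig_poly (\<lambda>x. a)"
  using trig_poly.cos[of a 0 0] by simp

lemma trig_poly_mult_cos:
  assumes "trig_poly g"
  shows "trig_poly (\<lambda>x. a * cos (t \<bullet> x + c) * g x)"
  using assms
proof induction
  case (cos b s d)
  have "a * cos (t \<bullet> x + c) * (b * cos (s \<bullet> x + d))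
      = (a * b / 2) * cos ((t - s) \<bullet> x + (c - d)) + (a * b / 2) * cos ((t + s) \<bullet> x + (c + d))" for x
  proof -
    have "a * cos A * (b * cos B) = (a * b / 2) * cos (A - B) + (a * b / 2) * cos (A + B)" for A B :: real
      by (simp add: cos_add cos_diff algebra_simps)
    moreover have "(t - s) \<bullet> x + (c - d) = (t \<bullet> x + c) - (s \<bullet> x + d)"
      "(t + s) \<bullet> x + (c + d) = (t \<bullet> x + c) + (s \<bullet> x + d)"
      by (simp_all add: inner_simps)
    ultimately show ?thesis by (simp only:)
  qed
  then show ?case
    using trig_poly.add[OF trig_poly.cos[of "a * b / 2" "t - s" "c - d"] trig_poly.cos[of "a * b / 2" "t + s" "c + d"]]
    by simp
next
  case (add f g)
  then show ?case using trig_poly.add[OF add.IH] by (simp add: distrib_left)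
qed

lemma trig_poly_mult:
  assumes "trig_poly f" "trig_poly g"
  shows "trig_poly (\<lambda>x. f x * g x)"
  using assms
proof induction
  case (cos a t c)
  then show ?case by (rule trig_poly_mult_cos)
next
  case (add f h)
  from trig_poly.add[OF add.IH(1,2)[OF add.prems]] show ?case by (simp add: distrib_right)
qed

lemma trig_poly_sum:
  assumes "\<And>i. i \<in> I \<Longrightarrow> trig_poly (f i)"
  shows "trig_poly (\<lambda>x. \<Sum>i\<in>I. f i x)"
  using assms
  by (induction I rule: infinite_finite_induct) (auto simp: trig_poly_const intro: trig_poly.add)

lemma trig_poly_measurable: "trig_poly f \<Longrightarrow> f \<in> borel_measurable borel"
  by (induction rule: trig_poly.induct) auto

lemma trig_poly_bounded: "trig_poly f \<Longrightarrow> \<exists>C. \<forall>x. \<bar>f x\<bar> \<le> C"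
proof (induction rule: trig_poly.induct)
  case (cos a t c)
  have "\<bar>a * cos (t \<bullet> x + c)\<bar> \<le> \<bar>a\<bar> * 1" for x
    unfolding abs_mult by (intro mult_left_mono) auto
  then show ?case by auto
next
  case (add f g)
  then obtain C D where "\<forall>x. \<bar>f x\<bar> \<le> C" "\<forall>x. \<bar>g x\<bar> \<le> D" by auto
  then have "\<bar>f x + g x\<bar> \<le> C + D" for x
    using abs_triangle_ineq[of "f x" "g x"] by (smt (verit))
  then show ?case by blast
qed

lemma trig_poly_real_polynomial:
  fixes p :: "'b::euclidean_space \<Rightarrow> real"
  assumes "real_polynomial_function p"
  shows "trig_poly (\<lambda>x. p (\<Sum>b\<in>Basis. sin (r * (x \<bullet> b)) *\<^sub>R b))"
  using assms
proof (induction rule: real_polynomial_function.induct)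
  case (linear f)
  interpret bounded_linear f by fact
  \<comment> \<open>A sine is a cosine with phase \<open>- (pi / 2)\<close>, so linear functions of
    the vector of sines are covered.\<close>
  have "trig_poly (\<lambda>x. f b * cos ((r *\<^sub>R b) \<bullet> x + (- (pi / 2))))" for b
    by (rule trig_poly.cos)
  then have "trig_poly (\<lambda>x. \<Sum>b\<in>Basis. f b * sin (r * (x \<bullet> b)))"
    by (intro trig_poly_sum) (simp add: cos_diff inner_commute)
  then show ?case by (simp add: sum scaleR mult.commute)
qed (auto intro: trig_poly_const trig_poly.add trig_poly_mult)

text \<open>The approximation has to be good on a ball only: outside it a loss of
  \<open>2 * C\<close> is paid, weighted by the tail probability. The bound \<open>C'\<close> on
  \<open>q\<close> secures integrability.\<close>

lemma (in prob_space) integral_diff_le_outside: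
  fixes Z :: "'a \<Rightarrow> 'b::euclidean_space" and f q :: "'b \<Rightarrow> real"
  assumes Z[measurable]: "Z \<in> borel_measurable M" and f[measurable]: "f \<in> borel_measurable borel"
    and q[measurable]: "q \<in> borel_measurable borel"
    and f_le: "\<And>x. \<bar>f x\<bar> \<le> C" and q_le: "\<And>x. \<bar>q x\<bar> \<le> C'"
    and fq: "\<And>x. \<bar>f x - q x\<bar> \<le> d + 2 * C * indicator {x. L < norm x} x"
  shows "\<bar>(LINT \<omega>|M. f (Z \<omega>)) - (LINT \<omega>|M. q (Z \<omega>))\<bar> \<le> d + 2 * C * prob {\<omega> \<in> space M. L < norm (Z \<omega>)}"
proof -
  have int: "integrable M (\<lambda>\<omega>. f (Z \<omega>))" "integrable M (\<lambda>\<omega>. q (Z \<omega>))"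
    by (intro integrable_const_bound[of _ C], use f_le in auto)
       (intro integrable_const_bound[of _ C'], use q_le in auto)
  have "{\<omega> \<in> space M. L < norm (Z \<omega>)} \<in> events" by measurable
  then have ind: "integrable M (\<lambda>\<omega>. 2 * C * indicator {\<omega> \<in> space M. L < norm (Z \<omega>)} \<omega>)"
    "(LINT \<omega>|M. indicator {\<omega> \<in> space M. L < norm (Z \<omega>)} \<omega>) = prob {\<omega> \<in> space M. L < norm (Z \<omega>)}"
    by (intro integrable_mult_right integrable_real_indicator) (auto simp: less_top[symmetric] Int_def conj_commute)
  have "\<bar>(LINT \<omega>|M. f (Z \<omega>)) - (LINT \<omega>|M. q (Z \<omega>))\<bar> = \<bar>LINT \<omega>|M. f (Z \<omega>) - q (Z \<omega>)\<bar>"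
    using int by simp
  also have "\<dots> \<le> (LINT \<omega>|M. \<bar>f (Z \<omega>) - q (Z \<omega>)\<bar>)" by (rule integral_abs_bound)
  also have "\<dots> \<le> (LINT \<omega>|M. d + 2 * C * indicator {\<omega> \<in> space M. L < norm (Z \<omega>)} \<omega>)"
  proof (rule integral_mono)
    show "\<bar>f (Z \<omega>) - q (Z \<omega>)\<bar> \<le> d + 2 * C * indicator {\<omega> \<in> space M. L < norm (Z \<omega>)} \<omega>"
      if "\<omega> \<in> space M" for \<omega>
      using fq[of "Z \<omega>"] that by (simp add: indicator_def)
  qed (use int ind in auto)
  also have "\<dots> = d + 2 * C * prob {\<omega> \<in> space M. L < norm (Z \<omega>)}"
    using ind by (simp add: prob_space)
  finally show ?thesis .
qed

text \<open>The function \<open>H\<close> recovers coordinates from their sines by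
  \<open>arcsin\<close>, so \<open>H (s x)\<close> is bounded by \<open>C\<close> everywhere and
  equals \<open>f x\<close> on the ball of radius \<open>L\<close>. As \<open>H\<close> is
  continuous on the cube containing all values of \<open>s\<close>, a polynomial in the sines is
  uniformly close to it over the whole space.\<close>

lemma trig_poly_approx:
  fixes f :: "'b::euclidean_space \<Rightarrow> real"
  assumes f: "continuous_on UNIV f" and f_le: "\<And>x. \<bar>f x\<bar> \<le> C" and d: "0 < d"
  obtains q where "trig_poly q" "\<And>x. \<bar>f x - q x\<bar> \<le> d + 2 * C * indicator {x. L < norm x} x"
proof -
  \<comment> \<open>Scaled so that coordinates of modulus up to \<open>\<bar>L\<bar> + 1\<close>
    land between \<open>- pi / 2\<close> and \<open>pi / 2\<close>, where \<open>arcsin\<close>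
    inverts \<open>sin\<close>.\<close>
  define r where "r = pi / (2 * (\<bar>L\<bar> + 1))"
  have r: "0 < r" by (simp add: r_def add_nonneg_pos)
  define H where "H u = f (\<Sum>b\<in>Basis. (arcsin (u \<bullet> b) / r) *\<^sub>R b)" for u
  define s where "s x = (\<Sum>b\<in>Basis. sin (r * (x \<bullet> b)) *\<^sub>R b)" for x :: 'b
  have "continuous_on (cbox (- One) One) (\<lambda>u::'b. \<Sum>b\<in>Basis. (arcsin (u \<bullet> b) / r) *\<^sub>R b)"
    by (intro continuous_intros) (use r in \<open>auto simp: mem_box\<close>)
  then have "continuous_on (cbox (- One) One) H"
    unfolding H_def by (rule continuous_on_compose2[OF f]) auto
  then obtain p where p: "real_polynomial_function p" "\<And>u. u \<in> cbox (- One) One \<Longrightarrow> \<bar>H u - p u\<bar> < d"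
    using Stone_Weierstrass_real_polynomial_function[OF compact_cbox _ d] by blast
  have s_box: "s x \<in> cbox (- One) One" for x
    by (simp add: mem_box s_def inner_sum_left inner_Basis if_distrib cong: if_cong)
  have Hs: "H (s x) = f x" if x: "norm x \<le> L" for x
  proof -
    have "arcsin (s x \<bullet> b) / r = x \<bullet> b" if b: "b \<in> Basis" for b
    proof -
      have "\<bar>x \<bullet> b\<bar> \<le> \<bar>L\<bar> + 1" using Basis_le_norm[OF b, of x] x by linarith
      then have "\<bar>r * (x \<bullet> b)\<bar> \<le> r * (\<bar>L\<bar> + 1)"
        unfolding abs_mult using r by (intro mult_mono) auto
      also have "r * (\<bar>L\<bar> + 1) = pi / 2" by (simp add: r_def field_simps add_nonneg_eq_0_iff)
      finally have "arcsin (sin (r * (x \<bullet> b))) = r * (x \<bullet> b)" by (intro arcsin_sin) auto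
      moreover have "s x \<bullet> b = sin (r * (x \<bullet> b))"
        using b by (simp add: s_def inner_sum_left inner_Basis if_distrib cong: if_cong)
      ultimately show ?thesis using r by simp
    qed
    then have "(\<Sum>b\<in>Basis. (arcsin (s x \<bullet> b) / r) *\<^sub>R b) = x"
      by (simp add: euclidean_representation)
    then show ?thesis by (simp add: H_def)
  qed
  show thesis
  proof (rule that)
    show "trig_poly (\<lambda>x. p (s x))"
      unfolding s_def by (rule trig_poly_real_polynomial[OF p(1)])
    fix x
    have "\<bar>f x - H (s x)\<bar> \<le> 2 * C * indicator {x. L < norm x} x"
    proof (cases "norm x \<le> L")
      case False
      have "\<bar>f x - H (s x)\<bar> \<le> \<bar>f x\<bar> + \<bar>H (s x)\<bar>" by (rule abs_triangle_ineq4)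
      also have "\<dots> \<le> C + C"
        unfolding H_def by (intro add_mono f_le)
      finally show ?thesis using False by simp
    qed (simp add: Hs)
    moreover have "\<bar>H (s x) - p (s x)\<bar> < d" by (rule p(2)[OF s_box])
    ultimately show "\<bar>f x - p (s x)\<bar> \<le> d + 2 * C * indicator {x. L < norm x} x" by linarith
  qed
qed

lemma (in prob_space) norm_tail_small:
  fixes Z :: "'a \<Rightarrow> 'b::euclidean_space"
  assumes [measurable]: "Z \<in> borel_measurable M" and e: "0 < e"
  obtains L where "0 \<le> L" "prob {\<omega> \<in> space M. L < norm (Z \<omega>)} < e"
proof -
  let ?A = "\<lambda>n::nat. {\<omega> \<in> space M. real n < norm (Z \<omega>)}"
  have "(\<lambda>n. prob (?A n)) \<longlonglongrightarrow> prob (\<Inter>n. ?A n)"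
    by (rule finite_Lim_measure_decseq) (auto simp: decseq_def)
  moreover have "(\<Inter>n. ?A n) = {}"
  proof -
    have "\<exists>n. \<not> real n < norm (Z \<omega>)" for \<omega>
      using real_arch_simple[of "norm (Z \<omega>)"] by (auto simp: not_less)
    then show ?thesis by blast
  qed
  ultimately have "(\<lambda>n. prob (?A n)) \<longlonglongrightarrow> 0" by simp
  from order_tendstoD(2)[OF this e] obtain n where "prob (?A n) < e"
    unfolding eventually_sequentially by blast
  then show thesis using that[of "real n"] by simp
qed

text \<open>A multivariate Levy continuity theorem, with tightness as a hypothesis. The test function is
  replaced by the periodic function that agrees with it on a large box and is a continuous function
  of the sines of the coordinates, so that the Stone-Weierstrass theorem applies.\<close>

lemma tendsto_in_distribution_cosI:
  fixes Y :: "nat \<Rightarrow> 's \<Rightarrow> 'b::euclidean_space"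
  assumes N: "\<And>n. prob_space (N n)" and \<nu>: "prob_space \<nu>" and sets_\<nu>: "sets \<nu> = sets borel"
    and tight: "bounded_in_prob N Y"
    and cos: "\<And>t c. (\<lambda>n. LINT \<omega>|N n. cos (t \<bullet> Y n \<omega> + c)) \<longlonglongrightarrow> (LINT y|\<nu>. cos (t \<bullet> y + c))"
  shows "tendsto_in_distribution N Y \<nu>"
  unfolding tendsto_in_distribution_def
proof (intro conjI allI impI)
  show Y[measurable]: "Y n \<in> borel_measurable (N n)" for n
    using tight by (simp add: bounded_in_prob_def)
  note [measurable_cong] = sets_\<nu>
  fix f :: "'b \<Rightarrow> real"
  assume f: "continuous_on UNIV f" and bdd: "bounded (range f)"
  have [measurable]: "f \<in> borel_measurable borel"
    using f by (rule borel_measurable_continuous_onI)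
  obtain C where C: "\<And>x. \<bar>f x\<bar> \<le> C" "0 < C"
    using bdd unfolding bounded_pos by auto
  have trig: "(\<lambda>n. LINT \<omega>|N n. q (Y n \<omega>)) \<longlonglongrightarrow> (LINT y|\<nu>. q y)" if "trig_poly q" for q
    using that
  proof (induction rule: trig_poly.induct)
    case (cos a t c)
    then show ?case using tendsto_mult_left[OF assms(5)] by simp
  next
    case (add f g)
    have int: "integrable M (\<lambda>x. h (Z x))" if "prob_space M" "Z \<in> borel_measurable M" "trig_poly h"
      for M :: "'c measure" and Z and h :: "'b \<Rightarrow> real"
    proof -
      interpret prob_space M by fact
      obtain D where "\<forall>x. \<bar>h x\<bar> \<le> D" using trig_poly_bounded[OF \<open>trig_poly h\<close>] by blast
      moreover note [measurable] = trig_poly_measurable[OF \<open>trig_poly h\<close>] \<open>Z \<in> borel_measurable M\<close>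
      ultimately show ?thesis by (intro integrable_const_bound[of _ D]) auto
    qed
    show ?case
      using tendsto_add[OF add.IH] int[OF N Y] int[OF N Y] int[OF \<nu>, of "\<lambda>x. x"] add.hyps
      by simp
  qed
  show "(\<lambda>n. LINT \<omega>|N n. f (Y n \<omega>)) \<longlonglongrightarrow> (LINT y|\<nu>. f y)"
  proof (rule LIMSEQ_I)
    fix e :: real assume e: "0 < e"
    \<comment> \<open>Three errors add up: \<open>d + 2 * C * d\<close> for replacing
      \<open>f\<close> by \<open>q\<close> under each of the two laws, and \<open>d\<close> for the
      convergence of the integrals of \<open>q\<close>.\<close>
    define d where "d = e / (3 + 4 * C)"
    have d: "0 < d" "d * (3 + 4 * C) = e" using e C by (simp_all add: d_def)
    obtain L1 where L1: "\<forall>\<^sub>F n in sequentially. measure (N n) {\<omega> \<in> space (N n). L1 < norm (Y n \<omega>)} < d"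
      using tight d(1) unfolding bounded_in_prob_def by blast
    obtain L2 where L2: "measure \<nu> {y \<in> space \<nu>. L2 < norm y} < d"
      using prob_space.norm_tail_small[OF \<nu> _ d(1), of "\<lambda>x. x"] by auto
    define L where "L = max L1 L2"
    obtain q where q: "trig_poly q" "\<And>x. \<bar>f x - q x\<bar> \<le> d + 2 * C * indicator {x. L < norm x} x"
      using trig_poly_approx[OF f C(1) d(1)] by blast
    note [measurable] = trig_poly_measurable[OF q(1)]
    obtain C' where C': "\<And>x. \<bar>q x\<bar> \<le> C'" using trig_poly_bounded[OF q(1)] by blast
    have "measure \<nu> {y \<in> space \<nu>. L < norm y} \<le> measure \<nu> {y \<in> space \<nu>. L2 < norm y}"
      using \<nu> by (intro finite_measure.finite_measure_mono) (auto simp: L_def prob_space_def)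
    then have "2 * C * measure \<nu> {y \<in> space \<nu>. L < norm y} \<le> 2 * C * d"
      using L2 C by (intro mult_left_mono) auto
    moreover have "\<bar>(LINT y|\<nu>. f y) - (LINT y|\<nu>. q y)\<bar> \<le> d + 2 * C * measure \<nu> {y \<in> space \<nu>. L < norm y}"
      by (rule prob_space.integral_diff_le_outside[OF \<nu> _ _ _ C(1) C' q(2)]) measurable
    ultimately have \<nu>_le: "\<bar>(LINT y|\<nu>. f y) - (LINT y|\<nu>. q y)\<bar> \<le> d + 2 * C * d" by linarith
    have "\<forall>\<^sub>F n in sequentially. \<bar>(LINT \<omega>|N n. q (Y n \<omega>)) - (LINT y|\<nu>. q y)\<bar> < d"
      using tendstoD[OF trig[OF q(1)] d(1)] by (simp add: dist_real_def)
    with L1 have "\<forall>\<^sub>F n in sequentially. norm ((LINT \<omega>|N n. f (Y n \<omega>)) - (LINT y|\<nu>. f y)) < e"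
    proof eventually_elim
      case (elim n)
      have "measure (N n) {\<omega> \<in> space (N n). L < norm (Y n \<omega>)} \<le> measure (N n) {\<omega> \<in> space (N n). L1 < norm (Y n \<omega>)}"
        using N[of n] by (intro finite_measure.finite_measure_mono) (auto simp: L_def prob_space_def)
      then have "2 * C * measure (N n) {\<omega> \<in> space (N n). L < norm (Y n \<omega>)} \<le> 2 * C * d"
        using elim C by (intro mult_left_mono) auto
      moreover have "\<bar>(LINT \<omega>|N n. f (Y n \<omega>)) - (LINT \<omega>|N n. q (Y n \<omega>))\<bar>
          \<le> d + 2 * C * measure (N n) {\<omega> \<in> space (N n). L < norm (Y n \<omega>)}"
        by (rule prob_space.integral_diff_le_outside[OF N _ _ _ C(1) C' q(2)]) measurable
      ultimately have "\<bar>(LINT \<omega>|N n. f (Y n \<omega>)) - (LINT \<omega>|N n. q (Y n \<omega>))\<bar> \<le> d + 2 * C * d" by linarith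
      moreover have "(d + 2 * C * d) + d + (d + 2 * C * d) = e"
        using d(2) by (simp add: algebra_simps)
      ultimately show ?case using \<nu>_le elim(2) unfolding real_norm_def by linarith
    qed
    then show "\<exists>no. \<forall>n\<ge>no. norm ((LINT \<omega>|N n. f (Y n \<omega>)) - (LINT y|\<nu>. f y)) < e"
      by (simp add: eventually_sequentially)
  qed
qed

text \<open>Translates characteristic functions into integrals of cosines with a phase, the form in
  which the limit theorems here are stated.\<close>

lemma (in prob_space) integral_cos_eq_Re:
  assumes [measurable]: "X \<in> borel_measurable M"
  shows "(LINT \<omega>|M. cos (X \<omega> + c)) = Re (iexp c * (CLINT \<omega>|M. iexp (X \<omega>)))"
proof -
  have int: "integrable M (\<lambda>\<omega>. iexp c * iexp (X \<omega>))"
    by (intro integrable_const_bound[of _ 1]) (auto simp: norm_mult)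
  have "(LINT \<omega>|M. cos (X \<omega> + c)) = (LINT \<omega>|M. Re (iexp c * iexp (X \<omega>)))"
    by (intro Bochner_Integration.integral_cong)
       (simp_all add: Re_exp exp_add[symmetric] distrib_left[symmetric] add.commute)
  also have "\<dots> = Re (CLINT \<omega>|M. iexp c * iexp (X \<omega>))"
    by (rule integral_Re[OF int])
  also have "(CLINT \<omega>|M. iexp c * iexp (X \<omega>)) = iexp c * (CLINT \<omega>|M. iexp (X \<omega>))"
    by simp
  finally show ?thesis .
qed


section \<open>The central limit theorem for samples\<close>

context
  fixes N :: "'x measure"
  assumes prob: "prob_space N"
begin

interpretation N: prob_space N by (fact prob)
interpretation product_prob_space "\<lambda>_::nat. N" UNIV by standard

text \<open>One infinite product carries the samples of all sizes, because the central limit theorem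
  concerns a single sequence of random variables. Each sample law is its image under restriction to
  the first \<open>n\<close> coordinates.\<close>

abbreviation (input) "Np \<equiv> Pi\<^sub>M (UNIV :: nat set) (\<lambda>_. N)"

lemma prob_space_sample: "prob_space (sample N n)"
  unfolding sample_def by (rule prob_space_PiM) (rule prob)

lemma sample_eq_distr: "sample N n = distr Np (sample N n) (\<lambda>x. restrict x {..<n})"
  unfolding sample_def by (rule distr_PiM_restrict_finite[symmetric]) auto

lemma integral_sample:
  fixes f :: "(nat \<Rightarrow> 'x) \<Rightarrow> 'b::{banach, second_countable_topology}"
  assumes "f \<in> borel_measurable (sample N n)"
  shows "integral\<^sup>L (sample N n) f = (LINT x|Np. f (restrict x {..<n}))"
  by (subst sample_eq_distr, subst integral_distr[OF _ assms])
     (simp_all add: sample_def measurable_restrict_subset)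

lemma indep_coordinates: "P.indep_vars (\<lambda>_. N) (\<lambda>i x. x i) UNIV"
proof (subst P.indep_vars_iff_distr_eq_PiM)
  have "distr Np Np (\<lambda>x. \<lambda>i\<in>UNIV. x i) = distr Np Np (\<lambda>x. x)" by (simp add: restrict_def)
  also have "\<dots> = Np" by (rule distr_id)
  finally show "distr Np Np (\<lambda>x. \<lambda>i\<in>UNIV. x i) = (\<Pi>\<^sub>M i\<in>UNIV. distr Np N (\<lambda>x. x i))"
    using distr_PiM_component[of "UNIV :: nat set" "\<lambda>_. N"] prob by simp
qed auto

lemma indep_coordinates_compose:
  assumes [measurable]: "\<psi> \<in> borel_measurable N"
  shows "P.indep_vars (\<lambda>_. borel) (\<lambda>i x. \<psi> (x i)) UNIV"
  by (rule P.indep_vars_compose2[OF indep_coordinates, of "\<lambda>_. \<psi>"]) simp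

lemma integral_coordinate:
  fixes f :: "'x \<Rightarrow> 'b::{banach, second_countable_topology}"
  assumes "f \<in> borel_measurable N"
  shows "(LINT x|Np. f (x i)) = integral\<^sup>L N f" "integrable Np (\<lambda>x. f (x i)) \<longleftrightarrow> integrable N f"
  using distr_PiM_component[of "UNIV :: nat set" "\<lambda>_. N" i] prob assms
    integral_distr[of "\<lambda>x. x i" Np N f] integrable_distr_eq[of "\<lambda>x. x i" Np N f]
  by simp_all

text \<open>Weak convergence to the normal law is tested against
  \<open>cos (\<sigma> * z + c)\<close>, whose normal integral is the real part of
  \<open>iexp c\<close> times the characteristic function at \<open>\<sigma>\<close>.
  Standardization divides by \<open>\<sigma>\<close>, so a degenerate \<open>\<psi>\<close> is
  treated separately: there the sums vanish almost surely.\<close>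

lemma clt_cos:
  assumes \<psi>: "\<psi> \<in> L2_zero_mean N"
  shows "(\<lambda>n. LINT x|sample N n. cos ((\<Sum>i<n. \<psi> (x i)) / sqrt n + c))
    \<longlonglongrightarrow> cos c * exp (- (LINT x|N. (\<psi> x)\<^sup>2) / 2)"
proof -
  have [measurable]: "\<psi> \<in> borel_measurable N" and sq: "integrable N (\<lambda>x. (\<psi> x)\<^sup>2)"
    and mean: "(LINT x|N. \<psi> x) = 0"
    using \<psi> by (auto simp: L2_zero_mean_def)
  have m: "(\<lambda>x. cos ((\<Sum>i<n. \<psi> (x i)) / sqrt n + c)) \<in> borel_measurable (sample N n)" for n
    unfolding sample_def by measurable
  define v where "v = (LINT x|N. (\<psi> x)\<^sup>2)"
  have "v \<ge> 0" by (simp add: v_def)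
  have eq: "(LINT x|sample N n. cos ((\<Sum>i<n. \<psi> (x i)) / sqrt n + c))
      = (LINT x|Np. cos ((\<Sum>i<n. \<psi> (x i)) / sqrt n + c))" for n
    unfolding integral_sample[OF m] by simp
  show ?thesis
  proof (cases "v = 0")
    case True
    then have "AE x in N. (\<psi> x)\<^sup>2 = 0"
      using integral_nonneg_eq_0_iff_AE[OF sq] by (simp add: v_def)
    then have "AE x in Np. (\<psi> (x i))\<^sup>2 = 0" for i
      using AE_PiM_component[of UNIV "\<lambda>_. N" i "\<lambda>x. (\<psi> x)\<^sup>2 = 0"] prob by simp
    then have AE: "AE x in Np. \<forall>i. \<psi> (x i) = 0"
      by (simp add: AE_all_countable)
    have "(LINT x|Np. cos ((\<Sum>i<n. \<psi> (x i)) / sqrt n + c)) = (LINT x|Np. cos c)" for n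
    proof (rule integral_cong_AE)
      show "AE x in Np. cos ((\<Sum>i<n. \<psi> (x i)) / sqrt n + c) = cos c"
        using AE by eventually_elim simp
    qed measurable
    with True show ?thesis by (simp add: eq v_def P.prob_space)
  next
    case False
    define \<sigma> where "\<sigma> = sqrt v"
    have \<sigma>: "0 < \<sigma>" "\<sigma>\<^sup>2 = v" using \<open>v \<ge> 0\<close> False by (simp_all add: \<sigma>_def)
    let ?S = "\<lambda>n x. (\<Sum>i<n. \<psi> (x i)) / sqrt (real n * \<sigma>\<^sup>2)"
    have weak: "weak_conv_m (\<lambda>n. distr Np borel (?S n)) std_normal_distribution"
    proof (rule P.central_limit_theorem_zero_mean[where \<mu> = "distr N borel \<psi>", OF indep_coordinates_compose])
      show "P.expectation (\<lambda>x. \<psi> (x n)) = 0" for n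
        by (simp add: integral_coordinate mean)
      then show "P.variance (\<lambda>x. \<psi> (x n)) = \<sigma>\<^sup>2" for n
        using integral_coordinate(1)[of "\<lambda>x. (\<psi> x)\<^sup>2"] by (simp add: \<sigma> v_def)
      show "integrable Np (\<lambda>x. (\<psi> (x n))\<^sup>2)" for n
        using integral_coordinate(2)[of "\<lambda>x. (\<psi> x)\<^sup>2"] sq by simp
      show "distr Np borel (\<lambda>x. \<psi> (x n)) = distr N borel \<psi>" for n
        using distr_distr[of \<psi> N borel "\<lambda>x. x n" Np] distr_PiM_component[of "UNIV :: nat set" "\<lambda>_. N" n] prob
        by (simp add: comp_def)
    qed (use \<sigma> in auto)
    have rd: "real_distribution (distr Np borel (?S n))" for n
      by (intro P.real_distribution_distr) measurable
    interpret std: real_distribution std_normal_distribution by (rule real_dist_normal_dist)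
    have "(\<lambda>n. LINT z|distr Np borel (?S n). cos (\<sigma> * z + c)) \<longlonglongrightarrow> (LINT z|std_normal_distribution. cos (\<sigma> * z + c))"
      by (rule weak_conv_imp_integral_bdd_continuous_conv[OF rd std.real_distribution_axioms weak, where B = 1]) auto
    moreover have "(LINT z|distr Np borel (?S n). cos (\<sigma> * z + c)) = (LINT x|Np. cos ((\<Sum>i<n. \<psi> (x i)) / sqrt n + c))" for n
      using \<sigma> by (subst integral_distr) (auto simp: real_sqrt_mult)
    moreover have "(LINT z|std_normal_distribution. cos (\<sigma> * z + c)) = cos c * exp (- v / 2)"
    proof -
      have "(LINT z|std_normal_distribution. cos (\<sigma> * z + c)) = Re (iexp c * char std_normal_distribution \<sigma>)"
        unfolding char_def by (rule std.integral_cos_eq_Re) simp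
      also have "\<dots> = cos c * exp (- v / 2)"
        unfolding char_std_normal_distribution by (simp add: \<sigma>(2) Re_exp)
      finally show ?thesis .
    qed
    ultimately show ?thesis by (simp add: eq v_def)
  qed
qed

text \<open>Distinct coordinates are independent and centered, so only the diagonal of the expanded
  square survives.\<close>

lemma second_moment_sum:
  assumes \<psi>: "\<psi> \<in> L2_zero_mean N"
  shows "(LINT x|sample N n. (\<Sum>i<n. \<psi> (x i))\<^sup>2) = n * (LINT x|N. (\<psi> x)\<^sup>2)"
    and "integrable (sample N n) (\<lambda>x. (\<Sum>i<n. \<psi> (x i))\<^sup>2)"
proof -
  have [measurable]: "\<psi> \<in> borel_measurable N" and sq: "integrable N (\<lambda>x. (\<psi> x)\<^sup>2)"
    and mean: "(LINT x|N. \<psi> x) = 0"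
    using \<psi> by (auto simp: L2_zero_mean_def)
  have int: "integrable N \<psi>" by (rule N.square_integrable_imp_integrable) (use sq in auto)
  have ii: "integrable Np (\<lambda>x. \<psi> (x i))" for i
    using int by (simp add: integral_coordinate)
  have ij: "(LINT x|Np. \<psi> (x i) * \<psi> (x j)) = (if i = j then LINT x|N. (\<psi> x)\<^sup>2 else 0)"
    and ij_int: "integrable Np (\<lambda>x. \<psi> (x i) * \<psi> (x j))" for i j
  proof -
    have "(LINT x|Np. \<psi> (x i) * \<psi> (x j)) = (if i = j then LINT x|N. (\<psi> x)\<^sup>2 else 0) \<and>
      integrable Np (\<lambda>x. \<psi> (x i) * \<psi> (x j))"
    proof (cases "i = j")
      case True
      then show ?thesis
        using integral_coordinate[of "\<lambda>x. (\<psi> x)\<^sup>2"] sq by (simp add: power2_eq_square)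
    next
      case False
      have "P.indep_vars (\<lambda>_. borel) (\<lambda>i x. \<psi> (x i)) {i, j}"
        by (rule P.indep_vars_subset[OF indep_coordinates_compose]) auto
      from P.indep_vars_lebesgue_integral[OF _ this ii] P.indep_vars_integrable[OF _ this ii]
      show ?thesis using False by (simp add: integral_coordinate mean)
    qed
    then show "(LINT x|Np. \<psi> (x i) * \<psi> (x j)) = (if i = j then LINT x|N. (\<psi> x)\<^sup>2 else 0)"
      "integrable Np (\<lambda>x. \<psi> (x i) * \<psi> (x j))" by simp_all
  qed
  have sq_sum: "(\<Sum>i<n. \<psi> (x i))\<^sup>2 = (\<Sum>i<n. \<Sum>j<n. \<psi> (x i) * \<psi> (x j))" for x
    by (simp add: power2_eq_square sum_product)
  have m: "(\<lambda>x. (\<Sum>i<n. \<psi> (x i))\<^sup>2) \<in> borel_measurable (sample N n)"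
    unfolding sample_def by measurable
  have Np: "integrable Np (\<lambda>x. (\<Sum>i<n. \<psi> (x i))\<^sup>2)"
    unfolding sq_sum by (intro Bochner_Integration.integrable_sum ij_int)
  then have "integrable Np (\<lambda>x. (\<Sum>i<n. \<psi> (restrict x {..<n} i))\<^sup>2)" by simp
  then show "integrable (sample N n) (\<lambda>x. (\<Sum>i<n. \<psi> (x i))\<^sup>2)"
    by (subst sample_eq_distr, subst integrable_distr_eq[OF _ m])
       (simp_all add: sample_def measurable_restrict_subset)
  have "(LINT x|sample N n. (\<Sum>i<n. \<psi> (x i))\<^sup>2) = (LINT x|Np. (\<Sum>i<n. \<psi> (x i))\<^sup>2)"
    unfolding integral_sample[OF m] by simp
  also have "\<dots> = (\<Sum>i<n. \<Sum>j<n. if i = j then LINT x|N. (\<psi> x)\<^sup>2 else 0)"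
    unfolding sq_sum using ij_int by (simp add: Bochner_Integration.integral_sum ij)
  also have "\<dots> = n * (LINT x|N. (\<psi> x)\<^sup>2)" by simp
  finally show "(LINT x|sample N n. (\<Sum>i<n. \<psi> (x i))\<^sup>2) = n * (LINT x|N. (\<psi> x)\<^sup>2)" .
qed

text \<open>Markov's inequality for the squared norm, whose mean is the same number \<open>V\<close>
  for every \<open>n > 0\<close>.\<close>

lemma bounded_in_prob_normalized_sum:
  fixes \<psi> :: "'x \<Rightarrow> real^'k"
  assumes \<psi>: "\<And>j. (\<lambda>x. \<psi> x $ j) \<in> L2_zero_mean N"
  shows "bounded_in_prob (sample N) (\<lambda>n x. (1 / sqrt n) *\<^sub>R (\<Sum>i<n. \<psi> (x i)))"
  unfolding bounded_in_prob_def
proof (intro conjI allI impI)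
  have "(\<lambda>x. \<psi> x $ j) \<in> borel_measurable N" for j
    using \<psi>[of j] by (simp add: L2_zero_mean_def)
  then have [measurable]: "\<psi> \<in> borel_measurable N"
    by (subst borel_measurable_euclidean_space) (auto simp: Basis_vec_def inner_axis)
  show m: "(\<lambda>x. (1 / sqrt n) *\<^sub>R (\<Sum>i<n. \<psi> (x i))) \<in> borel_measurable (sample N n)" for n
    unfolding sample_def by measurable
  define V where "V = (\<Sum>j\<in>UNIV. LINT x|N. (\<psi> x $ j)\<^sup>2)"
  have V: "0 \<le> V" unfolding V_def by (intro sum_nonneg) simp
  fix e :: real assume e: "0 < e"
  \<comment> \<open>Makes the Markov bound equal to \<open>e * V / (V + 1)\<close>, strictly below
    \<open>e\<close>, and keeps \<open>L\<close> positive when \<open>V = 0\<close>.\<close>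
  define L where "L = sqrt ((V + 1) / e)"
  have L: "0 < L" "L\<^sup>2 = (V + 1) / e" using V e by (simp_all add: L_def)
  have "measure (sample N n) {x \<in> space (sample N n). L < norm ((1 / sqrt n) *\<^sub>R (\<Sum>i<n. \<psi> (x i)))} < e"
    if n: "0 < n" for n
  proof -
    interpret S: prob_space "sample N n" by (rule prob_space_sample)
    let ?Z = "\<lambda>x. (1 / sqrt n) *\<^sub>R (\<Sum>i<n. \<psi> (x i))"
    have Z2: "(norm (?Z x))\<^sup>2 = (\<Sum>j\<in>UNIV. (1 / n) * (\<Sum>i<n. \<psi> (x i) $ j)\<^sup>2)" for x
      unfolding power2_norm_eq_inner inner_vec_def
      using n by (simp add: power2_eq_square[symmetric] power_divide)
    have int: "integrable (sample N n) (\<lambda>x. (norm (?Z x))\<^sup>2)"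
      unfolding Z2 using second_moment_sum(2)[OF \<psi>]
      by (intro Bochner_Integration.integrable_sum integrable_mult_right) auto
    have EZ: "(LINT x|sample N n. (norm (?Z x))\<^sup>2) = V"
      unfolding Z2 V_def using second_moment_sum[OF \<psi>] n
      by (subst Bochner_Integration.integral_sum) auto
    have "S.prob {x \<in> space (sample N n). L < norm (?Z x)} \<le> S.prob {x \<in> space (sample N n). L\<^sup>2 \<le> (norm (?Z x))\<^sup>2}"
    proof (rule S.finite_measure_mono)
      note [measurable] = m[of n]
      show "{x \<in> space (sample N n). L\<^sup>2 \<le> (norm (?Z x))\<^sup>2} \<in> S.events" by measurable
      show "{x \<in> space (sample N n). L < norm (?Z x)} \<subseteq> {x \<in> space (sample N n). L\<^sup>2 \<le> (norm (?Z x))\<^sup>2}"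
        using L(1) by (auto intro!: power_mono simp del: norm_scaleR)
    qed
    also have "\<dots> \<le> (LINT x|sample N n. (norm (?Z x))\<^sup>2) / L\<^sup>2"
      using L(1) by (intro integral_Markov_inequality_measure[OF int, of "{}"]) auto
    also have "\<dots> < e"
      using V e unfolding EZ L(2) by (simp add: field_simps)
    finally show ?thesis .
  qed
  then show "\<exists>L. \<forall>\<^sub>F n in sequentially.
      measure (sample N n) {x \<in> space (sample N n). L < norm ((1 / sqrt n) *\<^sub>R (\<Sum>i<n. \<psi> (x i)))} < e"
    by (intro exI[of _ L]) (auto simp: eventually_sequentially intro!: exI[of _ 1])
qed

end

text \<open>Factorization of semidefinite matrices ensures that the choice in
  \<open>multivariate_normal\<close> yields a genuine factor \<open>A\<close>. The integral depends
  on it only through the squared norm of \<open>transpose A *v t\<close>, which is the quadratic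
  form of \<open>\<Sigma>\<close> at \<open>t\<close>; independence of the coordinates splits the
  characteristic function into one-dimensional ones.\<close>

lemma
  fixes \<Sigma> :: "real^'k^'k"
  assumes "transpose \<Sigma> = \<Sigma>" "\<And>x. 0 \<le> x \<bullet> (\<Sigma> *v x)"
  shows prob_space_multivariate_normal: "prob_space (multivariate_normal m \<Sigma>)"
    and sets_multivariate_normal: "sets (multivariate_normal m \<Sigma>) = sets borel"
    and multivariate_normal_cos:
      "(LINT y|multivariate_normal 0 \<Sigma>. cos (t \<bullet> y + c)) = cos c * exp (- (t \<bullet> (\<Sigma> *v t)) / 2)"
proof -
  define A :: "real^'k^'k" where "A = (SOME A. A ** transpose A = \<Sigma>)"
  have A: "A ** transpose A = \<Sigma>"
    unfolding A_def by (rule someI_ex) (use psd_factorization[OF assms] in blast)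
  interpret std: real_distribution std_normal_distribution by (rule real_dist_normal_dist)
  interpret product_prob_space "\<lambda>_::'k. std_normal_distribution" UNIV by standard
  let ?Z = "\<Pi>\<^sub>M i\<in>(UNIV :: 'k set). std_normal_distribution"
  have [measurable]: "(\<lambda>z. (\<chi> i. z i) :: real^'k) \<in> borel_measurable ?Z"
    by (subst borel_measurable_euclidean_space) (auto simp: Basis_vec_def inner_axis)
  have [measurable]: "(\<lambda>v. A *v v) \<in> borel_measurable borel"
    by (intro borel_measurable_continuous_onI matrix_vector_mult_linear_continuous_on)
  have mvn: "multivariate_normal m \<Sigma> = distr ?Z borel (\<lambda>z. m + A *v (\<chi> i. z i))" for m
    by (simp add: multivariate_normal_def A_def)
  show "prob_space (multivariate_normal m \<Sigma>)"
    unfolding mvn by (intro P.prob_space_distr) measurable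
  show "sets (multivariate_normal m \<Sigma>) = sets borel"
    unfolding mvn by simp
  define w where "w = transpose A *v t"
  have tA: "t \<bullet> (A *v (\<chi> i. z i)) = (\<Sum>i\<in>UNIV. w $ i * z i)" for z
  proof -
    have "t \<bullet> (A *v (\<chi> i. z i)) = w \<bullet> (\<chi> i. z i)"
      unfolding w_def by (simp add: dot_lmul_matrix)
    then show ?thesis by (simp add: inner_vec_def)
  qed
  have ww: "(\<Sum>i\<in>UNIV. (w $ i)\<^sup>2) = t \<bullet> (\<Sigma> *v t)"
  proof -
    have "(\<Sum>i\<in>UNIV. (w $ i)\<^sup>2) = w \<bullet> w" by (simp add: inner_vec_def power2_eq_square)
    also have "\<dots> = t \<bullet> (A *v w)" unfolding w_def by (simp add: dot_lmul_matrix)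
    also have "\<dots> = t \<bullet> (\<Sigma> *v t)" unfolding w_def by (simp only: matrix_vector_mul_assoc A)
    finally show ?thesis .
  qed
  have "(LINT y|multivariate_normal 0 \<Sigma>. cos (t \<bullet> y + c)) = (LINT z|?Z. cos ((\<Sum>i\<in>UNIV. w $ i * z i) + c))"
    unfolding mvn by (subst integral_distr) (auto simp: tA)
  also have "\<dots> = Re (iexp c * (CLINT z|?Z. iexp (\<Sum>i\<in>UNIV. w $ i * z i)))"
    by (rule P.integral_cos_eq_Re) measurable
  also have "(CLINT z|?Z. iexp (\<Sum>i\<in>UNIV. w $ i * z i)) = (CLINT z|?Z. (\<Prod>i\<in>UNIV. iexp (w $ i * z i)))"
    by (simp add: sum_distrib_left exp_sum)
  also have "\<dots> = (\<Prod>i\<in>UNIV. CLINT z|std_normal_distribution. iexp (w $ i * z))"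
    by (rule product_integral_prod) (auto intro!: std.integrable_const_bound[of _ 1])
  also have "\<dots> = (\<Prod>i\<in>UNIV. complex_of_real (exp (- ((w $ i)\<^sup>2) / 2)))"
    using char_std_normal_distribution unfolding char_def by (simp add: fun_eq_iff)
  also have "\<dots> = complex_of_real (exp (- (t \<bullet> (\<Sigma> *v t)) / 2))"
    unfolding of_real_prod[symmetric] ww[symmetric] by (simp add: exp_sum[symmetric] sum_negf sum_divide_distrib)
  finally show "(LINT y|multivariate_normal 0 \<Sigma>. cos (t \<bullet> y + c)) = cos c * exp (- (t \<bullet> (\<Sigma> *v t)) / 2)"
    by (simp add: Re_exp)
qed


section \<open>Stochastic order calculus\<close>

lemma tendsto_in_prob_zero_iff:
  "tendsto_in_prob N Y 0 \<longleftrightarrow> (\<forall>n. Y n \<in> borel_measurable (N n)) \<and>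
     (\<forall>e>0. (\<lambda>n. measure (N n) {\<omega> \<in> space (N n). e < norm (Y n \<omega>)}) \<longlonglongrightarrow> 0)"
  by (simp add: tendsto_in_prob_def)

lemma tendsto_in_prob_measurable: "tendsto_in_prob N Y c \<Longrightarrow> Y n \<in> borel_measurable (N n)"
  by (simp add: tendsto_in_prob_def)

lemma bounded_in_prob_measurable: "bounded_in_prob N Y \<Longrightarrow> Y n \<in> borel_measurable (N n)"
  by (simp add: bounded_in_prob_def)

lemma tendsto_in_probD:
  assumes "tendsto_in_prob N Y c" "0 < d" "0 < e"
  shows "\<forall>\<^sub>F n in sequentially. measure (N n) {\<omega> \<in> space (N n). d < dist (Y n \<omega>) c} < e"
proof (rule order_tendstoD(2)[OF _ assms(3)])
  show "(\<lambda>n. measure (N n) {\<omega> \<in> space (N n). d < dist (Y n \<omega>) c}) \<longlonglongrightarrow> 0"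
    using assms(1,2) by (simp add: tendsto_in_prob_def)
qed

lemma bounded_in_probD:
  assumes "bounded_in_prob N Y" "0 < e"
  obtains L where "\<forall>\<^sub>F n in sequentially. measure (N n) {\<omega> \<in> space (N n). L < norm (Y n \<omega>)} < e"
  using assms unfolding bounded_in_prob_def by blast

lemma tendsto_in_prob_zeroI:
  assumes "\<And>n. Y n \<in> borel_measurable (N n)"
    and "\<And>d e. 0 < d \<Longrightarrow> 0 < e \<Longrightarrow>
      \<forall>\<^sub>F n in sequentially. measure (N n) {\<omega> \<in> space (N n). d < norm (Y n \<omega>)} < e"
  shows "tendsto_in_prob N Y 0"
  unfolding tendsto_in_prob_zero_iff
proof (intro conjI allI impI)
  fix d :: real assume "0 < d"
  then show "(\<lambda>n. measure (N n) {\<omega> \<in> space (N n). d < norm (Y n \<omega>)}) \<longlonglongrightarrow> 0"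
    using assms(2)[of d] by (intro order_tendstoI) (auto intro!: always_eventually intro: less_le_trans[OF _ measure_nonneg])
qed (rule assms(1))

lemma (in finite_measure) measure_cover_lt:
  assumes "measure M {\<omega> \<in> space M. A \<omega>} < a" "measure M {\<omega> \<in> space M. B \<omega>} < b"
    and "{\<omega> \<in> space M. A \<omega>} \<in> sets M" "{\<omega> \<in> space M. B \<omega>} \<in> sets M"
    and "\<And>\<omega>. \<omega> \<in> space M \<Longrightarrow> C \<omega> \<Longrightarrow> A \<omega> \<or> B \<omega>"
  shows "measure M {\<omega> \<in> space M. C \<omega>} < a + b"
proof -
  have "measure M {\<omega> \<in> space M. C \<omega>} \<le> measure M ({\<omega> \<in> space M. A \<omega>} \<union> {\<omega> \<in> space M. B \<omega>})"
    by (rule finite_measure_mono) (use assms in auto)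
  also have "\<dots> \<le> measure M {\<omega> \<in> space M. A \<omega>} + measure M {\<omega> \<in> space M. B \<omega>}"
    by (rule measure_Un_le) (use assms in auto)
  finally show ?thesis using assms(1,2) by linarith
qed

text \<open>Reduces a stochastic limit to a deterministic estimate, uniform over sample points where
  \<open>U\<close> is bounded and \<open>J\<close> is close to its limit.\<close>

lemma tendsto_in_prob_transfer:
  assumes fin: "\<And>n. finite_measure (N n)" and Y: "\<And>n. Y n \<in> borel_measurable (N n)"
    and U: "bounded_in_prob N U" and J: "tendsto_in_prob N J c"
    and det: "\<And>L e. 0 < e \<Longrightarrow> \<exists>d>0. \<forall>\<^sub>F n in sequentially. \<forall>\<omega>\<in>space (N n).
      norm (U n \<omega>) \<le> L \<longrightarrow> dist (J n \<omega>) c \<le> d \<longrightarrow> norm (Y n \<omega>) \<le> e"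
  shows "tendsto_in_prob N Y 0"
proof (rule tendsto_in_prob_zeroI[OF Y])
  fix r e :: real assume r: "0 < r" and e: "0 < e"
  obtain L where L: "\<forall>\<^sub>F n in sequentially. measure (N n) {\<omega> \<in> space (N n). L < norm (U n \<omega>)} < e / 2"
    by (rule bounded_in_probD[OF U half_gt_zero[OF e]])
  obtain d where d: "0 < d" and D: "\<forall>\<^sub>F n in sequentially. \<forall>\<omega>\<in>space (N n).
      norm (U n \<omega>) \<le> L \<longrightarrow> dist (J n \<omega>) c \<le> d \<longrightarrow> norm (Y n \<omega>) \<le> r"
    using det[OF r, of L] by blast
  have "\<forall>\<^sub>F n in sequentially. measure (N n) {\<omega> \<in> space (N n). d < dist (J n \<omega>) c} < e / 2"
    using e by (intro tendsto_in_probD[OF J d]) simp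
  with L D show "\<forall>\<^sub>F n in sequentially. measure (N n) {\<omega> \<in> space (N n). r < norm (Y n \<omega>)} < e"
  proof eventually_elim
    case (elim n)
    interpret finite_measure "N n" by (rule fin)
    note [measurable] = bounded_in_prob_measurable[OF U] tendsto_in_prob_measurable[OF J]
    have "measure (N n) {\<omega> \<in> space (N n). r < norm (Y n \<omega>)} < e / 2 + e / 2"
    proof (rule measure_cover_lt[OF elim(1,3)])
      show "L < norm (U n \<omega>) \<or> d < dist (J n \<omega>) c" if "\<omega> \<in> space (N n)" "r < norm (Y n \<omega>)" for \<omega>
        using elim(2) that by (cases "norm (U n \<omega>) \<le> L"; cases "dist (J n \<omega>) c \<le> d") auto
    qed measurable
    then show ?case by simp
  qed
qed

lemma tendsto_in_prob_add:
  assumes fin: "\<And>n. finite_measure (N n)" and A: "tendsto_in_prob N A 0" and B: "tendsto_in_prob N B 0"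
  shows "tendsto_in_prob N (\<lambda>n \<omega>. A n \<omega> + B n \<omega>) 0"
proof (rule tendsto_in_prob_zeroI)
  note [measurable] = tendsto_in_prob_measurable[OF A] tendsto_in_prob_measurable[OF B]
  show "(\<lambda>\<omega>. A n \<omega> + B n \<omega>) \<in> borel_measurable (N n)" for n by measurable
  fix r e :: real assume r: "0 < r" and e: "0 < e"
  from tendsto_in_probD[OF A half_gt_zero[OF r] half_gt_zero[OF e]]
    tendsto_in_probD[OF B half_gt_zero[OF r] half_gt_zero[OF e]]
  show "\<forall>\<^sub>F n in sequentially. measure (N n) {\<omega> \<in> space (N n). r < norm (A n \<omega> + B n \<omega>)} < e"
  proof eventually_elim
    case (elim n)
    interpret finite_measure "N n" by (rule fin)
    have "measure (N n) {\<omega> \<in> space (N n). r < norm (A n \<omega> + B n \<omega>)} < e / 2 + e / 2"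
    proof (rule measure_cover_lt[OF elim])
      show "r / 2 < dist (A n \<omega>) 0 \<or> r / 2 < dist (B n \<omega>) 0" if "r < norm (A n \<omega> + B n \<omega>)" for \<omega>
        using that norm_triangle_ineq[of "A n \<omega>" "B n \<omega>"] unfolding dist_0_norm dist_norm by auto
    qed measurable
    then show ?case by simp
  qed
qed

lemma bounded_in_prob_add:
  assumes fin: "\<And>n. finite_measure (N n)" and A: "bounded_in_prob N A" and B: "bounded_in_prob N B"
  shows "bounded_in_prob N (\<lambda>n \<omega>. A n \<omega> + B n \<omega>)"
  unfolding bounded_in_prob_def
proof (intro conjI allI impI)
  note [measurable] = bounded_in_prob_measurable[OF A] bounded_in_prob_measurable[OF B]
  show "(\<lambda>\<omega>. A n \<omega> + B n \<omega>) \<in> borel_measurable (N n)" for n by measurable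
  fix e :: real assume e: "0 < e"
  obtain K where K: "\<forall>\<^sub>F n in sequentially. measure (N n) {\<omega> \<in> space (N n). K < norm (A n \<omega>)} < e / 2"
    by (rule bounded_in_probD[OF A half_gt_zero[OF e]])
  obtain L where L: "\<forall>\<^sub>F n in sequentially. measure (N n) {\<omega> \<in> space (N n). L < norm (B n \<omega>)} < e / 2"
    by (rule bounded_in_probD[OF B half_gt_zero[OF e]])
  from K L have "\<forall>\<^sub>F n in sequentially. measure (N n) {\<omega> \<in> space (N n). K + L < norm (A n \<omega> + B n \<omega>)} < e"
  proof eventually_elim
    case (elim n)
    interpret finite_measure "N n" by (rule fin)
    have "measure (N n) {\<omega> \<in> space (N n). K + L < norm (A n \<omega> + B n \<omega>)} < e / 2 + e / 2"
    proof (rule measure_cover_lt[OF elim])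
      show "K < norm (A n \<omega>) \<or> L < norm (B n \<omega>)" if "K + L < norm (A n \<omega> + B n \<omega>)" for \<omega>
        using that norm_triangle_ineq[of "A n \<omega>" "B n \<omega>"] by auto
    qed measurable
    then show ?case by simp
  qed
  then show "\<exists>L. \<forall>\<^sub>F n in sequentially. measure (N n) {\<omega> \<in> space (N n). L < norm (A n \<omega> + B n \<omega>)} < e"
    by blast
qed

lemma tendsto_in_prob_imp_bounded:
  assumes "tendsto_in_prob N Y 0"
  shows "bounded_in_prob N Y"
  unfolding bounded_in_prob_def
  using tendsto_in_prob_measurable[OF assms] tendsto_in_probD[OF assms zero_less_one] by auto

lemma measurable_matrix_vector_mult [measurable]:
  fixes A :: "real^'n^'m"
  assumes "f \<in> borel_measurable M"
  shows "(\<lambda>x. A *v f x) \<in> borel_measurable M"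
  using borel_measurable_continuous_onI[OF matrix_vector_mult_linear_continuous_on[of UNIV A]] assms
  by (rule measurable_compose[rotated])

lemma tendsto_in_prob_matrix_mult:
  fixes A :: "real^'n^'m"
  assumes fin: "\<And>n. finite_measure (N n)" and Y: "tendsto_in_prob N Y 0"
  shows "tendsto_in_prob N (\<lambda>n \<omega>. A *v Y n \<omega>) 0"
proof (rule tendsto_in_prob_transfer[OF fin _ tendsto_in_prob_imp_bounded[OF Y] Y])
  note [measurable] = tendsto_in_prob_measurable[OF Y]
  show "(\<lambda>\<omega>. A *v Y n \<omega>) \<in> borel_measurable (N n)" for n by measurable
  fix L e :: real assume e: "0 < e"
  \<comment> \<open>The \<open>+ 1\<close> keeps the radius meaningful when
    \<open>A = 0\<close>.\<close>
  have "norm (A *v y) \<le> e" if "dist y 0 \<le> e / (norm A + 1)" for y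
  proof -
    have "norm (A *v y) \<le> (norm A + 1) * norm y"
      using norm_matrix_vector_mult_le[of A y] mult_right_mono[of "norm A" "norm A + 1" "norm y"] by simp
    also have "\<dots> \<le> e"
      using that add_nonneg_pos[OF norm_ge_zero[of A] zero_less_one] by (simp add: pos_le_divide_eq mult.commute)
    finally show ?thesis .
  qed
  then show "\<exists>d>0. \<forall>\<^sub>F n in sequentially. \<forall>\<omega>\<in>space (N n).
      norm (Y n \<omega>) \<le> L \<longrightarrow> dist (Y n \<omega>) 0 \<le> d \<longrightarrow> norm (A *v Y n \<omega>) \<le> e"
    using e by (intro exI[of _ "e / (norm A + 1)"]) (simp add: add_nonneg_pos)
qed

lemma bounded_in_prob_matrix_mult:
  fixes A :: "real^'n^'m"
  assumes fin: "\<And>n. finite_measure (N n)" and Y: "bounded_in_prob N Y"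
  shows "bounded_in_prob N (\<lambda>n \<omega>. A *v Y n \<omega>)"
  unfolding bounded_in_prob_def
proof (intro conjI allI impI)
  note [measurable] = bounded_in_prob_measurable[OF Y]
  show "(\<lambda>\<omega>. A *v Y n \<omega>) \<in> borel_measurable (N n)" for n by measurable
  fix e :: real assume e: "0 < e"
  obtain L where L: "\<forall>\<^sub>F n in sequentially. measure (N n) {\<omega> \<in> space (N n). L < norm (Y n \<omega>)} < e"
    by (rule bounded_in_probD[OF Y e])
  then have "\<forall>\<^sub>F n in sequentially. measure (N n) {\<omega> \<in> space (N n). norm A * L < norm (A *v Y n \<omega>)} < e"
  proof eventually_elim
    case (elim n)
    interpret finite_measure "N n" by (rule fin)
    have "measure (N n) {\<omega> \<in> space (N n). norm A * L < norm (A *v Y n \<omega>)}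
        \<le> measure (N n) {\<omega> \<in> space (N n). L < norm (Y n \<omega>)}"
    proof (rule finite_measure_mono)
      have "L < norm y" if "norm A * L < norm (A *v y)" for y
      proof (rule ccontr)
        assume "\<not> L < norm y"
        then have "norm A * norm y \<le> norm A * L" by (intro mult_left_mono) auto
        with that norm_matrix_vector_mult_le[of A y] show False by linarith
      qed
      then show "{\<omega> \<in> space (N n). norm A * L < norm (A *v Y n \<omega>)} \<subseteq> {\<omega> \<in> space (N n). L < norm (Y n \<omega>)}"
        by auto
    qed measurable
    with elim show ?case by simp
  qed
  then show "\<exists>L. \<forall>\<^sub>F n in sequentially. measure (N n) {\<omega> \<in> space (N n). L < norm (A *v Y n \<omega>)} < e"
    by blast
qed


section \<open>The constrained estimator\<close>

text \<open>Quantities that stay bounded after scaling by the square root of \<open>n\<close>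
  eventually enter any fixed neighbourhood; this makes local expansions applicable.\<close>

lemma eventually_less_sqrt_mult:
  fixes d L :: real
  assumes "0 < d"
  shows "\<forall>\<^sub>F n in sequentially. L < sqrt (real n) * d"
proof -
  have "filterlim (\<lambda>n. sqrt (real n)) at_top sequentially"
    by (rule filterlim_compose[OF sqrt_at_top filterlim_real_sequentially])
  then have "\<forall>\<^sub>F n in sequentially. L / d < sqrt (real n)"
    by (simp add: filterlim_at_top_dense)
  then show ?thesis using assms by (simp add: field_simps)
qed

lemma tendsto_constraint_gain:
  fixes D\<^sub>n :: "'a \<Rightarrow> real^'k^'d" and J\<^sub>n :: "'a \<Rightarrow> real^'k^'k"
  assumes D: "(D\<^sub>n \<longlongrightarrow> D) F" and J: "(J\<^sub>n \<longlongrightarrow> J) F" and inv: "gain_inverses_exist D J"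
  shows "\<forall>\<^sub>F x in F. gain_inverses_exist (D\<^sub>n x) (J\<^sub>n x)"
    and "((\<lambda>x. constraint_gain (D\<^sub>n x) (J\<^sub>n x)) \<longlongrightarrow> constraint_gain D J) F"
proof -
  have J': "((\<lambda>x. matrix_inv (J\<^sub>n x)) \<longlongrightarrow> matrix_inv J) F"
    using inv by (intro tendsto_matrix_inv J) (simp add: gain_inverses_exist_def)
  have gram: "((\<lambda>x. D\<^sub>n x ** matrix_inv (J\<^sub>n x) ** transpose (D\<^sub>n x)) \<longlongrightarrow> D ** matrix_inv J ** transpose D) F"
    by (intro tendsto_matrix_mult tendsto_transpose D J')
  show "\<forall>\<^sub>F x in F. gain_inverses_exist (D\<^sub>n x) (J\<^sub>n x)"
    using eventually_invertible[OF J] eventually_invertible[OF gram] inv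
    unfolding gain_inverses_exist_def by (intro eventually_conj) auto
  show "((\<lambda>x. constraint_gain (D\<^sub>n x) (J\<^sub>n x)) \<longlongrightarrow> constraint_gain D J) F"
    unfolding constraint_gain_def
    using inv by (intro tendsto_matrix_mult tendsto_transpose D J' tendsto_matrix_inv gram)
      (simp add: gain_inverses_exist_def)
qed

text \<open>The value \<open>s\<close> is prescribed only where the inverses exist, and near
  \<open>(\<theta>, J\<^sub>0)\<close> they do. With \<open>w = \<zeta> - \<theta>\<close>, gain
  \<open>K + E\<close> and \<open>S \<zeta> = DS \<theta> *v w + \<rho>\<close>, the error consists
  of the terms \<open>E D w\<close>, \<open>K \<rho>\<close> and \<open>E \<rho>\<close>, each of
  smaller order than \<open>w\<close>.\<close>

lemma one_step_expansion:
  fixes S :: "real^'k \<Rightarrow> real^'d" and DS :: "real^'k \<Rightarrow> real^'k^'d" and \<theta> :: "real^'k"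
  assumes S_deriv: "(S has_derivative (\<lambda>v. DS \<theta> *v v)) (at \<theta>)" and S0: "S \<theta> = 0"
    and DS_cont: "continuous_on UNIV DS" and inv: "gain_inverses_exist (DS \<theta>) J\<^sub>0" and e: "0 < e"
  defines "K \<equiv> constraint_gain (DS \<theta>) J\<^sub>0"
  obtains d where "0 < d"
    "\<forall>\<^sub>F n in sequentially. \<forall>\<zeta> J s. norm (sqrt n *\<^sub>R (\<zeta> - \<theta>)) \<le> L \<longrightarrow> dist J J\<^sub>0 \<le> d \<longrightarrow>
       (gain_inverses_exist (DS \<zeta>) J \<longrightarrow> s = \<zeta> - constraint_gain (DS \<zeta>) J *v S \<zeta>) \<longrightarrow>
       norm (sqrt n *\<^sub>R (s - \<theta> - (mat 1 - K ** DS \<theta>) *v (\<zeta> - \<theta>))) \<le> e"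
proof -
  \<comment> \<open>Collects the three error terms: if \<open>norm E \<le> \<kappa> \<le> 1\<close>
    and \<open>norm \<rho> \<le> \<kappa> * norm w\<close>, they sum to at most
    \<open>\<kappa> * c * norm w\<close>.\<close>
  define c where "c = norm (DS \<theta>) + norm K + 1"
  \<comment> \<open>Keeps \<open>\<kappa> * c * L\<close> below \<open>e\<close>. The sign of
    \<open>L\<close> is arbitrary, whence the absolute value and the \<open>+ 1\<close>.\<close>
  define \<kappa> where "\<kappa> = min 1 (e / ((\<bar>L\<bar> + 1) * c))"
  have c: "0 < c" by (simp add: c_def add_nonneg_pos)
  then have p: "0 < (\<bar>L\<bar> + 1) * c" by (simp add: add_nonneg_pos)
  have "\<kappa> \<le> e / ((\<bar>L\<bar> + 1) * c)" by (simp add: \<kappa>_def)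
  then have "\<kappa> * ((\<bar>L\<bar> + 1) * c) \<le> e"
    unfolding pos_le_divide_eq[OF p] .
  then have \<kappa>: "0 < \<kappa>" "\<kappa> \<le> 1" "(\<bar>L\<bar> + 1) * (\<kappa> * c) \<le> e"
    using e p by (simp_all add: \<kappa>_def mult_ac)
  \<comment> \<open>The neighbourhood filter of the pair yields one radius that serves the parameter
    and the information matrix jointly.\<close>
  have fst: "(fst \<longlongrightarrow> \<theta>) (nhds (\<theta>, J\<^sub>0))" and snd: "(snd \<longlongrightarrow> J\<^sub>0) (nhds (\<theta>, J\<^sub>0))"
    using tendsto_fst[of "\<lambda>x. x" "(\<theta>, J\<^sub>0)"] tendsto_snd[of "\<lambda>x. x" "(\<theta>, J\<^sub>0)"]
    by (simp_all add: filterlim_ident)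
  have "isCont DS \<theta>" using DS_cont by (simp add: continuous_on_eq_continuous_at)
  then have DS: "((\<lambda>x. DS (fst x)) \<longlongrightarrow> DS \<theta>) (nhds (\<theta>, J\<^sub>0))"
    using fst by (rule isCont_tendsto_compose)
  have "\<forall>\<^sub>F \<zeta> in nhds \<theta>. norm (S \<zeta> - DS \<theta> *v (\<zeta> - \<theta>)) \<le> \<kappa> * norm (\<zeta> - \<theta>)"
    using S_deriv \<kappa>(1) unfolding has_derivative_at_alt eventually_nhds_metric
    by (auto simp: S0 dist_norm norm_minus_commute)
  then have "\<forall>\<^sub>F x in nhds (\<theta>, J\<^sub>0). norm (S (fst x) - DS \<theta> *v (fst x - \<theta>)) \<le> \<kappa> * norm (fst x - \<theta>)"
    using fst by (rule eventually_compose_filterlim)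
  moreover have "\<forall>\<^sub>F x in nhds (\<theta>, J\<^sub>0). gain_inverses_exist (DS (fst x)) (snd x)"
    by (rule tendsto_constraint_gain(1)[OF DS snd inv])
  moreover have "\<forall>\<^sub>F x in nhds (\<theta>, J\<^sub>0). dist (constraint_gain (DS (fst x)) (snd x)) K < \<kappa>"
    unfolding K_def by (rule tendstoD[OF tendsto_constraint_gain(2)[OF DS snd inv] \<kappa>(1)])
  ultimately have "\<forall>\<^sub>F x in nhds (\<theta>, J\<^sub>0). norm (S (fst x) - DS \<theta> *v (fst x - \<theta>)) \<le> \<kappa> * norm (fst x - \<theta>) \<and>
      gain_inverses_exist (DS (fst x)) (snd x) \<and> dist (constraint_gain (DS (fst x)) (snd x)) K < \<kappa>"
    by eventually_elim simp
  then obtain r where r: "0 < r" and near': "\<forall>x. dist x (\<theta>, J\<^sub>0) < r \<longrightarrow>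
      norm (S (fst x) - DS \<theta> *v (fst x - \<theta>)) \<le> \<kappa> * norm (fst x - \<theta>) \<and>
      gain_inverses_exist (DS (fst x)) (snd x) \<and> dist (constraint_gain (DS (fst x)) (snd x)) K < \<kappa>"
    unfolding eventually_nhds_metric by (elim exE conjE)
  have near: "norm (S \<zeta> - DS \<theta> *v (\<zeta> - \<theta>)) \<le> \<kappa> * norm (\<zeta> - \<theta>) \<and>
      gain_inverses_exist (DS \<zeta>) J \<and> dist (constraint_gain (DS \<zeta>) J) K < \<kappa>"
    if "dist (\<zeta>, J) (\<theta>, J\<^sub>0) < r" for \<zeta> J
    using near'[rule_format, OF that] by simp
  show thesis
  proof (rule that[of "r / 2"])
    show "0 < r / 2" using r by simp
    have "\<forall>\<^sub>F n in sequentially. L < sqrt (real n) * (r / 2)"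
      using r by (intro eventually_less_sqrt_mult) simp
    then show "\<forall>\<^sub>F n in sequentially. \<forall>\<zeta> J s. norm (sqrt n *\<^sub>R (\<zeta> - \<theta>)) \<le> L \<longrightarrow> dist J J\<^sub>0 \<le> r / 2 \<longrightarrow>
       (gain_inverses_exist (DS \<zeta>) J \<longrightarrow> s = \<zeta> - constraint_gain (DS \<zeta>) J *v S \<zeta>) \<longrightarrow>
       norm (sqrt n *\<^sub>R (s - \<theta> - (mat 1 - K ** DS \<theta>) *v (\<zeta> - \<theta>))) \<le> e"
    proof (eventually_elim, intro allI impI)
      fix n :: nat and \<zeta> J s
      assume n: "L < sqrt n * (r / 2)" and \<zeta>: "norm (sqrt n *\<^sub>R (\<zeta> - \<theta>)) \<le> L" and J: "dist J J\<^sub>0 \<le> r / 2"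
        and s: "gain_inverses_exist (DS \<zeta>) J \<longrightarrow> s = \<zeta> - constraint_gain (DS \<zeta>) J *v S \<zeta>"
      define w where "w = \<zeta> - \<theta>"
      have w: "sqrt n * norm w \<le> L" using \<zeta> by (simp add: w_def)
      have "sqrt n * norm w < sqrt n * (r / 2)" using n w by linarith
      then have "norm w < r / 2" by (rule mult_left_less_imp_less) simp
      then have "dist \<zeta> \<theta> + dist J J\<^sub>0 < r"
        using J by (simp add: w_def dist_norm)
      moreover have "dist (\<zeta>, J) (\<theta>, J\<^sub>0) \<le> dist \<zeta> \<theta> + dist J J\<^sub>0"
        unfolding dist_Pair_Pair by (rule sqrt_sum_squares_le_sum) auto
      ultimately have "dist (\<zeta>, J) (\<theta>, J\<^sub>0) < r" by linarith
      note * = near[OF this]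
      define E where "E = constraint_gain (DS \<zeta>) J - K"
      define \<rho> where "\<rho> = S \<zeta> - DS \<theta> *v w"
      have E: "norm E \<le> \<kappa>" using * by (simp add: E_def dist_norm)
      have \<rho>: "norm \<rho> \<le> \<kappa> * norm w" using * by (simp add: \<rho>_def w_def)
      have "s = \<zeta> - (K + E) *v (DS \<theta> *v w + \<rho>)"
        using s * by (simp add: E_def \<rho>_def)
      then have "s - \<theta> - (mat 1 - K ** DS \<theta>) *v w = - (E *v (DS \<theta> *v w)) - (K *v \<rho>) - (E *v \<rho>)"
        by (simp add: w_def matrix_vector_mult_diff_rdistrib matrix_vector_mult_add_rdistrib
            matrix_vector_right_distrib matrix_vector_mul_assoc[symmetric] algebra_simps)
      also have "norm \<dots> \<le> norm (E *v (DS \<theta> *v w)) + norm (K *v \<rho>) + norm (E *v \<rho>)"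
        using norm_triangle_ineq4[of "- (E *v (DS \<theta> *v w)) - (K *v \<rho>)" "E *v \<rho>"]
          norm_triangle_ineq4[of "- (E *v (DS \<theta> *v w))" "K *v \<rho>"] by simp
      also have "\<dots> \<le> \<kappa> * (norm (DS \<theta>) * norm w) + norm K * (\<kappa> * norm w) + 1 * (\<kappa> * norm w)"
        using E \<rho> \<kappa>
        by (intro add_mono order_trans[OF norm_matrix_vector_mult_le] mult_mono mult_nonneg_nonneg norm_ge_zero
            norm_matrix_vector_mult_le) auto
      also have "\<dots> = \<kappa> * c * norm w" by (simp add: c_def algebra_simps)
      finally have "norm (sqrt n *\<^sub>R (s - \<theta> - (mat 1 - K ** DS \<theta>) *v w)) \<le> \<kappa> * c * (sqrt n * norm w)"
        by (simp add: mult_left_mono mult.left_commute[of _ "sqrt n"])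
      also have "\<dots> \<le> \<kappa> * c * (\<bar>L\<bar> + 1)"
        using w \<kappa> c by (intro mult_left_mono) auto
      also have "\<dots> \<le> e" using \<kappa>(3) by (simp add: mult_ac)
      finally show "norm (sqrt n *\<^sub>R (s - \<theta> - (mat 1 - K ** DS \<theta>) *v (\<zeta> - \<theta>))) \<le> e"
        by (simp add: w_def)
    qed
  qed
qed

text \<open>The minimizer is at least as close to \<open>s\<close> as the point of the level set that the chart
  assigns to the projection of \<open>s - \<theta>\<close> to the tangent space of the level set.\<close>

lemma projection_error:
  fixes S :: "real^'k \<Rightarrow> real^'d" and DS :: "real^'k \<Rightarrow> real^'k^'d" and \<theta> :: "real^'k"
  assumes S_deriv: "\<And>\<theta>. (S has_derivative (\<lambda>v. DS \<theta> *v v)) (at \<theta>)" and S0: "S \<theta> = 0"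
    and DS_cont: "continuous_on UNIV DS" and full_rank: "rank (DS \<theta>) = CARD('d)"
    and nrm: "equivalent_norm nrm" and e: "0 < e"
  obtains d where "0 < d"
    "\<forall>\<^sub>F n in sequentially. \<forall>s t. norm (sqrt n *\<^sub>R (s - \<theta>)) \<le> L \<longrightarrow>
       norm (sqrt n *\<^sub>R (DS \<theta> *v (s - \<theta>))) \<le> d \<longrightarrow>
       is_arg_min (\<lambda>\<zeta>. nrm (\<zeta> - s)) (\<lambda>\<zeta>. S \<zeta> = 0) t \<longrightarrow> norm (sqrt n *\<^sub>R (t - s)) \<le> e"
proof -
  obtain R where R: "DS \<theta> ** R = mat 1"
    using full_rank full_rank_right_inverse by blast
  obtain g where g: "g 0 = \<theta>" "(g has_derivative (\<lambda>v. v)) (at 0)"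
    "\<forall>\<^sub>F y in nhds 0. DS \<theta> *v y = 0 \<longrightarrow> S (g y) = 0"
    by (rule level_set_chart[OF S_deriv DS_cont full_rank S0])
  obtain a b where ab: "0 < a" "0 < b" "\<And>x. a * norm x \<le> nrm x" "\<And>x. nrm x \<le> b * norm x"
    using nrm unfolding equivalent_norm_def by blast
  \<comment> \<open>After scaling, \<open>p\<close> bounds the norm of \<open>y\<close> and
    \<open>q * d\<close> that of \<open>z\<close>; \<open>\<kappa>\<close> and \<open>d\<close> are
    then chosen so that each contributes at most \<open>e * a / 2\<close> after multiplication by
    \<open>b\<close>. The constants \<open>a\<close> and \<open>b\<close> compare \<open>nrm\<close>
    with the Euclidean norm.\<close>
  define p where "p = \<bar>L\<bar> + norm R + 1"
  define q where "q = norm R + 1"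
  have p: "0 < p" and q: "0 < q" by (simp_all add: p_def q_def add_nonneg_pos)
  define \<kappa> where "\<kappa> = e * a / (2 * b * p)"
  define d where "d = min 1 (e * a / (2 * b * q))"
  have \<kappa>: "0 < \<kappa>" "b * (\<kappa> * p) = e * a / 2"
    using e ab p by (simp_all add: \<kappa>_def)
  have "d \<le> e * a / (2 * b * q)" by (simp add: d_def)
  then have "d * (2 * b * q) \<le> e * a"
    using ab q by (subst (asm) pos_le_divide_eq) simp_all
  then have d: "0 < d" "d \<le> 1" "b * (q * d) \<le> e * a / 2"
    using e ab q by (simp_all add: d_def mult_ac)
  have "\<forall>\<^sub>F y in nhds 0. norm (g y - \<theta> - y) \<le> \<kappa> * norm y"
    using g(2) \<kappa>(1) unfolding has_derivative_at_alt eventually_nhds_metric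
    by (auto simp: g(1) dist_norm)
  then have "\<forall>\<^sub>F y in nhds 0. norm (g y - \<theta> - y) \<le> \<kappa> * norm y \<and> (DS \<theta> *v y = 0 \<longrightarrow> S (g y) = 0)"
    using g(3) by (rule eventually_conj)
  then obtain r where r: "0 < r" and near: "\<And>y. norm y < r \<Longrightarrow>
      norm (g y - \<theta> - y) \<le> \<kappa> * norm y \<and> (DS \<theta> *v y = 0 \<longrightarrow> S (g y) = 0)"
    unfolding eventually_nhds_metric by (auto simp: dist_norm)
  show thesis
  proof (rule that[OF d(1)])
    have "\<forall>\<^sub>F n in sequentially. \<bar>L\<bar> + norm R + 1 < sqrt (real n) * r"
      using r by (intro eventually_less_sqrt_mult)
    then show "\<forall>\<^sub>F n in sequentially. \<forall>s t. norm (sqrt n *\<^sub>R (s - \<theta>)) \<le> L \<longrightarrow>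
       norm (sqrt n *\<^sub>R (DS \<theta> *v (s - \<theta>))) \<le> d \<longrightarrow>
       is_arg_min (\<lambda>\<zeta>. nrm (\<zeta> - s)) (\<lambda>\<zeta>. S \<zeta> = 0) t \<longrightarrow> norm (sqrt n *\<^sub>R (t - s)) \<le> e"
    proof (eventually_elim, intro allI impI)
      fix n :: nat and s t
      assume n: "\<bar>L\<bar> + norm R + 1 < sqrt n * r" and s: "norm (sqrt n *\<^sub>R (s - \<theta>)) \<le> L"
        and Ds: "norm (sqrt n *\<^sub>R (DS \<theta> *v (s - \<theta>))) \<le> d"
        and t: "is_arg_min (\<lambda>\<zeta>. nrm (\<zeta> - s)) (\<lambda>\<zeta>. S \<zeta> = 0) t"
      \<comment> \<open>The part of \<open>s - \<theta>\<close> that \<open>DS \<theta>\<close>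
        sees, small by hypothesis. What remains, \<open>y\<close>, lies in the kernel, so
        \<open>g y\<close> is an admissible competitor in the minimization.\<close>
      define z where "z = R *v (DS \<theta> *v (s - \<theta>))"
      define y where "y = s - \<theta> - z"
      have Dy: "DS \<theta> *v y = 0"
      proof -
        have "DS \<theta> *v z = DS \<theta> *v (s - \<theta>)"
          unfolding z_def by (subst matrix_vector_mul_assoc) (simp add: R)
        then show ?thesis by (simp add: y_def matrix_vector_mult_diff_distrib)
      qed
      have z: "sqrt n * norm z \<le> norm R * d"
      proof -
        have "sqrt n * norm z \<le> sqrt n * (norm R * norm (DS \<theta> *v (s - \<theta>)))"
          unfolding z_def by (intro mult_left_mono norm_matrix_vector_mult_le) simp
        also have "\<dots> = norm R * norm (sqrt n *\<^sub>R (DS \<theta> *v (s - \<theta>)))" by simp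
        also have "\<dots> \<le> norm R * d" by (intro mult_left_mono Ds) simp
        finally show ?thesis .
      qed
      have "sqrt n * norm y \<le> sqrt n * (norm (s - \<theta>) + norm z)"
        unfolding y_def by (intro mult_left_mono norm_triangle_ineq4) simp
      also have "\<dots> \<le> L + norm R * d"
        using s z by (simp add: distrib_left)
      also have "\<dots> \<le> \<bar>L\<bar> + norm R + 1"
        using d mult_left_mono[of d 1 "norm R"] by simp
      finally have ny: "sqrt n * norm y \<le> \<bar>L\<bar> + norm R + 1" .
      with n have "sqrt n * norm y < sqrt n * r" by linarith
      then have "norm y < r" by (rule mult_left_less_imp_less) simp
      from near[OF this] Dy have gy: "norm (g y - \<theta> - y) \<le> \<kappa> * norm y" "S (g y) = 0" by blast+
      have "norm (g y - s) = norm ((g y - \<theta> - y) - z)" by (simp add: y_def)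
      also have "\<dots> \<le> \<kappa> * norm y + norm z"
        using norm_triangle_ineq4[of "g y - \<theta> - y" z] gy(1) by linarith
      finally have gs: "norm (g y - s) \<le> \<kappa> * norm y + norm z" .
      have "a * norm (t - s) \<le> nrm (t - s)" by (rule ab)
      also have "\<dots> \<le> nrm (g y - s)"
        using t gy(2) by (auto simp: is_arg_min_linorder)
      also have "\<dots> \<le> b * norm (g y - s)" by (rule ab)
      also have "\<dots> \<le> b * (\<kappa> * norm y + norm z)"
        using gs ab by (intro mult_left_mono) auto
      finally have "sqrt n * (a * norm (t - s)) \<le> sqrt n * (b * (\<kappa> * norm y + norm z))"
        by (intro mult_left_mono) auto
      also have "\<dots> = b * (\<kappa> * (sqrt n * norm y) + sqrt n * norm z)" by (simp add: algebra_simps)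
      also have "\<dots> \<le> b * (\<kappa> * p + q * d)"
        using ny z ab \<kappa>(1) d(1) unfolding p_def q_def
        by (intro mult_left_mono add_mono) (auto simp: distrib_right)
      also have "\<dots> \<le> e * a"
        using \<kappa>(2) d(3) by (simp add: distrib_left)
      finally show "norm (sqrt n *\<^sub>R (t - s)) \<le> e"
        using ab(1) by (simp add: mult_ac)
    qed
  qed
qed

text \<open>A Slutsky argument for cosine test functions: being 1-Lipschitz handles small values of
  \<open>A\<close>, being bounded by 1 handles the event where \<open>A\<close> is large.\<close>

lemma integral_cos_perturbation:
  fixes A Z :: "nat \<Rightarrow> 's \<Rightarrow> 'b::euclidean_space"
  assumes N: "\<And>n. prob_space (N n)" and A: "tendsto_in_prob N A 0"
    and Z: "\<And>n. Z n \<in> borel_measurable (N n)"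
  shows "(\<lambda>n. (LINT \<omega>|N n. cos (t \<bullet> (A n \<omega> + Z n \<omega>) + c)) - (LINT \<omega>|N n. cos (t \<bullet> Z n \<omega> + c))) \<longlonglongrightarrow> 0"
proof (rule LIMSEQ_I)
  fix e :: real assume e: "0 < e"
  define q where "q = norm t + 1"
  have q: "0 < q" "norm t < q" by (simp_all add: q_def add_nonneg_pos)
  \<comment> \<open>The Lipschitz part stays below \<open>e / 2\<close>, and an exceptional event of
    probability below \<open>e / 4\<close> costs at most twice its probability.\<close>
  define d where "d = e / (2 * q)"
  have d: "0 < d" using e q by (simp add: d_def)
  then have "norm t * d < q * d" using q by simp
  also have "q * d = e / 2" using q by (simp add: d_def)
  finally have td: "norm t * d < e / 2" .
  have "\<forall>\<^sub>F n in sequentially. measure (N n) {\<omega> \<in> space (N n). d < dist (A n \<omega>) 0} < e / 4"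
    using e by (intro tendsto_in_probD[OF A d]) simp
  then have "\<forall>\<^sub>F n in sequentially. norm ((LINT \<omega>|N n. cos (t \<bullet> (A n \<omega> + Z n \<omega>) + c))
      - (LINT \<omega>|N n. cos (t \<bullet> Z n \<omega> + c)) - 0) < e"
  proof eventually_elim
    case (elim n)
    interpret prob_space "N n" by (rule N)
    note [measurable] = tendsto_in_prob_measurable[OF A] Z
    let ?B = "{\<omega> \<in> space (N n). d < norm (A n \<omega>)}"
    have B: "?B \<in> sets (N n)" by measurable
    have int: "integrable (N n) (\<lambda>\<omega>. cos (t \<bullet> (A n \<omega> + Z n \<omega>) + c))" "integrable (N n) (\<lambda>\<omega>. cos (t \<bullet> Z n \<omega> + c))"
      by (intro integrable_const_bound[of _ 1]; simp)+
    have ind: "integrable (N n) (\<lambda>\<omega>. 2 * indicator ?B \<omega> :: real)" "(LINT \<omega>|N n. indicator ?B \<omega>) = prob ?B"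
      using B by (auto intro!: integrable_mult_right integrable_real_indicator simp: less_top[symmetric] Int_def conj_commute)
    have "\<bar>LINT \<omega>|N n. cos (t \<bullet> (A n \<omega> + Z n \<omega>) + c) - cos (t \<bullet> Z n \<omega> + c)\<bar>
        \<le> (LINT \<omega>|N n. \<bar>cos (t \<bullet> (A n \<omega> + Z n \<omega>) + c) - cos (t \<bullet> Z n \<omega> + c)\<bar>)"
      by (rule integral_abs_bound)
    also have "\<dots> \<le> (LINT \<omega>|N n. norm t * d + 2 * indicator ?B \<omega>)"
    proof (rule integral_mono)
      fix \<omega> assume \<omega>: "\<omega> \<in> space (N n)"
      let ?x = "t \<bullet> (A n \<omega> + Z n \<omega>) + c" and ?y = "t \<bullet> Z n \<omega> + c"
      show "\<bar>cos ?x - cos ?y\<bar> \<le> norm t * d + 2 * indicator ?B \<omega>"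
      proof (cases "\<omega> \<in> ?B")
        case True
        have "\<bar>cos ?x - cos ?y\<bar> \<le> \<bar>cos ?x\<bar> + \<bar>cos ?y\<bar>" by (rule abs_triangle_ineq4)
        also have "\<dots> \<le> 1 + 1" by (intro add_mono abs_cos_le_one)
        also have "\<dots> \<le> norm t * d + 2 * indicator ?B \<omega>" using True d by simp
        finally show ?thesis .
      next
        case False
        have "\<bar>cos ?x - cos ?y\<bar> = 2 * (\<bar>sin ((?x + ?y) / 2)\<bar> * \<bar>sin ((?y - ?x) / 2)\<bar>)"
          unfolding cos_diff_cos by (simp add: abs_mult)
        also have "\<dots> \<le> 2 * (1 * \<bar>(?y - ?x) / 2\<bar>)"
          by (intro mult_left_mono mult_mono abs_sin_le_one abs_sin_x_le_abs_x) auto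
        also have "\<dots> = \<bar>t \<bullet> A n \<omega>\<bar>" by (simp add: inner_simps)
        also have "\<dots> \<le> norm t * norm (A n \<omega>)" by (rule Cauchy_Schwarz_ineq2)
        also have "\<dots> \<le> norm t * d + 2 * indicator ?B \<omega>"
          using False \<omega> by (simp add: mult_left_mono)
        finally show ?thesis .
      qed
    qed (use int ind in auto)
    also have "\<dots> = norm t * d + 2 * prob ?B"
      using ind by (simp add: prob_space)
    also have "\<dots> < e" using elim td by simp
    finally show ?case using int by simp
  qed
  then show "\<exists>no. \<forall>n\<ge>no. norm ((LINT \<omega>|N n. cos (t \<bullet> (A n \<omega> + Z n \<omega>) + c))
      - (LINT \<omega>|N n. cos (t \<bullet> Z n \<omega> + c)) - 0) < e"
    by (simp add: eventually_sequentially)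
qed

section \<open>From asymptotic linearity to a normal limit\<close>

lemma sqrt_scale_average:
  "sqrt (real n) *\<^sub>R (x - (1 / real n) *\<^sub>R y) = sqrt (real n) *\<^sub>R x - (1 / sqrt (real n)) *\<^sub>R (y :: 'b::real_vector)"
\<comment> \<open>For \<open>n = 0\<close> both sides vanish, as \<open>sqrt 0 = 0\<close> and
  \<open>1 / 0 = 0\<close>.\<close>
proof (cases "n = 0")
  case False
  then have "sqrt (real n) / real n = 1 / sqrt (real n)"
    by (simp add: field_simps)
  then show ?thesis by (simp add: scaleR_diff_right)
qed simp

text \<open>Up to a vanishing term the scaled error is a normalized sum, so its cosine integrals are
  governed by the scalar limit theorem for \<open>t \<bullet> \<psi>\<close>, whose variance is the
  quadratic form of the information bound. The first conclusion supplies tightness of the initial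
  estimator, the second the limit law of the constrained one.\<close>

lemma asymptotically_linear_imp_normal:
  fixes \<psi> :: "'x \<Rightarrow> real^'k"
  assumes N: "prob_space N" and \<psi>: "\<And>i. (\<lambda>x. \<psi> x $ i) \<in> L2_zero_mean N"
    and T: "asymptotically_linear N T \<theta> \<psi>"
  shows "bounded_in_prob (sample N) (\<lambda>n x. sqrt (real n) *\<^sub>R (T n x - \<theta>))"
    and "tendsto_in_distribution (sample N) (\<lambda>n x. sqrt (real n) *\<^sub>R (T n x - \<theta>))
      (multivariate_normal 0 (information_bound N \<psi>))"
proof -
  define A where "A n x = sqrt (real n) *\<^sub>R (T n x - \<theta> - (1 / real n) *\<^sub>R (\<Sum>i<n. \<psi> (x i)))" for n and x :: "nat \<Rightarrow> 'x"
  define Z where "Z n x = (1 / sqrt (real n)) *\<^sub>R (\<Sum>i<n. \<psi> (x i))" for n and x :: "nat \<Rightarrow> 'x"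
  have A: "tendsto_in_prob (sample N) A 0"
    using T unfolding asymptotically_linear_def A_def .
  have Z: "bounded_in_prob (sample N) Z"
    unfolding Z_def by (rule bounded_in_prob_normalized_sum[OF N \<psi>])
  have fin: "finite_measure (sample N n)" for n
    using prob_space_sample[OF N] by (simp add: prob_space_def)
  have eq: "sqrt (real n) *\<^sub>R (T n x - \<theta>) = A n x + Z n x" for n x
    by (simp add: A_def Z_def sqrt_scale_average)
  show bdd: "bounded_in_prob (sample N) (\<lambda>n x. sqrt (real n) *\<^sub>R (T n x - \<theta>))"
    unfolding eq by (intro bounded_in_prob_add fin tendsto_in_prob_imp_bounded[OF A] Z)
  have \<psi>': "(\<lambda>x. \<psi> x $ i) \<in> L2_functions N" for i
    using \<psi>[of i] by (simp add: L2_zero_mean_iff)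
  have psd: "transpose (information_bound N \<psi>) = information_bound N \<psi>"
    "0 \<le> u \<bullet> (information_bound N \<psi> *v u)" for u
    by (simp_all add: transpose_information_bound information_bound_quadratic_form[OF \<psi>'])
  show "tendsto_in_distribution (sample N) (\<lambda>n x. sqrt (real n) *\<^sub>R (T n x - \<theta>))
      (multivariate_normal 0 (information_bound N \<psi>))"
  proof (rule tendsto_in_distribution_cosI[OF prob_space_sample[OF N]
        prob_space_multivariate_normal[OF psd] sets_multivariate_normal[OF psd] bdd])
    fix t c
    have "(\<lambda>x. t \<bullet> \<psi> x) \<in> L2_zero_mean N"
      using N by (intro L2_zero_mean_inner \<psi>) (simp add: prob_space_def)
    from clt_cos[OF N this, of c]
    have "(\<lambda>n. LINT x|sample N n. cos (t \<bullet> Z n x + c)) \<longlonglongrightarrow> cos c * exp (- (t \<bullet> (information_bound N \<psi> *v t)) / 2)"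
      by (simp add: Z_def inner_sum_right information_bound_quadratic_form[OF \<psi>'])
    from tendsto_add[OF integral_cos_perturbation[OF prob_space_sample[OF N] A bounded_in_prob_measurable[OF Z], of t c] this]
    show "(\<lambda>n. LINT x|sample N n. cos (t \<bullet> (sqrt (real n) *\<^sub>R (T n x - \<theta>)) + c))
        \<longlonglongrightarrow> (LINT y|multivariate_normal 0 (information_bound N \<psi>). cos (t \<bullet> y + c))"
      unfolding multivariate_normal_cos[OF psd] eq by simp
  qed
qed

lemma information_bound_matrix_mult:
  fixes M :: "real^'k^'k"
  assumes \<psi>: "\<And>i. (\<lambda>x. \<psi> x $ i) \<in> L2_functions N"
  shows "information_bound N (\<lambda>x. M *v \<psi> x) = M ** information_bound N \<psi> ** transpose M"
proof -
  have "(M ** information_bound N \<psi> ** transpose M) $ i $ j = (LINT x|N. (M *v \<psi> x) $ i * (M *v \<psi> x) $ j)" for i j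
  proof -
    have "(LINT x|N. (M *v \<psi> x) $ i * (M *v \<psi> x) $ j)
        = (LINT x|N. (\<Sum>a\<in>UNIV. \<Sum>b\<in>UNIV. M $ i $ a * M $ j $ b * (\<psi> x $ a * \<psi> x $ b)))"
      by (simp add: matrix_vector_mult_def sum_product mult_ac)
    also have "\<dots> = (\<Sum>a\<in>UNIV. \<Sum>b\<in>UNIV. M $ i $ a * M $ j $ b * (LINT x|N. \<psi> x $ a * \<psi> x $ b))"
      using L2_functions_mult_integrable[OF \<psi> \<psi>] by (simp add: Bochner_Integration.integral_sum)
    also have "\<dots> = (\<Sum>b\<in>UNIV. \<Sum>a\<in>UNIV. M $ i $ a * M $ j $ b * (LINT x|N. \<psi> x $ a * \<psi> x $ b))"
      by (rule sum.swap)
    also have "\<dots> = (M ** information_bound N \<psi> ** transpose M) $ i $ j"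
      by (simp add: matrix_matrix_mult_def information_bound_def transpose_def sum_distrib_left sum_distrib_right mult_ac)
    finally show ?thesis by simp
  qed
  then show ?thesis by (simp add: vec_eq_iff information_bound_def)
qed


theorem theorem3p1:
  fixes X :: "'x measure" and \<Theta> :: "(real^'k) set" and \<G> :: "'g set"
    and P :: "real^'k \<Rightarrow> 'g \<Rightarrow> 'x measure"
    and ell :: "real^'k \<Rightarrow> 'g \<Rightarrow> 'x \<Rightarrow> real^'k"
    and S :: "real^'k \<Rightarrow> real^'d" and DS :: "real^'k \<Rightarrow> real^'k^'d"
    and \<theta>_hat \<theta>_star \<theta>_tilde :: "nat \<Rightarrow> (nat \<Rightarrow> 'x) \<Rightarrow> real^'k"
    and I_hat :: "nat \<Rightarrow> (nat \<Rightarrow> 'x) \<Rightarrow> real^'k^'k"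
    and nrm :: "real^'k \<Rightarrow> real"
  defines "info \<equiv> \<lambda>\<theta> G. efficient_information (P \<theta> G) (ell \<theta> G)"
    and "Q \<equiv> submodel P {\<theta> \<in> \<Theta>. S \<theta> = 0} \<G>"
    and "ell_Q \<equiv> \<lambda>\<theta> G x. ell \<theta> G x
           - constraint_gain (DS \<theta>) (efficient_information (P \<theta> G) (ell \<theta> G))
               *v (DS \<theta> *v ell \<theta> G x)"
  assumes dim: "CARD('d) < CARD('k)"
    and model: "regular_semiparametric_model X \<Theta> \<G> P ell"
    and S_deriv: "\<And>\<theta>. (S has_derivative (\<lambda>v. DS \<theta> *v v)) (at \<theta>)"
    and DS_cont: "continuous_on UNIV DS"
    and full_rank: "\<And>\<theta>. \<theta> \<in> \<Theta> \<Longrightarrow> rank (DS \<theta>) = CARD('d)"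
    and Q_nonempty: "Q \<noteq> {}"
    and hat_measurable: "\<And>n. \<theta>_hat n \<in> borel_measurable (sample X n)"
    and hat_efficient: "\<And>\<theta> G. \<theta> \<in> \<Theta> \<Longrightarrow> G \<in> \<G> \<Longrightarrow>
          asymptotically_linear (P \<theta> G) \<theta>_hat \<theta> (ell \<theta> G)"
    and I_hat_measurable: "\<And>n. I_hat n \<in> borel_measurable (sample X n)"
    and I_hat_consistent: "\<And>\<theta> G. \<theta> \<in> \<Theta> \<Longrightarrow> G \<in> \<G> \<Longrightarrow>
          tendsto_in_prob (sample (P \<theta> G)) I_hat (info \<theta> G)"
    and inverses_exist: "\<And>\<theta> G. \<theta> \<in> \<Theta> \<Longrightarrow> G \<in> \<G> \<Longrightarrow>
          (\<lambda>n. measure (sample (P \<theta> G) n)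
                 {x \<in> space (sample (P \<theta> G) n).
                    gain_inverses_exist (DS (\<theta>_hat n x)) (I_hat n x)}) \<longlonglongrightarrow> 1"
    and star_measurable: "\<And>n. \<theta>_star n \<in> borel_measurable (sample X n)"
    and star_eq: "\<And>n x. x \<in> space (sample X n) \<Longrightarrow>
          gain_inverses_exist (DS (\<theta>_hat n x)) (I_hat n x) \<Longrightarrow>
          \<theta>_star n x =
            \<theta>_hat n x - constraint_gain (DS (\<theta>_hat n x)) (I_hat n x) *v S (\<theta>_hat n x)"
    and norm: "equivalent_norm nrm"
    and tilde_measurable: "\<And>n. \<theta>_tilde n \<in> borel_measurable (sample X n)"
    and tilde_minimizer: "\<And>n x. x \<in> space (sample X n) \<Longrightarrow>
          is_arg_min (\<lambda>\<zeta>. nrm (\<zeta> - \<theta>_star n x)) (\<lambda>\<zeta>. S \<zeta> = 0) (\<theta>_tilde n x)"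
  shows "\<forall>\<theta>\<in>\<Theta>. \<forall>G\<in>\<G>. S \<theta> = 0 \<longrightarrow>
     efficient_influence_function (parameter P \<Theta> \<G>) Q (P \<theta> G) (ell_Q \<theta> G) \<and>
     asymptotically_linear (P \<theta> G) \<theta>_tilde \<theta> (ell_Q \<theta> G) \<and>
     tendsto_in_distribution (sample (P \<theta> G))
       (\<lambda>n x. sqrt (real n) *\<^sub>R (\<theta>_tilde n x - \<theta>))
       (multivariate_normal 0
          (matrix_inv (info \<theta> G)
             - constraint_gain (DS \<theta>) (info \<theta> G) ** DS \<theta> ** matrix_inv (info \<theta> G))) \<and>
     tendsto_in_prob (sample (P \<theta> G))
       (\<lambda>n x. sqrt (real n) *\<^sub>R (\<theta>_tilde n x - \<theta>_star n x)) 0"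
proof (intro ballI impI)
  fix \<theta> G
  assume \<theta>: "\<theta> \<in> \<Theta>" and G: "G \<in> \<G>" and S0: "S \<theta> = 0"
  interpret regular_semiparametric_model X \<Theta> \<G> P ell by (fact model)
  let ?N = "P \<theta> G" and ?\<psi> = "ell \<theta> G"
  have N: "prob_space ?N" by (rule prob[OF \<theta> G])
  note \<psi> = ell_L2(2)[OF \<theta> G]
  define D where "D = DS \<theta>"
  define B where "B = information_bound ?N ?\<psi>"
  have info: "info \<theta> G = matrix_inv B"
    by (simp add: info_def efficient_information_def B_def)
  define K where "K = constraint_gain D (matrix_inv B)"
  define M where "M = mat 1 - K ** D"
  have B: "invertible B" "transpose B = B"
    using information_exists[OF \<theta> G] by (simp_all add: B_def transpose_information_bound)
  have pos: "0 < x \<bullet> (B *v x)" if "x \<noteq> 0" for x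
    unfolding B_def by (rule information_bound_pos_def[OF \<psi> information_exists[OF \<theta> G] that])
  note gain = full_rank[OF \<theta>, folded D_def] B pos
  have DM: "D ** M = 0"
    unfolding M_def K_def by (rule constraint_gain_complement[OF gain])
  have ell_Q: "ell_Q \<theta> G = (\<lambda>x. M *v ?\<psi> x)"
    by (simp add: ell_Q_def M_def K_def D_def B_def efficient_information_def
        matrix_vector_mult_diff_rdistrib matrix_vector_mul_assoc)
  have eif_Q: "efficient_influence_function (parameter P \<Theta> \<G>) Q ?N (ell_Q \<theta> G)"
    unfolding Q_def ell_Q_def
    by (rule efficient_influence_function_constrained[OF \<theta> G S0 S_deriv DS_cont full_rank[OF \<theta>]])
  have fin: "finite_measure (sample ?N n)" for n
    using prob_space_sample[OF N] by (simp add: prob_space_def)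
  have sets: "sets (sample X n) = sets (sample ?N n)" for n
    unfolding sample_def using sets_eq[OF \<theta> G] by (intro sets_PiM_cong) auto
  have space: "space (sample ?N n) = space (sample X n)" for n
    by (rule sets_eq_imp_space_eq[OF sets[symmetric]])
  note [measurable] = borel_measurable_sets_eq[OF hat_measurable sets]
    borel_measurable_sets_eq[OF star_measurable sets] borel_measurable_sets_eq[OF tilde_measurable sets]

  \<comment> \<open>\<open>Y1\<close> is the scaled deviation of the update from its linearization
    and \<open>Y2\<close> the scaled displacement by the projection; \<open>V\<close>, the scaled
    error of the update, must be tight for the projection estimate.\<close>
  define R where "R n x = sqrt (real n) *\<^sub>R (\<theta>_hat n x - \<theta> - (1 / real n) *\<^sub>R (\<Sum>i<n. ?\<psi> (x i)))" for n x
  define U where "U n x = sqrt (real n) *\<^sub>R (\<theta>_hat n x - \<theta>)" for n x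
  define Y1 where "Y1 n x = sqrt (real n) *\<^sub>R (\<theta>_star n x - \<theta> - M *v (\<theta>_hat n x - \<theta>))" for n x
  define Y2 where "Y2 n x = sqrt (real n) *\<^sub>R (\<theta>_tilde n x - \<theta>_star n x)" for n x
  define V where "V n x = sqrt (real n) *\<^sub>R (\<theta>_star n x - \<theta>)" for n x

  have R: "tendsto_in_prob (sample ?N) R 0"
    using hat_efficient[OF \<theta> G] unfolding asymptotically_linear_def R_def .
  have U: "bounded_in_prob (sample ?N) U"
    unfolding U_def
    by (rule asymptotically_linear_imp_normal(1)[OF N ell_L2(1)[OF \<theta> G] hat_efficient[OF \<theta> G]])
  \<comment> \<open>At sample points where \<open>U\<close> is bounded and \<open>I_hat\<close> is
    near its limit, the inverses exist for large \<open>n\<close>, so \<open>star_eq\<close>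
    determines \<open>\<theta>_star\<close> there.\<close>
  have Y1: "tendsto_in_prob (sample ?N) Y1 0"
  proof (rule tendsto_in_prob_transfer[OF fin _ U I_hat_consistent[OF \<theta> G, unfolded info]])
    show "Y1 n \<in> borel_measurable (sample ?N n)" for n
      unfolding Y1_def by measurable
    fix L e :: real assume e: "0 < e"
    have inv: "gain_inverses_exist (DS \<theta>) (matrix_inv B)"
      using constraint_gain_inverses_exist[OF gain] by (simp add: D_def)
    obtain d where d: "0 < d" "\<forall>\<^sub>F n in sequentially. \<forall>\<zeta> J s. norm (sqrt n *\<^sub>R (\<zeta> - \<theta>)) \<le> L \<longrightarrow>
       dist J (matrix_inv B) \<le> d \<longrightarrow>
       (gain_inverses_exist (DS \<zeta>) J \<longrightarrow> s = \<zeta> - constraint_gain (DS \<zeta>) J *v S \<zeta>) \<longrightarrow>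
       norm (sqrt n *\<^sub>R (s - \<theta> - (mat 1 - constraint_gain (DS \<theta>) (matrix_inv B) ** DS \<theta>) *v (\<zeta> - \<theta>))) \<le> e"
      by (rule one_step_expansion[OF S_deriv S0 DS_cont inv e])
    from d(2) have "\<forall>\<^sub>F n in sequentially. \<forall>x\<in>space (sample ?N n).
        norm (U n x) \<le> L \<longrightarrow> dist (I_hat n x) (matrix_inv B) \<le> d \<longrightarrow> norm (Y1 n x) \<le> e"
    proof eventually_elim
      case (elim n)
      show ?case
        unfolding U_def Y1_def M_def K_def D_def space
        using elim star_eq by simp
    qed
    with d(1) show "\<exists>d>0. \<forall>\<^sub>F n in sequentially. \<forall>x\<in>space (sample ?N n).
        norm (U n x) \<le> L \<longrightarrow> dist (I_hat n x) (matrix_inv B) \<le> d \<longrightarrow> norm (Y1 n x) \<le> e"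
      by (intro exI[of _ d] conjI)
  qed
  have V_eq: "V n x = Y1 n x + M *v U n x" for n x
    unfolding V_def Y1_def U_def matrix_vector_mult_scaleR scaleR_add_right[symmetric] by simp
  have V: "bounded_in_prob (sample ?N) V"
    unfolding V_eq[abs_def]
    by (intro bounded_in_prob_add bounded_in_prob_matrix_mult tendsto_in_prob_imp_bounded fin U Y1)
  \<comment> \<open>The part of \<open>V\<close> that does not vanish is \<open>M *v U n x\<close>,
    and \<open>D ** M = 0\<close> removes it; hence the linearized constraint residual of the update
    is negligible at the required rate.\<close>
  have W_eq: "sqrt (real n) *\<^sub>R (DS \<theta> *v (\<theta>_star n x - \<theta>)) = D *v Y1 n x" for n x
  proof -
    have "sqrt (real n) *\<^sub>R (DS \<theta> *v (\<theta>_star n x - \<theta>)) = D *v V n x"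
      by (simp add: V_def D_def matrix_vector_mult_scaleR)
    also have "\<dots> = D *v Y1 n x + (D ** M) *v U n x"
      by (simp add: V_eq matrix_vector_right_distrib matrix_vector_mul_assoc)
    finally show ?thesis by (simp add: DM)
  qed
  have Y2: "tendsto_in_prob (sample ?N) Y2 0"
  proof (rule tendsto_in_prob_transfer[OF fin _ V tendsto_in_prob_matrix_mult[OF fin Y1, of D]])
    show "Y2 n \<in> borel_measurable (sample ?N n)" for n
      unfolding Y2_def by measurable
    fix L e :: real assume e: "0 < e"
    obtain d where d: "0 < d" "\<forall>\<^sub>F n in sequentially. \<forall>s t. norm (sqrt n *\<^sub>R (s - \<theta>)) \<le> L \<longrightarrow>
       norm (sqrt n *\<^sub>R (DS \<theta> *v (s - \<theta>))) \<le> d \<longrightarrow>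
       is_arg_min (\<lambda>\<zeta>. nrm (\<zeta> - s)) (\<lambda>\<zeta>. S \<zeta> = 0) t \<longrightarrow> norm (sqrt n *\<^sub>R (t - s)) \<le> e"
      by (rule projection_error[OF S_deriv S0 DS_cont full_rank[OF \<theta>] norm e])
    from d(2) have "\<forall>\<^sub>F n in sequentially. \<forall>x\<in>space (sample ?N n).
        norm (V n x) \<le> L \<longrightarrow> dist (D *v Y1 n x) 0 \<le> d \<longrightarrow> norm (Y2 n x) \<le> e"
    proof eventually_elim
      case (elim n)
      show ?case
        unfolding V_def Y2_def W_eq[symmetric] space dist_0_norm dist_norm diff_0_right
        using elim tilde_minimizer by blast
    qed
    with d(1) show "\<exists>d>0. \<forall>\<^sub>F n in sequentially. \<forall>x\<in>space (sample ?N n).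
        norm (V n x) \<le> L \<longrightarrow> dist (D *v Y1 n x) 0 \<le> d \<longrightarrow> norm (Y2 n x) \<le> e"
      by (intro exI[of _ d] conjI)
  qed
  have linear: "asymptotically_linear ?N \<theta>_tilde \<theta> (ell_Q \<theta> G)"
  proof -
    \<comment> \<open>Applying the linear map \<open>M\<close> to the expansion of the initial
      estimator turns its influence function into the constrained one.\<close>
    have "sqrt (real n) *\<^sub>R (\<theta>_tilde n x - \<theta> - (1 / real n) *\<^sub>R (\<Sum>i<n. M *v ?\<psi> (x i)))
        = Y2 n x + (Y1 n x + M *v R n x)" for n x
    proof -
      have "M *v R n x = sqrt (real n) *\<^sub>R (M *v (\<theta>_hat n x - \<theta>) - (1 / real n) *\<^sub>R (\<Sum>i<n. M *v ?\<psi> (x i)))"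
        by (simp add: R_def matrix_vector_mult_scaleR matrix_vector_mult_diff_distrib
            linear_sum[OF matrix_vector_mul_linear])
      then show ?thesis
        unfolding Y1_def Y2_def by (simp add: scaleR_diff_right)
    qed
    moreover have "tendsto_in_prob (sample ?N) (\<lambda>n x. Y2 n x + (Y1 n x + M *v R n x)) 0"
      by (intro tendsto_in_prob_add tendsto_in_prob_matrix_mult fin R Y1 Y2)
    ultimately show ?thesis
      unfolding asymptotically_linear_def ell_Q by simp
  qed
  \<comment> \<open>Symmetry of \<open>M ** B\<close> and \<open>D ** M = 0\<close> absorb the
    second factor \<open>M\<close> of the covariance.\<close>
  have "information_bound ?N (ell_Q \<theta> G) = M ** B ** transpose M"
    unfolding ell_Q B_def by (rule information_bound_matrix_mult[OF \<psi>])
  also have "\<dots> = M ** B"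
    unfolding M_def K_def by (rule constraint_gain_idempotent[OF gain])
  also have "\<dots> = matrix_inv (info \<theta> G)
      - constraint_gain (DS \<theta>) (info \<theta> G) ** DS \<theta> ** matrix_inv (info \<theta> G)"
    by (simp add: info matrix_inv_matrix_inv[OF B(1)] M_def K_def D_def matrix_diff_rdistrib)
  finally have cov: "information_bound ?N (ell_Q \<theta> G) = matrix_inv (info \<theta> G)
      - constraint_gain (DS \<theta>) (info \<theta> G) ** DS \<theta> ** matrix_inv (info \<theta> G)" .
  have \<psi>Q0: "(\<lambda>x. ell_Q \<theta> G x $ i) \<in> L2_zero_mean ?N" for i
    using eif_Q unfolding efficient_influence_function_def pathwise_gradient_def by blast
  show "efficient_influence_function (parameter P \<Theta> \<G>) Q ?N (ell_Q \<theta> G) \<and>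
     asymptotically_linear ?N \<theta>_tilde \<theta> (ell_Q \<theta> G) \<and>
     tendsto_in_distribution (sample ?N)
       (\<lambda>n x. sqrt (real n) *\<^sub>R (\<theta>_tilde n x - \<theta>))
       (multivariate_normal 0
          (matrix_inv (info \<theta> G)
             - constraint_gain (DS \<theta>) (info \<theta> G) ** DS \<theta> ** matrix_inv (info \<theta> G))) \<and>
     tendsto_in_prob (sample ?N)
       (\<lambda>n x. sqrt (real n) *\<^sub>R (\<theta>_tilde n x - \<theta>_star n x)) 0"
    using eif_Q linear asymptotically_linear_imp_normal(2)[OF N \<psi>Q0 linear] Y2
    unfolding cov Y2_def by blast
qed

end
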